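(* Assume that $(E,\mathcal E)$ is a Borel space. Let $\Phi\in L^2(E;\mathbb D^{1,2}(H))\subset L^2(\Omega\times E;H)$ be such that $D_x\Phi\in\mathrm{dom}(\delta^{(2)})$ for $\mu$-almost all $x\in E$, and assume that $\mathbb E\int_E\|\delta(D_x\Phi)\|^2\,\mu(\mathrm dx)<\infty$. Then $\delta(\Phi)\in\mathbb D^{1,2}(H)$ and $$D_x\delta(\Phi)=\delta(D_x\Phi)+\Phi(x)$$ as an equality in $L^2(\Omega\times E;H)$.
   Context: Setting: $(E,\mathcal E,\mu)$ is a $\sigma$-finite measure space such that the diagonal $\{(x,y)\in E\times E:x=y\}$ belongs to $\mathcal E\otimes\mathcal E$. $(E,\mathcal E)$ is a Borel space if there is a measurable bijection with measurable inverse from $E$ onto a Borel subset of $[0,1]$. $\mathbf N$ is the space of all $\sigma$-finite $\mathbb N_0\cup\{+\infty\}$-valued measures on $(E,\mathcal E)$ with the $\sigma$-algebra generated by the maps $\eta\mapsto\eta(B)$, $B\in\mathcal E$. $(\Omega,\mathcal F,\mathbb P)$ is a complete probability space, $N:\Omega\to\mathbf N$ is a Poisson random measure with intensity measure $\mu$, represented as $N=\sum_{n=1}^{N(E)}\delta_{X_n}$ with $E$-valued random variables $X_1,X_2,\dots$, and $\mathcal F$ is the $\mathbb P$-completion of $\sigma(N)$. $H$ is a separable real Hilbert space with inner product $\langle\cdot,\cdot\rangle$ and norm $\|\cdot\|$. $L^0(\cdot;H)$ denotes equivalence classes of strongly measurable functions and $L^p(\cdot;H)$ the usual Bochner spaces;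 product spaces carry product measures ($\Omega$ carries $\mathbb P$, $E$ carries $\mu$). Difference operator: for $F\in L^0(\Omega;H)$, $D_xF:=f(N+\delta_x)-f(N)$, where $f:\mathbf N\to H$ is measurable with $F=f(N)$ a.s. For $\Phi\in L^0(\Omega\times E;H)$ with $\Phi(y)=\varphi(N,y)$ $\mathbb P\otimes\mu$-a.e., $\varphi:\mathbf N\times E\to H$ measurable, $D_x\Phi(y):=\varphi(N+\delta_x,y)-\varphi(N,y)$, so $D\Phi\in L^0(\Omega\times E\times E;H)$, and for fixed $x$, $D_x\Phi=(D_x\Phi(y))_{y\in E}$ is a random function on $E$. These are a.e. independent of the representatives. Sobolev space: for $p>1$, $\mathbb D^{1,p}(H)$ is the space of $F\in L^p(\Omega;H)$ with $DF\in L^p(\Omega\times E;H)$, with norm $(\|F\|_{L^p(\Omega;H)}^p+\|DF\|_{L^p(\Omega\times E;H)}^p)^{1/p}$. Kabanov–Skorohod integral: $\delta^{(2)}:\mathrm{dom}(\delta^{(2)})\subset L^2(\Omega\times E;H)\to L^2(\Omega;H)$ is the adjoint of the densely defined operator $D|_{\mathbb D^{1,2}(H)}:\mathbb D^{1,2}(H)\subset L^2(\Omega;H)\to L^2(\Omega\times E;H)$; one writes $\delta(\Phi):=\delta^{(2)}(\Phi)$. It is a fact that $L^2(E;\mathbb D^{1,2}(H))\subset\mathrm{dom}(\delta^{(2)})$, so $\delta(\Phi)$ in the claim is defined. $\delta(D_x\Phi)$ is the integral applied, for $\mu$-almost every fixed $x$, to $D_x\Phi$; the $x$-dependent family is regarded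 as an element of $L^0(E;L^2(\Omega;H))\subset L^0(\Omega\times E;H)$. *)

theory Defs
  imports "HOL-Probability.Probability"
begin

text \<open>
  Conventions: \<open>P\<close> is the probability measure on \<open>\<Omega>\<close>, \<open>M\<close> the intensity measure \<open>\<mu>\<close> on \<open>E\<close>, and
  \<open>N\<close> the point process.  Elements of \<open>L\<^sup>0\<close> and \<open>L\<^sup>p\<close> are handled through representatives, so
  that equality of classes is almost everywhere equality; operators that are defined only up to
  null sets pick an arbitrary representative with \<open>SOME\<close>.  Separable real Hilbert spaces are
  types of sort \<open>{real_inner, banach, second_countable_topology}\<close>; for these, strong
  measurability is Borel measurability.
\<close>

definition borel_space :: "'e measure \<Rightarrow> bool" where
  "borel_space M \<longleftrightarrow>
    (\<exists>(g :: 'e \<Rightarrow> real) B. B \<in> sets borel \<and> B \<subseteq> {0..1} \<and> bij_betw g (space M) B \<and>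
       g \<in> M \<rightarrow>\<^sub>M restrict_space borel B \<and>
       the_inv_into (space M) g \<in> restrict_space borel B \<rightarrow>\<^sub>M M)"

definition point_measures :: "'e measure \<Rightarrow> 'e measure set" where
  "point_measures M =
    {\<eta>. sets \<eta> = sets M \<and> sigma_finite_measure \<eta> \<and>
        (\<forall>B\<in>sets M. emeasure \<eta> B \<in> insert \<infinity> (range of_nat))}"

text \<open>The measurable space \<open>\<^bold>N\<close>, built like \<open>subprob_algebra\<close> in the library.\<close>

definition point_algebra :: "'e measure \<Rightarrow> 'e measure measure" where
  "point_algebra M =
    (SUP B\<in>sets M. vimage_algebra (point_measures M) (\<lambda>\<eta>. emeasure \<eta> B) borel)"

definition add_point :: "'e measure \<Rightarrow> 'e \<Rightarrow> 'e measure" where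
  "add_point \<eta> x = measure_of (space \<eta>) (sets \<eta>) (\<lambda>B. emeasure \<eta> B + indicator B x)"

definition poisson_random_measure ::
    "'w measure \<Rightarrow> 'e measure \<Rightarrow> ('w \<Rightarrow> 'e measure) \<Rightarrow> bool" where
  "poisson_random_measure P M N \<longleftrightarrow>
    N \<in> P \<rightarrow>\<^sub>M point_algebra M \<and>
    (\<forall>B\<in>sets M.
       if emeasure M B = \<infinity> then (AE \<omega> in P. emeasure (N \<omega>) B = \<infinity>)
       else (\<forall>k::nat. measure P {\<omega> \<in> space P. emeasure (N \<omega>) B = of_nat k}
                      = measure M B ^ k / fact k * exp (- measure M B))) \<and>
    (\<forall>(B :: nat \<Rightarrow> 'e set) m. (\<forall>i<m. B i \<in> sets M) \<longrightarrow> disjoint_family_on B {..<m} \<longrightarrow>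
       prob_space.indep_vars P (\<lambda>_. borel) (\<lambda>i \<omega>. emeasure (N \<omega>) (B i)) {..<m})"

text \<open>The representation \<open>N = \<Sum>n=1..N(E). \<delta>(X\<^sub>n)\<close>, with the \<open>X\<^sub>n\<close> indexed from \<open>0\<close>.\<close>

definition point_representation ::
    "'w measure \<Rightarrow> 'e measure \<Rightarrow> ('w \<Rightarrow> 'e measure) \<Rightarrow> (nat \<Rightarrow> 'w \<Rightarrow> 'e) \<Rightarrow> bool" where
  "point_representation P M N X \<longleftrightarrow>
    (\<forall>n. X n \<in> P \<rightarrow>\<^sub>M M) \<and>
    (\<forall>\<omega>\<in>space P. \<forall>B\<in>sets M. emeasure (N \<omega>) B =
       (\<Sum>n. if of_nat n < emeasure (N \<omega>) (space M) then indicator B (X n \<omega>) else 0))"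

definition Lp :: "real \<Rightarrow> 'a measure \<Rightarrow> ('a \<Rightarrow> 'h::real_normed_vector) set" where
  "Lp p m = {f \<in> borel_measurable m. integrable m (\<lambda>z. norm (f z) powr p)}"

definition Lp_norm :: "real \<Rightarrow> 'a measure \<Rightarrow> ('a \<Rightarrow> 'h::real_normed_vector) \<Rightarrow> real" where
  "Lp_norm p m f = (\<integral>z. norm (f z) powr p \<partial>m) powr (1 / p)"

definition diff_op ::
    "'w measure \<Rightarrow> 'e measure \<Rightarrow> ('w \<Rightarrow> 'e measure) \<Rightarrow>
     ('w \<Rightarrow> 'h::real_normed_vector) \<Rightarrow> 'w \<times> 'e \<Rightarrow> 'h" where
  "diff_op P M N F =
    (let f = (SOME f. f \<in> borel_measurable (point_algebra M) \<and> (AE \<omega> in P. F \<omega> = f (N \<omega>)))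
     in (\<lambda>(\<omega>, x). f (add_point (N \<omega>) x) - f (N \<omega>)))"

text \<open>\<open>diff_field P M N \<Phi> x\<close> is the random function \<open>D\<^sub>x\<Phi>\<close> on \<open>E\<close>, for fixed \<open>x\<close>.\<close>

definition diff_field ::
    "'w measure \<Rightarrow> 'e measure \<Rightarrow> ('w \<Rightarrow> 'e measure) \<Rightarrow>
     ('w \<times> 'e \<Rightarrow> 'h::real_normed_vector) \<Rightarrow> 'e \<Rightarrow> 'w \<times> 'e \<Rightarrow> 'h" where
  "diff_field P M N \<Phi> x =
    (let \<phi> = (SOME \<phi>. \<phi> \<in> borel_measurable (point_algebra M \<Otimes>\<^sub>M M) \<and>
                      (AE (\<omega>, y) in P \<Otimes>\<^sub>M M. \<Phi> (\<omega>, y) = \<phi> (N \<omega>, y)))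
     in (\<lambda>(\<omega>, y). \<phi> (add_point (N \<omega>) x, y) - \<phi> (N \<omega>, y)))"

definition sobolev ::
    "real \<Rightarrow> 'w measure \<Rightarrow> 'e measure \<Rightarrow> ('w \<Rightarrow> 'e measure) \<Rightarrow>
     ('w \<Rightarrow> 'h::real_normed_vector) set" where
  "sobolev p P M N = {F \<in> Lp p P. diff_op P M N F \<in> Lp p (P \<Otimes>\<^sub>M M)}"

definition sobolev_norm ::
    "real \<Rightarrow> 'w measure \<Rightarrow> 'e measure \<Rightarrow> ('w \<Rightarrow> 'e measure) \<Rightarrow>
     ('w \<Rightarrow> 'h::real_normed_vector) \<Rightarrow> real" where
  "sobolev_norm p P M N F =
    (Lp_norm p P F powr p + Lp_norm p (P \<Otimes>\<^sub>M M) (diff_op P M N F) powr p) powr (1 / p)"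

text \<open>
  The Bochner space \<open>L\<^sup>2(E; D\<^sup>1\<^sup>,\<^sup>2(H))\<close>, as a set of functions on \<open>\<Omega> \<times> E\<close>: the sequence \<open>s\<close> of
  simple functions with values in the Sobolev space expresses strong measurability of
  \<open>x \<mapsto> \<Phi>(\<cdot>, x)\<close> with respect to the Sobolev norm.
\<close>

definition L2_sobolev ::
    "'w measure \<Rightarrow> 'e measure \<Rightarrow> ('w \<Rightarrow> 'e measure) \<Rightarrow>
     ('w \<times> 'e \<Rightarrow> 'h::real_normed_vector) set" where
  "L2_sobolev P M N =
    {\<Phi> \<in> Lp 2 (P \<Otimes>\<^sub>M M).
       (AE x in M. (\<lambda>\<omega>. \<Phi> (\<omega>, x)) \<in> sobolev 2 P M N) \<and>
       (\<exists>s :: nat \<Rightarrow> 'e \<Rightarrow> 'w \<Rightarrow> 'h.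
          (\<forall>n. simple_function M (s n) \<and> s n ` space M \<subseteq> sobolev 2 P M N) \<and>
          (AE x in M. (\<lambda>n. sobolev_norm 2 P M N (\<lambda>\<omega>. s n x \<omega> - \<Phi> (\<omega>, x))) \<longlonglongrightarrow> 0)) \<and>
       (\<integral>\<^sup>+ x. ennreal ((sobolev_norm 2 P M N (\<lambda>\<omega>. \<Phi> (\<omega>, x)))\<^sup>2) \<partial>M) < \<infinity>}"

text \<open>The Kabanov--Skorohod integral as the Hilbert space adjoint of \<open>D\<close> on \<open>D\<^sup>1\<^sup>,\<^sup>2(H)\<close>.\<close>

definition is_skorohod ::
    "'w measure \<Rightarrow> 'e measure \<Rightarrow> ('w \<Rightarrow> 'e measure) \<Rightarrow>
     ('w \<times> 'e \<Rightarrow> 'h::real_inner) \<Rightarrow> ('w \<Rightarrow> 'h) \<Rightarrow> bool" where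
  "is_skorohod P M N \<Phi> G \<longleftrightarrow>
    G \<in> Lp 2 P \<and>
    (\<forall>F\<in>sobolev 2 P M N.
       (\<integral>z. diff_op P M N F z \<bullet> \<Phi> z \<partial>(P \<Otimes>\<^sub>M M)) = (\<integral>\<omega>. F \<omega> \<bullet> G \<omega> \<partial>P))"

definition skorohod_dom ::
    "'w measure \<Rightarrow> 'e measure \<Rightarrow> ('w \<Rightarrow> 'e measure) \<Rightarrow> ('w \<times> 'e \<Rightarrow> 'h::real_inner) set" where
  "skorohod_dom P M N = {\<Phi> \<in> Lp 2 (P \<Otimes>\<^sub>M M). \<exists>G. is_skorohod P M N \<Phi> G}"

definition skorohod ::
    "'w measure \<Rightarrow> 'e measure \<Rightarrow> ('w \<Rightarrow> 'e measure) \<Rightarrow>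
     ('w \<times> 'e \<Rightarrow> 'h::real_inner) \<Rightarrow> 'w \<Rightarrow> 'h" where
  "skorohod P M N \<Phi> = (SOME G. is_skorohod P M N \<Phi> G)"

text \<open>
  The embedding of \<open>L\<^sup>0(E; L\<^sup>2(\<Omega>; H))\<close> into \<open>L\<^sup>0(\<Omega> \<times> E; H)\<close>.  It is needed because a family of
  representatives chosen separately for each \<open>x\<close> need not be jointly measurable.
\<close>

definition joint_version ::
    "'w measure \<Rightarrow> 'e measure \<Rightarrow> ('e \<Rightarrow> 'w \<Rightarrow> 'h::real_normed_vector) \<Rightarrow> 'w \<times> 'e \<Rightarrow> 'h" where
  "joint_version P M g =
    (SOME \<Psi>. \<Psi> \<in> borel_measurable (P \<Otimes>\<^sub>M M) \<and>
             (AE x in M. AE \<omega> in P. \<Psi> (\<omega>, x) = g x \<omega>))"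

definition skorohod_diff ::
    "'w measure \<Rightarrow> 'e measure \<Rightarrow> ('w \<Rightarrow> 'e measure) \<Rightarrow>
     ('w \<times> 'e \<Rightarrow> 'h::real_inner) \<Rightarrow> 'w \<times> 'e \<Rightarrow> 'h" where
  "skorohod_diff P M N \<Phi> = joint_version P M (\<lambda>x. skorohod P M N (diff_field P M N \<Phi> x))"

end

theory Submission
  imports Defs
begin

text \<open>
  Write \<open>\<gamma>(N)\<close> and \<open>\<phi>(N, \<cdot>)\<close> for representatives of \<open>\<delta>(\<Phi>)\<close> and \<open>\<Phi>\<close>.  The operators \<open>D\<close> and \<open>\<delta>\<close>
  are adjoint, so the claim can be tested: it has to be shown that \<open>\<gamma>(N + \<delta>\<^sub>x) - \<gamma>(N)\<close> and
  \<open>\<Phi>(x) + \<delta>(D\<^sub>x\<Phi>)\<close> have the same pairings with sufficiently many fields \<open>g\<close>.  For these \<open>g\<close> one has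
  \<open>\<^bold>E \<integral> \<langle>D\<^sub>x\<delta>(\<Phi>), g(x)\<rangle> = \<^bold>E \<langle>\<delta>(\<Phi>), \<delta>(g)\<rangle> = \<^bold>E \<integral> \<langle>\<Phi>(y), D\<^sub>y\<delta>(g)\<rangle>\<close>, and if the commutation relation
  \<open>D\<^sub>y\<delta>(g) = g(y) + \<delta>(D\<^sub>yg)\<close> is known for \<open>g\<close>, a further duality moves the second term to
  \<open>\<^bold>E \<integral>\<integral> \<langle>D\<^sub>x\<Phi>(y), D\<^sub>yg(x)\<rangle> = \<^bold>E \<integral> \<langle>\<delta>(D\<^sub>x\<Phi>), g(x)\<rangle>\<close>.  So the relation for \<open>\<Phi>\<close> follows from the one for
  elementary fields.

  The elementary fields are \<open>g(x) = 1\<^sub>S(N) 1\<^sub>B(x) h\<close>, where \<open>S\<close> prescribes the numbers of points in the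
  atoms of a finite partition and \<open>B\<close> lies in one atom.  Removing a point of \<open>B\<close> from a configuration
  shifts the counts by one, so \<open>\<delta>(g)\<close> is an explicit function of the counts, and all identities for \<open>g\<close>
  reduce to the Mecke formula (\<open>event_duality\<close>, \<open>event_commutation\<close>).  The state space is a Borel space, so its
  \<open>\<sigma>\<close>-algebra is countably generated; nested partitions then yield a countable \<open>\<inter>\<close>-stable generator on
  locally finite configurations (\<open>measure_eqI_boxes\<close>).  It gives the Mecke formula itself
  (\<open>mecke_measure\<close>), where on a box only the Poisson weights enter, and it shows that the countably many
  test fields determine the result for almost every single \<open>x\<close> (\<open>commutation\<close>).  Because the conclusion
  is obtained for each such \<open>x\<close> and its other terms are jointly measurable, it also produces the jointly
  measurable version of \<open>x \<mapsto> \<delta>(D\<^sub>x\<Phi>)\<close>.  Square integrability of \<open>D\<delta>(\<Phi>)\<close> is then read off from the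
  right-hand side.

  What remains is that \<open>\<delta>(\<Phi>)\<close> exists at all (\<open>skorohod_exists\<close>).  For a bounded field of finite
  intensity, \<open>\<delta>\<close> is the pathwise compensated integral (\<open>strong_skorohod_pathwise\<close>), and \<open>commutation\<close>
  applied to it gives the energy estimate
  \<open>\<^bold>E \<parallel>\<delta>(\<Phi>)\<parallel>\<^sup>2 \<le> \<^bold>E \<integral> \<parallel>\<Phi>\<parallel>\<^sup>2 + \<^bold>E \<integral>\<integral> \<parallel>D\<Phi>\<parallel>\<^sup>2\<close> (\<open>energy_estimate\<close>).  Truncation and completeness of \<open>L\<^sup>2\<close>
  extend the integral to \<open>L\<^sup>2(E; D\<^sup>1\<^sup>,\<^sup>2(H))\<close>.
\<close>

section \<open>Point measures and their \<sigma>-algebra\<close>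

lemma space_point_algebra: "space (point_algebra M) = point_measures M"
  by (auto simp: point_algebra_def space_Sup_eq_UN)

lemma measurable_emeasure_point_algebra [measurable]:
  "B \<in> sets M \<Longrightarrow> (\<lambda>\<eta>. emeasure \<eta> B) \<in> borel_measurable (point_algebra M)"
  by (auto intro!: measurable_Sup1 measurable_vimage_algebra1 simp: point_algebra_def)

lemma measurable_into_point_algebra:
  assumes "\<And>z. z \<in> space K \<Longrightarrow> f z \<in> point_measures M"
    and "\<And>B. B \<in> sets M \<Longrightarrow> (\<lambda>z. emeasure (f z) B) \<in> borel_measurable K"
  shows "f \<in> K \<rightarrow>\<^sub>M point_algebra M"
  using assms by (auto intro!: measurable_Sup2 measurable_vimage_algebra2 simp: point_algebra_def)

lemma point_measuresD:
  assumes "\<eta> \<in> point_measures M"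
  shows "sets \<eta> = sets M" "space \<eta> = space M" "sigma_finite_measure \<eta>"
    and "B \<in> sets M \<Longrightarrow> emeasure \<eta> B \<noteq> \<infinity> \<Longrightarrow> \<exists>k. emeasure \<eta> B = of_nat k"
  using assms sets_eq_imp_space_eq[of \<eta> M] unfolding point_measures_def by auto

lemma sets_add_point [simp]: "sets (add_point \<eta> x) = sets \<eta>"
  and space_add_point [simp]: "space (add_point \<eta> x) = space \<eta>"
  by (simp_all add: add_point_def)

lemma emeasure_add_point:
  assumes "B \<in> sets \<eta>"
  shows "emeasure (add_point \<eta> x) B = emeasure \<eta> B + indicator B x"
proof (rule emeasure_measure_of[OF add_point_def])
  have "countably_additive (sets \<eta>) (\<lambda>B. emeasure (return (count_space UNIV) x) B)"
    unfolding countably_additive_def by (intro allI impI suminf_emeasure) auto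
  then have "countably_additive (sets \<eta>) (\<lambda>B. indicator B x :: ennreal)"
    by (simp add: emeasure_return)
  then show "countably_additive (sets (add_point \<eta> x)) (\<lambda>B. emeasure \<eta> B + indicator B x)"
    using suminf_emeasure[of _ \<eta>]
    by (auto simp: countably_additive_def suminf_add[symmetric] summableI)
qed (use assms sets.space_closed in \<open>auto simp: positive_def\<close>)

text \<open>A \<sigma>-finite cover for \<open>\<eta>\<close> is one for \<open>\<eta>'\<close>.  This applies to configurations to which a point has
  been added or from which one has been removed.\<close>

lemma sigma_finite_measure_mono:
  assumes "sigma_finite_measure \<eta>" "sets \<eta>' = sets \<eta>"
    and "\<And>B. B \<in> sets \<eta> \<Longrightarrow> emeasure \<eta> B \<noteq> \<infinity> \<Longrightarrow> emeasure \<eta>' B \<noteq> \<infinity>"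
  shows "sigma_finite_measure \<eta>'"
proof -
  obtain A :: "nat \<Rightarrow> 'a set" where A: "range A \<subseteq> sets \<eta>" "(\<Union>i. A i) = space \<eta>"
    "\<And>i. emeasure \<eta> (A i) \<noteq> \<infinity>"
    using sigma_finite_measure.sigma_finite[OF assms(1)] by metis
  show ?thesis
    using A assms sets_eq_imp_space_eq[OF assms(2)]
    by (intro sigma_finite_measure.intro exI[of _ "range A"]) auto
qed

lemma add_point_in_point_measures:
  assumes "\<eta> \<in> point_measures M"
  shows "add_point \<eta> x \<in> point_measures M"
proof -
  note D = point_measuresD[OF assms]
  have "sigma_finite_measure (add_point \<eta> x)"
    using D(3) by (rule sigma_finite_measure_mono)
      (auto simp: emeasure_add_point D(1) indicator_def)
  moreover have "emeasure (add_point \<eta> x) B \<in> insert \<infinity> (range of_nat)" if B: "B \<in> sets M" for B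
  proof (cases "emeasure \<eta> B = \<infinity>")
    case False
    then obtain k where "emeasure \<eta> B = of_nat k"
      using D(4)[OF B] by auto
    then have "emeasure (add_point \<eta> x) B = of_nat (k + (if x \<in> B then 1 else 0))"
      using B D(1) by (simp add: emeasure_add_point)
    then show ?thesis by blast
  qed (use B D(1) in \<open>simp add: emeasure_add_point\<close>)
  ultimately show ?thesis
    using D(1) by (auto simp: point_measures_def)
qed

lemma add_point_commute:
  "add_point (add_point \<eta> x) y = add_point (add_point \<eta> y) x"
  by (rule measure_eqI) (simp_all add: emeasure_add_point ac_simps)

lemma measurable_add_point [measurable (raw)]:
  assumes f [measurable]: "f \<in> K \<rightarrow>\<^sub>M point_algebra M" and [measurable]: "g \<in> K \<rightarrow>\<^sub>M M"
  shows "(\<lambda>z. add_point (f z) (g z)) \<in> K \<rightarrow>\<^sub>M point_algebra M"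
proof (rule measurable_into_point_algebra)
  fix B assume B [measurable]: "B \<in> sets M"
  have "(\<lambda>z. emeasure (f z) B + indicator B (g z)) \<in> borel_measurable K"
    by measurable
  moreover have "sets (f z) = sets M" if "z \<in> space K" for z
    using measurable_space[OF f that] by (simp add: space_point_algebra point_measuresD)
  ultimately show "(\<lambda>z. emeasure (add_point (f z) (g z)) B) \<in> borel_measurable K"
    using B by (subst measurable_cong) (auto simp: emeasure_add_point)
next
  fix z assume "z \<in> space K"
  then show "add_point (f z) (g z) \<in> point_measures M"
    using measurable_space[OF f] by (simp add: space_point_algebra add_point_in_point_measures)
qed

section \<open>Partitions of the state space and a countable generator\<close>

locale atom_partitions =
  fixes M :: "'e measure" and A :: "nat \<Rightarrow> 'e set"
  assumes A_sets: "A i \<in> sets M"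
    and A_finite: "emeasure M (A i) < \<infinity>"
    and A_cover: "(\<Union>i. A i) = space M"
    and A_generate: "sets M = sigma_sets (space M) (range A)"
begin

abbreviation \<N> :: "'e measure measure" where "\<N> \<equiv> point_algebra M"

abbreviation NE :: "('e measure \<times> 'e) measure" where "NE \<equiv> \<N> \<Otimes>\<^sub>M M"

text \<open>The first \<open>n\<close> of the sets cut the space into atoms, indexed by the set of those indices \<open>k\<close> for
  which \<open>A k\<close> contains the atom.  The empty index set is excluded because that atom may have
  infinite measure.  Passing from \<open>n\<close> to a larger number refines the partition, and the coarser
  label is a restriction of the finer one.\<close>

definition label :: "nat \<Rightarrow> 'e \<Rightarrow> nat set" where
  "label n x = {k. k < n \<and> x \<in> A k}"

definition labels :: "nat \<Rightarrow> nat set set" where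
  "labels n = Pow {..<n} - {{}}"

definition atom :: "nat \<Rightarrow> nat set \<Rightarrow> 'e set" where
  "atom n I = {x \<in> space M. label n x = I}"

definition cyl :: "nat \<Rightarrow> (nat set \<Rightarrow> nat) \<Rightarrow> 'e measure set" where
  "cyl n k = {\<eta> \<in> point_measures M. \<forall>I\<in>labels n. emeasure \<eta> (atom n I) = of_nat (k I)}"

definition locally_finite :: "'e measure set" where
  "locally_finite = {\<eta> \<in> point_measures M. \<forall>i. emeasure \<eta> (A i) < \<infinity>}"

definition boxes :: "('e measure \<times> 'e) set set" where
  "boxes = {(cyl n k \<inter> locally_finite) \<times> atom n I | n k I. I \<in> labels n}"

lemma finite_labels [simp]: "finite (labels n)"
  by (simp add: labels_def)

lemma label_restrict: "m \<le> n \<Longrightarrow> label m x = label n x \<inter> {..<m}"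
  by (auto simp: label_def)

lemma label_in_labels: "x \<in> A i \<Longrightarrow> i < n \<Longrightarrow> label n x \<in> labels n"
  by (auto simp: labels_def label_def)

lemma atom_sets [measurable]: "atom n I \<in> sets M"
proof -
  have "atom n I = {x \<in> space M. \<forall>k\<in>{..<n}. (x \<in> A k) = (k \<in> I)} \<inter> (if I \<subseteq> {..<n} then space M else {})"
    by (auto simp: atom_def label_def)
  moreover have "{x \<in> space M. \<forall>k\<in>{..<n}. (x \<in> A k) = (k \<in> I)} \<in> sets M"
    using A_sets by measurable
  ultimately show ?thesis by auto
qed

lemma atom_subset_A: "I \<in> labels n \<Longrightarrow> i \<in> I \<Longrightarrow> atom n I \<subseteq> A i"
  by (auto simp: atom_def label_def)

lemma atom_finite: "I \<in> labels n \<Longrightarrow> emeasure M (atom n I) < \<infinity>"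
proof -
  assume I: "I \<in> labels n"
  then obtain i where "i \<in> I" by (auto simp: labels_def)
  then show ?thesis
    using emeasure_mono[OF atom_subset_A[OF I] A_sets] A_finite[of i] by (metis le_less_trans)
qed

lemma atom_disjoint: "I \<noteq> J \<Longrightarrow> atom n I \<inter> atom n J = {}"
  by (auto simp: atom_def)

lemma A_eq_atoms: "i < n \<Longrightarrow> A i = (\<Union>I\<in>{I \<in> labels n. i \<in> I}. atom n I)"
  using A_cover by (fastforce simp: atom_def label_def labels_def)

lemma atom_refine:
  assumes "m \<le> n" "I \<in> labels m"
  shows "atom m I = (\<Union>J\<in>{J \<in> labels n. J \<inter> {..<m} = I}. atom n J)"
proof (intro set_eqI iffI)
  fix x assume x: "x \<in> atom m I"
  then have "label n x \<inter> {..<m} = I" "x \<in> space M"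
    using label_restrict[OF assms(1), of x] by (simp_all add: atom_def)
  moreover have "label n x \<in> labels n"
    using calculation assms(2) by (auto simp: labels_def label_def)
  ultimately show "x \<in> (\<Union>J\<in>{J \<in> labels n. J \<inter> {..<m} = I}. atom n J)"
    by (auto simp: atom_def)
next
  fix x assume "x \<in> (\<Union>J\<in>{J \<in> labels n. J \<inter> {..<m} = I}. atom n J)"
  then have "label n x \<inter> {..<m} = I" "x \<in> space M"
    by (auto simp: atom_def)
  then show "x \<in> atom m I"
    using label_restrict[OF assms(1), of x] by (simp add: atom_def)
qed

lemma emeasure_atom_refine:
  assumes "m \<le> n" "I \<in> labels m" "sets \<eta> = sets M"
  shows "emeasure \<eta> (atom m I) = (\<Sum>J | J \<in> labels n \<and> J \<inter> {..<m} = I. emeasure \<eta> (atom n J))"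
  unfolding atom_refine[OF assms(1,2)]
  by (rule sum_emeasure[symmetric]) (auto simp: assms(3) disjoint_family_on_def atom_disjoint)

lemma locally_finite_point_measure: "\<eta> \<in> locally_finite \<Longrightarrow> \<eta> \<in> point_measures M"
  by (simp add: locally_finite_def)

lemma locally_finite_iff_atoms:
  assumes "\<eta> \<in> point_measures M"
  shows "\<eta> \<in> locally_finite \<longleftrightarrow> (\<forall>n. \<forall>I\<in>labels n. emeasure \<eta> (atom n I) < \<infinity>)"
proof
  assume L: "\<eta> \<in> locally_finite"
  show "\<forall>n. \<forall>I\<in>labels n. emeasure \<eta> (atom n I) < \<infinity>"
  proof (intro allI ballI)
    fix n I assume I: "I \<in> labels n"
    then obtain i where "i \<in> I" by (auto simp: labels_def)
    then have "emeasure \<eta> (atom n I) \<le> emeasure \<eta> (A i)"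
      using A_sets point_measuresD(1)[OF assms] by (intro emeasure_mono atom_subset_A[OF I]) auto
    then show "emeasure \<eta> (atom n I) < \<infinity>"
      using L unfolding locally_finite_def by (auto intro: le_less_trans)
  qed
next
  assume *: "\<forall>n. \<forall>I\<in>labels n. emeasure \<eta> (atom n I) < \<infinity>"
  have "emeasure \<eta> (A i) < \<infinity>" for i
  proof -
    have "emeasure \<eta> (A i) = emeasure \<eta> (\<Union>I\<in>{I \<in> labels (Suc i). i \<in> I}. atom (Suc i) I)"
      using A_eq_atoms[of i "Suc i"] by simp
    also have "\<dots> = (\<Sum>I | I \<in> labels (Suc i) \<and> i \<in> I. emeasure \<eta> (atom (Suc i) I))"
      by (rule sum_emeasure[symmetric])
        (auto simp: point_measuresD(1)[OF assms] disjoint_family_on_def atom_disjoint)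
    also have "\<dots> < \<infinity>"
      using * by auto
    finally show ?thesis .
  qed
  then show "\<eta> \<in> locally_finite"
    using assms by (simp add: locally_finite_def)
qed

lemma locally_finite_sets [measurable]: "locally_finite \<in> sets \<N>"
proof -
  have "locally_finite = {\<eta> \<in> space \<N>. \<forall>i. emeasure \<eta> (A i) < \<infinity>}"
    by (simp add: locally_finite_def space_point_algebra)
  also have "\<dots> \<in> sets \<N>"
    using A_sets by measurable
  finally show ?thesis .
qed

lemma cyl_sets [measurable]: "cyl n k \<in> sets \<N>"
proof -
  have "cyl n k = {\<eta> \<in> space \<N>. \<forall>I\<in>labels n. emeasure \<eta> (atom n I) = of_nat (k I)}"
    by (simp add: cyl_def space_point_algebra)
  also have "\<dots> \<in> sets \<N>"
    by measurable
  finally show ?thesis .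
qed

lemma exists_cyl:
  assumes "\<eta> \<in> locally_finite"
  shows "\<exists>k. \<eta> \<in> cyl n k"
proof -
  have "\<forall>I\<in>labels n. \<exists>j. emeasure \<eta> (atom n I) = of_nat j"
    using assms point_measuresD(4)[OF locally_finite_point_measure[OF assms] atom_sets]
      locally_finite_iff_atoms[OF locally_finite_point_measure[OF assms]] by (metis less_irrefl)
  then obtain k where "\<forall>I\<in>labels n. emeasure \<eta> (atom n I) = of_nat (k I)"
    by (metis (mono_tags, lifting) someI_ex)
  then show ?thesis
    using assms by (auto simp: cyl_def locally_finite_point_measure)
qed

lemma countable_cyl: "countable (range (cyl n))"
proof -
  have "range (cyl n) \<subseteq> cyl n ` (PiE (labels n) (\<lambda>_. UNIV))"
  proof
    fix S assume "S \<in> range (cyl n)"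
    then obtain k where "S = cyl n k" by auto
    then have "S = cyl n (restrict k (labels n))" by (auto simp: cyl_def)
    then show "S \<in> cyl n ` (PiE (labels n) (\<lambda>_. UNIV))" by auto
  qed
  moreover have "countable (PiE (labels n) (\<lambda>_. UNIV :: nat set))"
    by (intro countable_PiE) auto
  ultimately show ?thesis
    by (meson countable_image countable_subset)
qed

lemma countable_boxes: "countable boxes"
proof -
  have "boxes \<subseteq> (\<Union>n. \<Union>S\<in>range (cyl n). \<Union>I\<in>labels n. {(S \<inter> locally_finite) \<times> atom n I})"
    unfolding boxes_def by blast
  moreover have "countable \<dots>"
    by (intro countable_UN countable_cyl) (auto intro: countable_finite)
  ultimately show ?thesis by (rule countable_subset)
qed

text \<open>The counts on a coarse partition are sums of the counts on a finer one.  Hence a cylinder of a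
  coarser partition either contains one of a finer partition or misses it, and boxes form a
  \<open>\<inter>\<close>-stable system without passing to unions.\<close>

lemma cyl_coarsen:
  assumes "m \<le> n" "\<eta> \<in> cyl n k" "\<zeta> \<in> cyl n k" "\<eta> \<in> cyl m l"
  shows "\<zeta> \<in> cyl m l"
proof -
  have "emeasure \<zeta> (atom m I) = emeasure \<eta> (atom m I)" if I: "I \<in> labels m" for I
  proof -
    have pm: "\<zeta> \<in> point_measures M" "\<eta> \<in> point_measures M"
      using assms by (auto simp: cyl_def)
    show ?thesis
      unfolding emeasure_atom_refine[OF assms(1) I point_measuresD(1)[OF pm(1)]]
        emeasure_atom_refine[OF assms(1) I point_measuresD(1)[OF pm(2)]]
      using assms by (intro sum.cong) (auto simp: cyl_def)
  qed
  then show ?thesis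
    using assms by (auto simp: cyl_def)
qed

lemma Int_stable_boxes: "Int_stable (insert {} boxes)"
proof -
  have *: "a \<inter> b \<in> {{}, b}"
    if a: "a = (cyl m l \<inter> locally_finite) \<times> atom m I"
      and b: "b = (cyl n k \<inter> locally_finite) \<times> atom n J" and "m \<le> n" for a b m l n k I J
  proof (cases "a \<inter> b = {}")
    case False
    then obtain \<eta> x where "(\<eta>, x) \<in> a" "(\<eta>, x) \<in> b" by auto
    then have h: "\<eta> \<in> cyl m l" "x \<in> atom m I" "\<eta> \<in> cyl n k" "x \<in> atom n J"
      by (auto simp: a b)
    have "b \<subseteq> a"
      using h cyl_coarsen[OF \<open>m \<le> n\<close> h(3) _ h(1)] label_restrict[OF \<open>m \<le> n\<close>]
      by (auto simp: a b atom_def)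
    then show ?thesis by auto
  qed auto
  show ?thesis
  proof (rule Int_stableI)
    fix a b assume ab: "a \<in> insert {} boxes" "b \<in> insert {} boxes"
    show "a \<inter> b \<in> insert {} boxes"
    proof (cases "a = {} \<or> b = {}")
      case False
      then have ab': "a \<in> boxes" "b \<in> boxes" using ab by auto
      then obtain m l I n k J where e: "a = (cyl m l \<inter> locally_finite) \<times> atom m I"
        "b = (cyl n k \<inter> locally_finite) \<times> atom n J"
        by (auto simp: boxes_def)
      show ?thesis
        using *[OF e] *[OF e(2,1)] ab' by (cases "m \<le> n") (auto simp: Int_commute)
    qed auto
  qed
qed

lemma boxes_through:
  assumes "\<eta> \<in> locally_finite" "x \<in> space M"
  obtains n k I where "m \<le> n" "I \<in> labels n" "\<eta> \<in> cyl n k" "x \<in> atom n I"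
proof -
  obtain i where i: "x \<in> A i" using assms A_cover by auto
  define n where "n = max m (Suc i)"
  obtain k where "\<eta> \<in> cyl n k" using exists_cyl[OF assms(1)] by blast
  moreover have "label n x \<in> labels n" "x \<in> atom n (label n x)"
    using label_in_labels[OF i, of n] assms by (auto simp: n_def atom_def)
  ultimately show ?thesis using that[of n] by (auto simp: n_def)
qed

text \<open>Boxes are like a countable basis: a set is generated by them as soon as each of its points lies
  in a box that is contained in the set.\<close>

lemma union_of_boxes:
  assumes "Q \<subseteq> locally_finite \<times> space M"
    and "\<And>\<eta> x. (\<eta>, x) \<in> Q \<Longrightarrow> \<exists>T\<in>boxes. (\<eta>, x) \<in> T \<and> T \<subseteq> Q"
  shows "Q \<in> sigma_sets (locally_finite \<times> space M) (insert {} boxes)"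
proof -
  have "Q = \<Union>{T \<in> boxes. T \<subseteq> Q}"
    using assms(2) by fast
  moreover have "\<Union>{T \<in> boxes. T \<subseteq> Q} \<in> sigma_sets (locally_finite \<times> space M) (insert {} boxes)"
    by (rule sigma_sets_UNION)
      (auto intro: countable_subset[OF _ countable_boxes] sigma_sets.Basic)
  ultimately show ?thesis by simp
qed

lemma Int_stable_atoms: "Int_stable (insert {} {atom n I | n I. I \<in> labels n})"
proof -
  have *: "atom m I \<inter> atom n J \<in> {{}, atom n J}" if "m \<le> n" for m n I J
    using label_restrict[OF that] by (auto simp: atom_def)
  have "a \<inter> b \<in> insert {} {atom n I | n I. I \<in> labels n}"
    if ab: "a \<in> insert {} {atom n I | n I. I \<in> labels n}" "b \<in> insert {} {atom n I | n I. I \<in> labels n}"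
    for a b
  proof (cases "a = {} \<or> b = {}")
    case False
    then obtain m I n J where e: "a = atom m I" "I \<in> labels m" "b = atom n J" "J \<in> labels n"
      using ab by auto
    show ?thesis
      using *[of m n I J] *[of n m J I] e by (cases "m \<le> n") (auto simp: Int_commute)
  qed auto
  then show ?thesis by (rule Int_stableI)
qed

lemma atoms_subset: "insert {} {atom n I | n I. I \<in> labels n} \<subseteq> Pow (space M)"
  by (auto simp: atom_def)

lemma sets_M_atoms: "sets M = sigma_sets (space M) (insert {} {atom n I | n I. I \<in> labels n})"
    (is "_ = sigma_sets _ ?G")
proof
  have "A i \<in> sigma_sets (space M) ?G" for i
    unfolding A_eq_atoms[of i "Suc i", simplified]
    by (rule sigma_sets_UNION) (auto intro: countable_finite sigma_sets.Basic)
  then show "sets M \<subseteq> sigma_sets (space M) ?G"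
    unfolding A_generate by (intro sigma_sets_mono) auto
  show "sigma_sets (space M) ?G \<subseteq> sets M"
    by (intro sets.sigma_sets_subset) auto
qed

text \<open>Evaluations at a general set are recovered from evaluations at atoms by a Dynkin argument, and
  complements in this argument require finite values.  On configurations with infinitely many
  points in a set of finite measure the statement can fail: if the atoms are intervals, the rational
  numbers and an irrational translate of them have the same counts on all atoms.\<close>

lemma sets_restrict_boxes:
  "sets (restrict_space NE (locally_finite \<times> space M)) =
    sigma_sets (locally_finite \<times> space M) (insert {} boxes)"
proof -
  let ?\<Omega> = "locally_finite \<times> space M"
  have sub: "insert {} boxes \<subseteq> Pow ?\<Omega>"
    by (auto simp: boxes_def atom_def)
  define R where "R = sigma ?\<Omega> (insert {} boxes)"
  have space_R: "space R = ?\<Omega>" and sets_R: "sets R = sigma_sets ?\<Omega> (insert {} boxes)"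
    using sub by (auto simp: R_def)
  have pm: "\<eta> \<in> point_measures M" if "(\<eta>, x) \<in> ?\<Omega>" for \<eta> x
    using that by (auto simp: locally_finite_def)
  have count_atom: "(\<lambda>z. emeasure (fst z) (atom n I)) \<in> borel_measurable R"
    if I: "I \<in> labels n" for n I
  proof -
    define g where "g z = nat \<lfloor>enn2real (emeasure (fst z) (atom n I))\<rfloor>" for z :: "'e measure \<times> 'e"
    have g: "emeasure \<eta> (atom n I) = of_nat (g (\<eta>, x))" if lf: "\<eta> \<in> locally_finite" for \<eta> x
    proof -
      obtain k where "\<eta> \<in> cyl n k" using exists_cyl[OF lf] by blast
      then have "emeasure \<eta> (atom n I) = of_nat (k I)" using I by (simp add: cyl_def)
      then show ?thesis by (simp add: g_def)
    qed
    have "g -` {c} \<inter> space R \<in> sets R" for c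
      unfolding sets_R space_R
    proof (rule union_of_boxes)
      fix \<eta> x assume z: "(\<eta>, x) \<in> g -` {c} \<inter> ?\<Omega>"
      then obtain m k J where m: "n \<le> m" "J \<in> labels m" "\<eta> \<in> cyl m k" "x \<in> atom m J"
        using boxes_through[of \<eta> x n] by (metis Int_iff mem_Sigma_iff)
      have "g (\<zeta>, y) = c" if "\<zeta> \<in> cyl m k" "\<zeta> \<in> locally_finite" for \<zeta> y
      proof -
        obtain l where l: "\<eta> \<in> cyl n l" using exists_cyl[of \<eta> n] z by auto
        then have "\<zeta> \<in> cyl n l" using cyl_coarsen[OF m(1) m(3) that(1)] by auto
        then have "emeasure \<zeta> (atom n I) = emeasure \<eta> (atom n I)"
          using l I by (simp add: cyl_def)
        then show ?thesis using z by (simp add: g_def)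
      qed
      then show "\<exists>T\<in>boxes. (\<eta>, x) \<in> T \<and> T \<subseteq> g -` {c} \<inter> ?\<Omega>"
        using z m by (intro bexI[of _ "(cyl m k \<inter> locally_finite) \<times> atom m J"])
          (auto simp: boxes_def atom_def)
    qed auto
    then have "g \<in> R \<rightarrow>\<^sub>M count_space UNIV"
      by (simp add: measurable_count_space_eq2_countable)
    then have "(\<lambda>z. of_nat (g z) :: ennreal) \<in> borel_measurable R"
      by measurable
    then show ?thesis
      using g by (subst measurable_cong[where g="\<lambda>z. of_nat (g z)"]) (auto simp: space_R)
  qed
  have count_n: "(\<lambda>z. emeasure (fst z) (B \<inter> (\<Union>i<n. A i))) \<in> borel_measurable R"
    if B: "B \<in> sets M" for B n
    using Int_stable_atoms atoms_subset B[unfolded sets_M_atoms]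
  proof (induction rule: sigma_sets_induct_disjoint)
    case (basic B)
    then consider "B = {}" | m I where "B = atom m I" "I \<in> labels m" by auto
    then show ?case
    proof cases
      case 2
      show ?thesis
      proof (cases "m < n \<or> I \<inter> {..<n} \<noteq> {}")
        case True
        then have "B \<inter> (\<Union>i<n. A i) = atom m I"
          using 2 by (force simp: atom_def label_def labels_def)
        then show ?thesis using count_atom[OF 2(2)] by simp
      next
        case False
        have "i \<in> I" if "x \<in> B" "x \<in> A i" "i < n" for x i
          using that 2(1) False by (auto simp: atom_def label_def)
        then have "B \<inter> (\<Union>i<n. A i) = {}"
          using False by blast
        then show ?thesis by simp
      qed
    qed simp
  next
    case (compl B)
    have B: "B \<in> sets M" using compl(1) by (simp add: sets_M_atoms)
    have "emeasure \<eta> ((space M - B) \<inter> (\<Union>i<n. A i)) =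
        emeasure \<eta> (space M \<inter> (\<Union>i<n. A i)) - emeasure \<eta> (B \<inter> (\<Union>i<n. A i))"
      if "\<eta> \<in> locally_finite" for \<eta>
    proof -
      have s: "sets \<eta> = sets M"
        using that by (auto simp: locally_finite_def dest: point_measuresD)
      have "emeasure \<eta> (\<Union>i<n. A i) \<le> (\<Sum>i<n. emeasure \<eta> (A i))"
        using A_sets by (intro emeasure_subadditive_finite) (auto simp: s)
      also have "\<dots> < \<infinity>" using that by (simp add: locally_finite_def)
      finally have "emeasure \<eta> (B \<inter> (\<Union>i<n. A i)) \<noteq> \<infinity>"
        using emeasure_mono[of "B \<inter> (\<Union>i<n. A i)" "\<Union>i<n. A i" \<eta>] A_sets by (auto simp: s top.extremum_unique)
      then have "emeasure \<eta> (space M \<inter> (\<Union>i<n. A i) - B \<inter> (\<Union>i<n. A i)) =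
          emeasure \<eta> (space M \<inter> (\<Union>i<n. A i)) - emeasure \<eta> (B \<inter> (\<Union>i<n. A i))"
        using A_sets B sets.sets_into_space[OF B] by (intro emeasure_Diff) (auto simp: s)
      moreover have "space M \<inter> (\<Union>i<n. A i) - B \<inter> (\<Union>i<n. A i) = (space M - B) \<inter> (\<Union>i<n. A i)"
        by auto
      ultimately show ?thesis by simp
    qed
    moreover have "(\<lambda>z. emeasure (fst z) (space M \<inter> (\<Union>i<n. A i))) \<in> borel_measurable R"
    proof -
      have U: "space M \<inter> (\<Union>i<n. A i) = (\<Union>I\<in>labels n. atom n I)"
        using A_cover by (fastforce simp: atom_def label_def labels_def)
      have "emeasure \<eta> (space M \<inter> (\<Union>i<n. A i)) = (\<Sum>I\<in>labels n. emeasure \<eta> (atom n I))"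
        if "\<eta> \<in> locally_finite" for \<eta>
        unfolding U using that
        by (intro sum_emeasure[symmetric])
          (auto simp: disjoint_family_on_def atom_disjoint locally_finite_def dest: point_measuresD(1))
      then show ?thesis
        using count_atom by (subst measurable_cong[where g="\<lambda>z. \<Sum>I\<in>labels n. emeasure (fst z) (atom n I)"]) (auto simp: space_R)
    qed
    ultimately show ?case
      using compl(2) by (subst measurable_cong[where g="\<lambda>z. emeasure (fst z) (space M \<inter> (\<Union>i<n. A i)) -
          emeasure (fst z) (B \<inter> (\<Union>i<n. A i))"]) (auto simp: space_R)
  next
    case (union B)
    have B: "B i \<in> sets M" for i using union(2) by (auto simp: sets_M_atoms)
    have "emeasure \<eta> ((\<Union>i. B i) \<inter> (\<Union>i<n. A i)) = (\<Sum>i. emeasure \<eta> (B i \<inter> (\<Union>i<n. A i)))"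
      if "\<eta> \<in> locally_finite" for \<eta>
    proof -
      have "(\<Union>i. B i) \<inter> (\<Union>i<n. A i) = (\<Union>i. B i \<inter> (\<Union>i<n. A i))" by auto
      moreover have "sets \<eta> = sets M"
        using that by (auto simp: locally_finite_def dest: point_measuresD)
      ultimately show ?thesis
        using union(1) B A_sets
        by (subst suminf_emeasure) (auto simp: disjoint_family_on_def)
    qed
    then show ?case
      using union(3) by (subst measurable_cong[where g="\<lambda>z. \<Sum>i. emeasure (fst z) (B i \<inter> (\<Union>i<n. A i))"])
        (auto simp: space_R)
  qed (auto simp: atom_def)
  have count: "(\<lambda>z. emeasure (fst z) B) \<in> borel_measurable R" if B: "B \<in> sets M" for B
  proof -
    have "emeasure \<eta> B = (SUP n. emeasure \<eta> (B \<inter> (\<Union>i<n. A i)))" if "\<eta> \<in> locally_finite" for \<eta>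
    proof -
      have s: "sets \<eta> = sets M"
        using that by (auto simp: locally_finite_def dest: point_measuresD)
      have "\<exists>n. x \<in> (\<Union>i<n. A i)" if x: "x \<in> B" for x
      proof -
        obtain i where "x \<in> A i"
          using x A_cover sets.sets_into_space[OF B] by blast
        then show ?thesis by (intro exI[of _ "Suc i"]) blast
      qed
      then have "B = (\<Union>n. B \<inter> (\<Union>i<n. A i))"
        by blast
      moreover have "(SUP n. emeasure \<eta> (B \<inter> (\<Union>i<n. A i))) = emeasure \<eta> (\<Union>n. B \<inter> (\<Union>i<n. A i))"
        using A_sets B by (intro SUP_emeasure_incseq) (fastforce simp: s incseq_def)+
      ultimately show ?thesis by simp
    qed
    then show ?thesis
      using count_n[OF B] by (subst measurable_cong[where g="\<lambda>z. SUP n. emeasure (fst z) (B \<inter> (\<Union>i<n. A i))"])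
        (auto simp: space_R)
  qed
  have fst_R: "fst \<in> R \<rightarrow>\<^sub>M \<N>"
    using count by (intro measurable_into_point_algebra) (auto simp: space_R pm)
  have snd_R: "snd \<in> R \<rightarrow>\<^sub>M M"
  proof (rule measurable_sigma_sets[OF A_generate])
    fix B assume "B \<in> range A"
    then obtain i where B: "B = A i" by auto
    show "snd -` B \<inter> space R \<in> sets R"
      unfolding sets_R space_R
    proof (rule union_of_boxes)
      fix \<eta> x assume z: "(\<eta>, x) \<in> snd -` B \<inter> ?\<Omega>"
      then obtain m k J where m: "Suc i \<le> m" "J \<in> labels m" "\<eta> \<in> cyl m k" "x \<in> atom m J"
        using boxes_through[of \<eta> x "Suc i"] by (metis Int_iff mem_Sigma_iff)
      then have "i \<in> J" using z by (auto simp: B atom_def label_def)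
      then have "atom m J \<subseteq> A i" using atom_subset_A m by auto
      then show "\<exists>T\<in>boxes. (\<eta>, x) \<in> T \<and> T \<subseteq> snd -` B \<inter> ?\<Omega>"
        using z m by (intro bexI[of _ "(cyl m k \<inter> locally_finite) \<times> atom m J"])
          (auto simp: boxes_def B atom_def)
    qed auto
  qed (use A_sets sets.sets_into_space in \<open>auto simp: space_R\<close>)
  have id_R: "id \<in> R \<rightarrow>\<^sub>M NE"
    using fst_R snd_R by (simp add: measurable_pair_iff comp_def id_def)
  have space: "?\<Omega> \<subseteq> space NE"
    by (auto simp: space_pair_measure space_point_algebra locally_finite_def)
  show ?thesis
  proof
    show "sets (restrict_space NE ?\<Omega>) \<subseteq> sigma_sets ?\<Omega> (insert {} boxes)"
    proof
      fix T assume "T \<in> sets (restrict_space NE ?\<Omega>)"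
      then obtain Q where Q: "Q \<in> sets NE" "T = ?\<Omega> \<inter> Q"
        by (auto simp: sets_restrict_space)
      then show "T \<in> sigma_sets ?\<Omega> (insert {} boxes)"
        using measurable_sets[OF id_R Q(1)] by (simp add: sets_R space_R Int_commute)
    qed
    have "T \<in> sets (restrict_space NE ?\<Omega>)" if T: "T \<in> insert {} boxes" for T
    proof -
      have "T \<in> sets NE" using T by (auto simp: boxes_def)
      moreover have "T = ?\<Omega> \<inter> T" using T sub by auto
      ultimately show ?thesis by (auto simp: sets_restrict_space)
    qed
    then show "sigma_sets ?\<Omega> (insert {} boxes) \<subseteq> sets (restrict_space NE ?\<Omega>)"
      using space sets.sigma_sets_subset[of "insert {} boxes" "restrict_space NE ?\<Omega>"]
      by (auto simp: space_restrict_space Int_absorb2)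
  qed
qed

text \<open>The uniqueness principle behind both the Mecke formula and the identification of
  \<open>D\<^sub>x\<delta>(\<Phi>)\<close> for a fixed \<open>x\<close>.\<close>

lemma measure_eqI_boxes:
  assumes sets: "sets m1 = sets NE" "sets m2 = sets NE"
    and ae: "AE z in m1. fst z \<in> locally_finite" "AE z in m2. fst z \<in> locally_finite"
    and eq: "\<And>n k I. I \<in> labels n \<Longrightarrow> emeasure m1 (cyl n k \<times> atom n I) = emeasure m2 (cyl n k \<times> atom n I)"
    and fin: "\<And>n k I. I \<in> labels n \<Longrightarrow> emeasure m1 (cyl n k \<times> atom n I) \<noteq> \<infinity>"
  shows "m1 = m2"
proof (rule measure_eqI_restrict_generator)
  let ?\<Omega> = "locally_finite \<times> space M"
  have drop: "emeasure m ((cyl n k \<inter> locally_finite) \<times> atom n I) = emeasure m (cyl n k \<times> atom n I)"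
    if "sets m = sets NE" "AE z in m. fst z \<in> locally_finite"
    for m :: "('e measure \<times> 'e) measure" and n k I
    using that(2) by (intro emeasure_eq_AE) (auto simp: that(1))
  have sp: "space m = point_measures M \<times> space M" if "sets m = sets NE"
    for m :: "('e measure \<times> 'e) measure"
    using sets_eq_imp_space_eq[OF that] by (simp add: space_pair_measure space_point_algebra)
  have ae': "AE z in m. z \<in> ?\<Omega>"
    if "sets m = sets NE" "AE z in m. fst z \<in> locally_finite"
    for m :: "('e measure \<times> 'e) measure"
    using that(2) AE_space[of m] by eventually_elim (auto simp: sp[OF that(1)] mem_Times_iff)
  show "Int_stable (insert {} boxes)" by (rule Int_stable_boxes)
  show "insert {} boxes \<subseteq> Pow ?\<Omega>" by (auto simp: boxes_def atom_def)
  show "emeasure m1 T = emeasure m2 T" if "T \<in> insert {} boxes" for T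
    using that eq by (auto simp: boxes_def drop sets ae)
  show "sets m1 = sets m2" by (simp add: sets)
  show "?\<Omega> \<in> sets m1" by (simp add: sets)
  show "sets (restrict_space m1 ?\<Omega>) = sigma_sets ?\<Omega> (insert {} boxes)"
    "sets (restrict_space m2 ?\<Omega>) = sigma_sets ?\<Omega> (insert {} boxes)"
    by (simp_all add: sets_restrict_boxes[symmetric] sets_restrict_space sets)
  show "AE z in m1. z \<in> ?\<Omega>" "AE z in m2. z \<in> ?\<Omega>"
    using ae' sets ae by auto
  show "countable (insert {} boxes)" by (simp add: countable_boxes)
  show "\<Union>(insert {} boxes) = ?\<Omega>"
  proof
    show "?\<Omega> \<subseteq> \<Union>(insert {} boxes)"
    proof
      fix z assume "z \<in> ?\<Omega>"
      then obtain n k I where "I \<in> labels n" "fst z \<in> cyl n k" "snd z \<in> atom n I"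
        using boxes_through[of "fst z" "snd z" 0] unfolding mem_Times_iff by metis
      then show "z \<in> \<Union>(insert {} boxes)"
        using \<open>z \<in> ?\<Omega>\<close>
        by (intro UnionI[of "(cyl n k \<inter> locally_finite) \<times> atom n I"]) (auto simp: boxes_def mem_Times_iff)
    qed
  qed (auto simp: boxes_def atom_def)
  show "emeasure m1 T \<noteq> \<infinity>" if "T \<in> insert {} boxes" for T
    using that fin by (auto simp: boxes_def drop sets ae)
qed auto

end

section \<open>The Poisson process with a point removed\<close>

locale poisson_process = atom_partitions M A
  for M :: "'e measure" and A :: "nat \<Rightarrow> 'e set" +
  fixes P :: "'w measure" and N :: "'w \<Rightarrow> 'e measure" and X :: "nat \<Rightarrow> 'w \<Rightarrow> 'e"
  assumes prob_space_P: "prob_space P"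
    and sigma_finite_M: "sigma_finite_measure M"
    and poisson: "poisson_random_measure P M N"
    and representation: "point_representation P M N X"
    and P_eq: "P = completion (restr_to_subalg P (vimage_algebra (space P) N \<N>))"
begin

abbreviation PE :: "('w \<times> 'e) measure" where "PE \<equiv> P \<Otimes>\<^sub>M M"

abbreviation EPE :: "('e \<times> 'w \<times> 'e) measure" where "EPE \<equiv> M \<Otimes>\<^sub>M PE"

abbreviation IP :: "(nat \<times> 'w) measure" where "IP \<equiv> count_space UNIV \<Otimes>\<^sub>M P"

sublocale P: prob_space P by (rule prob_space_P)
sublocale M: sigma_finite_measure M by (rule sigma_finite_M)
sublocale PM: pair_sigma_finite P M ..
sublocale C: sigma_finite_measure "count_space (UNIV :: nat set)"
  by (rule sigma_finite_measure_count_space)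
sublocale CP: pair_sigma_finite "count_space (UNIV :: nat set)" P ..

lemma N_measurable [measurable]: "N \<in> P \<rightarrow>\<^sub>M \<N>"
  using poisson by (simp add: poisson_random_measure_def)

lemma X_measurable [measurable]: "X n \<in> P \<rightarrow>\<^sub>M M"
  using representation by (simp add: point_representation_def)

lemma N_point_measure: "\<omega> \<in> space P \<Longrightarrow> N \<omega> \<in> point_measures M"
  using measurable_space[OF N_measurable] by (simp add: space_point_algebra)

lemma sets_N: "\<omega> \<in> space P \<Longrightarrow> sets (N \<omega>) = sets M"
  by (rule point_measuresD(1)[OF N_point_measure])

definition below :: "'w \<Rightarrow> nat set" where
  "below \<omega> = {k. of_nat k < emeasure (N \<omega>) (space M)}"

text \<open>The configuration \<open>N\<close> with the point of index \<open>n\<close> removed.  As the image of a counting measure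
  it is additive and integer valued by construction, which a difference of measures would not be.\<close>

definition rest :: "nat \<Rightarrow> 'w \<Rightarrow> 'e measure" where
  "rest n \<omega> = distr (count_space (below \<omega> - {n})) M (\<lambda>k. X k \<omega>)"

lemma sets_rest [simp]: "sets (rest n \<omega>) = sets M"
  by (simp add: rest_def)

lemma emeasure_N:
  assumes "\<omega> \<in> space P" "B \<in> sets M"
  shows "emeasure (N \<omega>) B = (\<Sum>k. if k \<in> below \<omega> then indicator B (X k \<omega>) else 0)"
  using representation assms by (simp add: point_representation_def below_def)

lemma emeasure_rest_count:
  assumes "\<omega> \<in> space P" "B \<in> sets M"
  shows "emeasure (rest n \<omega>) B = emeasure (count_space (below \<omega> - {n})) {k \<in> below \<omega> - {n}. X k \<omega> \<in> B}"
proof -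
  have "emeasure (rest n \<omega>) B =
      emeasure (count_space (below \<omega> - {n})) ((\<lambda>k. X k \<omega>) -` B \<inter> space (count_space (below \<omega> - {n})))"
    unfolding rest_def using assms measurable_space[OF X_measurable]
    by (intro emeasure_distr) auto
  moreover have "(\<lambda>k. X k \<omega>) -` B \<inter> space (count_space (below \<omega> - {n})) = {k \<in> below \<omega> - {n}. X k \<omega> \<in> B}"
    by auto
  ultimately show ?thesis by simp
qed

lemma emeasure_rest:
  assumes "\<omega> \<in> space P" "B \<in> sets M"
  shows "emeasure (rest n \<omega>) B = (\<Sum>k. if k \<in> below \<omega> \<and> k \<noteq> n then indicator B (X k \<omega>) else 0)"
proof -
  let ?K = "below \<omega> - {n}"
  have "emeasure (rest n \<omega>) B = (\<integral>\<^sup>+k. indicator {k \<in> ?K. X k \<omega> \<in> B} k \<partial>count_space ?K)"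
    by (subst nn_integral_indicator) (auto simp: emeasure_rest_count[OF assms])
  also have "\<dots> = (\<integral>\<^sup>+k. (if k \<in> ?K then indicator B (X k \<omega>) else 0) \<partial>count_space UNIV)"
    by (subst nn_integral_count_space_indicator) (auto intro!: nn_integral_cong simp: indicator_def)
  also have "\<dots> = (\<Sum>k. if k \<in> below \<omega> \<and> k \<noteq> n then indicator B (X k \<omega>) else 0)"
    by (simp add: nn_integral_count_space_nat)
  finally show ?thesis .
qed

lemma rest_le: "\<omega> \<in> space P \<Longrightarrow> B \<in> sets M \<Longrightarrow> emeasure (rest n \<omega>) B \<le> emeasure (N \<omega>) B"
  by (simp add: emeasure_rest emeasure_N) (auto intro!: suminf_le summableI)

lemma rest_point_measure:
  assumes "\<omega> \<in> space P"
  shows "rest n \<omega> \<in> point_measures M"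
proof -
  have "sigma_finite_measure (rest n \<omega>)"
    using point_measuresD(3)[OF N_point_measure[OF assms]]
    by (rule sigma_finite_measure_mono)
      (use rest_le[OF assms, of _ n] in \<open>force simp: sets_N[OF assms] top_unique\<close>)+
  moreover have "emeasure (rest n \<omega>) B \<in> insert \<infinity> (range of_nat)" if "B \<in> sets M" for B
    using emeasure_rest_count[OF assms that]
    by (subst (asm) emeasure_count_space) (auto split: if_splits)
  ultimately show ?thesis
    by (auto simp: point_measures_def)
qed

lemma add_point_rest:
  assumes "\<omega> \<in> space P" "n \<in> below \<omega>"
  shows "add_point (rest n \<omega>) (X n \<omega>) = N \<omega>"
proof (rule measure_eqI)
  show "sets (add_point (rest n \<omega>) (X n \<omega>)) = sets (N \<omega>)"
    by (simp add: sets_N assms)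
  fix B assume "B \<in> sets (add_point (rest n \<omega>) (X n \<omega>))"
  then have B: "B \<in> sets M" by simp
  have "emeasure (N \<omega>) B = (\<Sum>k. (if k \<in> below \<omega> \<and> k \<noteq> n then indicator B (X k \<omega>) else 0) +
      (if k = n then indicator B (X k \<omega>) else 0))"
    unfolding emeasure_N[OF assms(1) B] using assms(2) by (intro arg_cong[where f=suminf]) auto
  also have "\<dots> = emeasure (rest n \<omega>) B + (\<Sum>k. if k = n then indicator B (X k \<omega>) else 0)"
    unfolding emeasure_rest[OF assms(1) B] by (intro suminf_add[symmetric] summableI)
  also have "(\<Sum>k. if k = n then indicator B (X k \<omega>) else 0 :: ennreal) = indicator B (X n \<omega>)"
    using sums_single[of n "\<lambda>k. indicator B (X k \<omega>) :: ennreal"] by (simp add: sums_iff)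
  finally show "emeasure (add_point (rest n \<omega>) (X n \<omega>)) B = emeasure (N \<omega>) B"
    using B by (simp add: emeasure_add_point)
qed

lemma below_measurable [measurable]: "Measurable.pred P (\<lambda>\<omega>. k \<in> below \<omega>)"
  by (simp add: below_def)

lemma rest_measurable [measurable]: "rest n \<in> P \<rightarrow>\<^sub>M \<N>"
proof (rule measurable_into_point_algebra)
  fix B assume B [measurable]: "B \<in> sets M"
  have "(\<lambda>\<omega>. \<Sum>k. if k \<in> below \<omega> \<and> k \<noteq> n then indicator B (X k \<omega>) else 0 :: ennreal) \<in> borel_measurable P"
    by measurable
  then show "(\<lambda>\<omega>. emeasure (rest n \<omega>) B) \<in> borel_measurable P"
    using B by (subst measurable_cong[where g="\<lambda>\<omega>. \<Sum>k. if k \<in> below \<omega> \<and> k \<noteq> n then indicator B (X k \<omega>) else 0"])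
      (auto simp: emeasure_rest)
qed (rule rest_point_measure)

definition pois :: "real \<Rightarrow> nat \<Rightarrow> real" where
  "pois r k = r ^ k / fact k * exp (- r)"

lemma pois_Suc: "(real k + 1) * pois r (Suc k) = r * pois r k"
proof -
  have "fact (Suc k) = (real k + 1) * (fact k :: real)" "real k + 1 \<noteq> 0"
    by (simp_all add: algebra_simps)
  then show ?thesis
    unfolding pois_def by (simp add: divide_simps del: fact_Suc)
qed

lemma prob_count:
  assumes "B \<in> sets M" "emeasure M B < \<infinity>"
  shows "P.prob {\<omega> \<in> space P. emeasure (N \<omega>) B = of_nat k} = pois (measure M B) k"
  using poisson assms unfolding poisson_random_measure_def pois_def by (auto split: if_splits)

lemma AE_count_finite:
  assumes B [measurable]: "B \<in> sets M" and "emeasure M B < \<infinity>"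
  shows "AE \<omega> in P. emeasure (N \<omega>) B < \<infinity>"
proof -
  let ?S = "\<lambda>k::nat. {\<omega> \<in> space P. emeasure (N \<omega>) B = of_nat k}"
  have "(\<lambda>k. P.prob (?S k)) sums P.prob (\<Union>k. ?S k)"
    by (rule P.finite_measure_UNION) (auto simp: disjoint_family_on_def)
  moreover have "(\<lambda>k. P.prob (?S k)) sums 1"
  proof -
    have "(\<lambda>k. (measure M B ^ k /\<^sub>R fact k) * exp (- measure M B)) sums (exp (measure M B) * exp (- measure M B))"
      by (intro sums_mult2 exp_converges)
    then show ?thesis
      by (simp add: prob_count[OF assms] pois_def exp_minus field_simps)
  qed
  ultimately have "P.prob (\<Union>k. ?S k) = 1"
    by (rule sums_unique2)
  then have "AE \<omega> in P. \<omega> \<in> (\<Union>k. ?S k)"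
    by (subst (asm) P.prob_eq_1) auto
  then show ?thesis
    by eventually_elim (auto simp: of_nat_less_top)
qed

lemma AE_locally_finite: "AE \<omega> in P. N \<omega> \<in> locally_finite"
proof -
  have "AE \<omega> in P. \<forall>i. emeasure (N \<omega>) (A i) < \<infinity>"
    using AE_count_finite[OF A_sets A_finite] by (simp add: AE_all_countable)
  then show ?thesis
    using AE_space by eventually_elim (auto simp: locally_finite_def N_point_measure)
qed

lemma rest_locally_finite: "\<omega> \<in> space P \<Longrightarrow> N \<omega> \<in> locally_finite \<Longrightarrow> rest n \<omega> \<in> locally_finite"
  using rest_le[OF _ A_sets, of \<omega> n] unfolding locally_finite_def
  by (simp add: rest_point_measure) (metis le_less_trans)

lemma prob_cyl:
  assumes "labels n \<noteq> {}"
  shows "P.prob {\<omega> \<in> space P. N \<omega> \<in> cyl n k} = (\<Prod>I\<in>labels n. pois (measure M (atom n I)) (k I))"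
proof -
  define m where "m = card (labels n)"
  obtain e where e: "bij_betw e {..<m} (labels n)"
    using ex_bij_betw_nat_finite[OF finite_labels[of n]] by (auto simp: m_def atLeast0LessThan)
  have m: "{..<m} \<noteq> {}" using assms by (auto simp: m_def card_gt_0_iff lessThan_empty_iff)
  define Z where "Z i \<omega> = emeasure (N \<omega>) (atom n (e i))" for i \<omega>
  have "disjoint_family_on (\<lambda>i. atom n (e i)) {..<m}"
    using bij_betw_imp_inj_on[OF e]
    unfolding disjoint_family_on_def by (metis atom_disjoint inj_onD)
  then have "P.indep_vars (\<lambda>_. borel) Z {..<m}"
    using poisson unfolding poisson_random_measure_def Z_def by auto
  then have "P.prob (\<Inter>i\<in>{..<m}. Z i -` {of_nat (k (e i))} \<inter> space P) =
      (\<Prod>i\<in>{..<m}. P.prob (Z i -` {of_nat (k (e i))} \<inter> space P))"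
    using m by (intro P.indep_varsD[where I="{..<m}"]) auto
  moreover have "(\<Inter>i\<in>{..<m}. Z i -` {of_nat (k (e i))} \<inter> space P) = {\<omega> \<in> space P. N \<omega> \<in> cyl n k}"
  proof -
    have "(\<forall>I\<in>labels n. emeasure \<eta> (atom n I) = of_nat (k I)) \<longleftrightarrow>
        (\<forall>i<m. emeasure \<eta> (atom n (e i)) = of_nat (k (e i)))" for \<eta>
      unfolding bij_betw_imp_surj_on[OF e, symmetric] by auto
    then show ?thesis
      using m N_point_measure by (auto simp: cyl_def Z_def)
  qed
  moreover have "P.prob (Z i -` {of_nat (k (e i))} \<inter> space P) = pois (measure M (atom n (e i))) (k (e i))"
    if "i < m" for i
  proof -
    have "e i \<in> labels n" using that bij_betwE[OF e] by auto
    then have "P.prob {\<omega> \<in> space P. emeasure (N \<omega>) (atom n (e i)) = of_nat (k (e i))} =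
        pois (measure M (atom n (e i))) (k (e i))"
      by (intro prob_count atom_finite) auto
    moreover have "Z i -` {of_nat (k (e i))} \<inter> space P =
        {\<omega> \<in> space P. emeasure (N \<omega>) (atom n (e i)) = of_nat (k (e i))}"
      by (auto simp: Z_def)
    ultimately show ?thesis by simp
  qed
  ultimately have "P.prob {\<omega> \<in> space P. N \<omega> \<in> cyl n k} =
      (\<Prod>i\<in>{..<m}. pois (measure M (atom n (e i))) (k (e i)))"
    by simp
  also have "\<dots> = (\<Prod>I\<in>labels n. pois (measure M (atom n I)) (k I))"
    by (rule prod.reindex_bij_betw[OF e])
  finally show ?thesis .
qed

abbreviation incr :: "(nat set \<Rightarrow> nat) \<Rightarrow> nat set \<Rightarrow> nat set \<Rightarrow> nat" where
  "incr k I \<equiv> k(I := Suc (k I))"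

lemma prob_cyl_incr:
  assumes I: "I \<in> labels n"
  shows "(real (k I) + 1) * P.prob {\<omega> \<in> space P. N \<omega> \<in> cyl n (incr k I)} =
    measure M (atom n I) * P.prob {\<omega> \<in> space P. N \<omega> \<in> cyl n k}"
proof -
  have ne: "labels n \<noteq> {}" using I by auto
  have "(\<Prod>J\<in>labels n - {I}. pois (measure M (atom n J)) ((incr k I) J)) =
      (\<Prod>J\<in>labels n - {I}. pois (measure M (atom n J)) (k J))"
    by (intro prod.cong) auto
  then show ?thesis
    unfolding prob_cyl[OF ne] using pois_Suc[of "k I" "measure M (atom n I)"]
    by (simp add: prod.remove[OF finite_labels I] mult.assoc[symmetric] del: fun_upd_apply)
      (simp add: mult_ac)
qed

lemma add_point_cyl_iff:
  assumes "\<eta> \<in> point_measures M" "I \<in> labels n" "x \<in> atom n I"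
  shows "add_point \<eta> x \<in> cyl n (incr k I) \<longleftrightarrow> \<eta> \<in> cyl n k"
proof -
  have "emeasure (add_point \<eta> x) (atom n J) = of_nat (incr k I J) \<longleftrightarrow> emeasure \<eta> (atom n J) = of_nat (k J)"
    if "J \<in> labels n" for J
  proof (cases "J = I")
    case True
    have "emeasure \<eta> (atom n I) + 1 = of_nat (k I) + 1 \<longleftrightarrow> emeasure \<eta> (atom n I) = of_nat (k I)"
      by (metis add.commute ennreal_add_left_cancel ennreal_one_neq_top infinity_ennreal_def)
    then show ?thesis
      using True assms by (simp add: emeasure_add_point point_measuresD(1) add.commute)
  next
    case False
    then have "x \<notin> atom n J" using assms by (auto simp: atom_def)
    then show ?thesis
      using False assms by (simp add: emeasure_add_point point_measuresD(1))
  qed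
  then show ?thesis
    using add_point_in_point_measures[OF assms(1)] assms(1) by (simp add: cyl_def)
qed

section \<open>The Mecke formula\<close>

text \<open>The measure on pairs of an outcome and the index of one of its points: integration against it
  is the expectation of the sum over all points of \<open>N\<close>.\<close>

definition marked :: "(nat \<times> 'w) measure" where
  "marked = density IP (\<lambda>(m, \<omega>). indicator (below \<omega>) m)"

lemma sets_marked [measurable_cong]: "sets marked = sets IP"
  by (simp add: marked_def)

lemma space_marked: "space marked = UNIV \<times> space P"
  by (simp add: marked_def space_pair_measure)

lemma measurable_indicator_below [measurable]:
  "(\<lambda>(m, \<omega>). indicator (below \<omega>) m :: ennreal) \<in> borel_measurable IP"
  by (rule measurable_pair_measure_countable1) (auto simp: indicator_def)

lemma measurable_rest_pair [measurable]:
  "(\<lambda>(m, \<omega>). rest m \<omega>) \<in> IP \<rightarrow>\<^sub>M \<N>"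
  by (rule measurable_pair_measure_countable1) auto

lemma measurable_X_pair [measurable]:
  "(\<lambda>(m, \<omega>). X m \<omega>) \<in> IP \<rightarrow>\<^sub>M M"
  by (rule measurable_pair_measure_countable1) auto

lemma measurable_rest_X [measurable]:
  "(\<lambda>(m, \<omega>). (rest m \<omega>, X m \<omega>)) \<in> IP \<rightarrow>\<^sub>M NE"
  using measurable_Pair[OF measurable_rest_pair measurable_X_pair] by (simp add: case_prod_beta')

lemma nn_integral_marked:
  assumes [measurable]: "f \<in> borel_measurable IP"
  shows "(\<integral>\<^sup>+z. f z \<partial>marked) = (\<integral>\<^sup>+\<omega>. (\<Sum>m. indicator (below \<omega>) m * f (m, \<omega>)) \<partial>P)"
proof -
  have "(\<integral>\<^sup>+z. f z \<partial>marked) = (\<integral>\<^sup>+z. (case z of (m, \<omega>) \<Rightarrow> indicator (below \<omega>) m) * f z \<partial>IP)"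
    unfolding marked_def by (intro nn_integral_density) auto
  also have "\<dots> = (\<integral>\<^sup>+\<omega>. (\<integral>\<^sup>+m. indicator (below \<omega>) m * f (m, \<omega>) \<partial>count_space UNIV) \<partial>P)"
    by (subst CP.nn_integral_snd[symmetric]) auto
  finally show ?thesis
    by (simp add: nn_integral_count_space_nat)
qed

lemma AE_marked_iff:
  assumes [measurable]: "Measurable.pred IP Q"
  shows "(AE z in marked. Q z) \<longleftrightarrow> (AE \<omega> in P. \<forall>m\<in>below \<omega>. Q (m, \<omega>))"
proof -
  have "(AE z in marked. Q z) \<longleftrightarrow>
      (AE z in IP. fst z \<in> below (snd z) \<longrightarrow> Q z)"
    unfolding marked_def by (subst AE_density) (auto simp: case_prod_beta' indicator_def)
  also have "\<dots> \<longleftrightarrow> (AE m in count_space UNIV. AE \<omega> in P. m \<in> below \<omega> \<longrightarrow> Q (m, \<omega>))"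
  proof -
    have "{z \<in> space IP. fst z \<in> below (snd z) \<longrightarrow> Q (fst z, snd z)} \<in>
        sets IP"
    proof -
      have "Measurable.pred IP (\<lambda>(m, \<omega>). m \<in> below \<omega>)"
        by (rule measurable_pair_measure_countable1) auto
      then have [measurable]: "Measurable.pred IP (\<lambda>z. fst z \<in> below (snd z))"
        by (simp add: case_prod_beta')
      show ?thesis by measurable
    qed
    from CP.AE_pair_iff[OF this] show ?thesis by simp
  qed
  also have "\<dots> \<longleftrightarrow> (AE \<omega> in P. \<forall>m\<in>below \<omega>. Q (m, \<omega>))"
    by (simp add: AE_count_space AE_all_countable Ball_def)
  finally show ?thesis .
qed

text \<open>The reduced Mecke formula, as an identity of measures.  The remaining configuration and
  the removed point lie in the box of the counts \<open>k\<close> and the atom \<open>I\<close> if and only if \<open>N\<close> has the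
  counts \<open>k\<close> increased by one at \<open>I\<close> and the removed point is one of its \<open>k I + 1\<close> points in \<open>I\<close>.  On a box the formula is therefore the identity
  \<open>(k + 1) p(k + 1) = r p(k)\<close> for the Poisson weights.\<close>

theorem mecke_measure:
  "distr PE NE (\<lambda>(\<omega>, x). (N \<omega>, x)) =
    distr marked NE (\<lambda>(m, \<omega>). (rest m \<omega>, X m \<omega>))" (is "?m1 = ?m2")
proof (rule measure_eqI_boxes)
  have m1: "(\<lambda>(\<omega>, x). (N \<omega>, x)) \<in> PE \<rightarrow>\<^sub>M NE" by measurable
  have m2: "(\<lambda>(m, \<omega>). (rest m \<omega>, X m \<omega>)) \<in> marked \<rightarrow>\<^sub>M NE" by measurable
  have lf: "{z \<in> space NE. fst z \<in> locally_finite} \<in> sets NE"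
    by measurable
  show "sets ?m1 = sets NE" "sets ?m2 = sets NE"
    by simp_all
  have "AE z in PE. N (fst z) \<in> locally_finite"
    using AE_locally_finite by (intro PM.AE_pair_measure) auto
  then show "AE z in ?m1. fst z \<in> locally_finite"
    by (subst AE_distr_iff[OF m1 lf]) (auto simp: case_prod_beta')
  have "AE z in marked. rest (fst z) (snd z) \<in> locally_finite"
  proof (subst AE_marked_iff)
    have [measurable]: "(\<lambda>z. rest (fst z) (snd z)) \<in> IP \<rightarrow>\<^sub>M \<N>"
      using measurable_rest_pair by (simp add: case_prod_beta')
    show "Measurable.pred IP (\<lambda>z. rest (fst z) (snd z) \<in> locally_finite)"
      by measurable
    show "AE \<omega> in P. \<forall>m\<in>below \<omega>. rest (fst (m, \<omega>)) (snd (m, \<omega>)) \<in> locally_finite"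
      using AE_locally_finite AE_space by eventually_elim (auto simp: rest_locally_finite)
  qed
  then show "AE z in ?m2. fst z \<in> locally_finite"
    by (subst AE_distr_iff[OF m2 lf]) (auto simp: case_prod_beta')
  fix n k I assume I: "I \<in> labels n"
  let ?T = "cyl n k \<times> atom n I"
  have "emeasure ?m1 ?T = emeasure PE ({\<omega> \<in> space P. N \<omega> \<in> cyl n k} \<times> atom n I)"
    using sets.sets_into_space[OF atom_sets]
    by (subst emeasure_distr[OF m1]) (auto intro!: arg_cong[where f="emeasure _"] simp: space_pair_measure)
  also have "\<dots> = emeasure P {\<omega> \<in> space P. N \<omega> \<in> cyl n k} * emeasure M (atom n I)"
    by (intro M.emeasure_pair_measure_Times) auto
  finally have 1: "emeasure ?m1 ?T = ennreal (measure M (atom n I) * P.prob {\<omega> \<in> space P. N \<omega> \<in> cyl n k})"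
    using atom_finite[OF I] by (simp add: P.emeasure_eq_measure emeasure_eq_ennreal_measure ennreal_mult' mult.commute)
  have "emeasure ?m2 ?T = (\<integral>\<^sup>+z. indicator ?T (case z of (m, \<omega>) \<Rightarrow> (rest m \<omega>, X m \<omega>)) \<partial>marked)"
    by (subst nn_integral_distr[OF m2, symmetric]) auto
  also have "\<dots> = (\<integral>\<^sup>+\<omega>. (\<Sum>m. indicator (below \<omega>) m * indicator ?T (rest m \<omega>, X m \<omega>)) \<partial>P)"
    by (subst nn_integral_marked) (auto intro!: measurable_compose[OF measurable_rest_X])
  also have "\<dots> = (\<integral>\<^sup>+\<omega>. ennreal (real (k I) + 1) * indicator {\<omega> \<in> space P. N \<omega> \<in> cyl n (incr k I)} \<omega> \<partial>P)"
  proof (rule nn_integral_cong)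
    fix \<omega> assume w: "\<omega> \<in> space P"
    have "indicator (below \<omega>) m * indicator ?T (rest m \<omega>, X m \<omega>) =
        indicator (cyl n (incr k I)) (N \<omega>) * (if m \<in> below \<omega> then indicator (atom n I) (X m \<omega>) else 0 :: ennreal)" for m
      using add_point_cyl_iff[OF rest_point_measure[OF w] I, of "X m \<omega>" m k] add_point_rest[OF w, of m]
      by (auto simp: indicator_def)
    then have "(\<Sum>m. indicator (below \<omega>) m * indicator ?T (rest m \<omega>, X m \<omega>)) =
        indicator (cyl n (incr k I)) (N \<omega>) * emeasure (N \<omega>) (atom n I)"
      using w by (simp add: emeasure_N)
    also have "\<dots> = ennreal (real (k I) + 1) * indicator {\<omega> \<in> space P. N \<omega> \<in> cyl n (incr k I)} \<omega>"
      using w I by (auto simp: cyl_def indicator_def ennreal_of_nat_eq_real_of_nat add.commute)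
    finally show "(\<Sum>m. indicator (below \<omega>) m * indicator ?T (rest m \<omega>, X m \<omega>)) =
        ennreal (real (k I) + 1) * indicator {\<omega> \<in> space P. N \<omega> \<in> cyl n (incr k I)} \<omega>" .
  qed
  also have "\<dots> = ennreal ((real (k I) + 1) * P.prob {\<omega> \<in> space P. N \<omega> \<in> cyl n (incr k I)})"
    by (subst nn_integral_cmult_indicator) (auto simp: P.emeasure_eq_measure ennreal_mult')
  finally show "emeasure ?m1 ?T = emeasure ?m2 ?T"
    unfolding 1 prob_cyl_incr[OF I] by simp
  show "emeasure ?m1 ?T \<noteq> \<infinity>"
    unfolding 1 by simp
qed

end

section \<open>Square integrable functions\<close>

definition L2 :: "'a measure \<Rightarrow> ('a \<Rightarrow> 'h::{real_normed_vector, second_countable_topology}) \<Rightarrow> bool" where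
  "L2 m f \<longleftrightarrow> f \<in> borel_measurable m \<and> integrable m (\<lambda>z. (norm (f z))\<^sup>2)"

lemma Lp_2_iff: "f \<in> Lp 2 m \<longleftrightarrow> L2 m f"
  by (simp add: Lp_def L2_def)

lemma L2_measurable [measurable_dest]: "L2 m f \<Longrightarrow> f \<in> borel_measurable m"
  by (simp add: L2_def)

lemma L2_iff_nn_integral:
  assumes "f \<in> borel_measurable m"
  shows "L2 m f \<longleftrightarrow> (\<integral>\<^sup>+z. ennreal ((norm (f z))\<^sup>2) \<partial>m) < \<infinity>"
  using assms by (simp add: L2_def integrable_iff_bounded)

lemma L2_bound:
  assumes "L2 m f" "g \<in> borel_measurable m" "AE z in m. norm (g z) \<le> norm (f z)"
  shows "L2 m g"
proof -
  have "AE z in m. norm ((norm (g z))\<^sup>2) \<le> norm ((norm (f z))\<^sup>2)"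
    using assms(3) by eventually_elim (simp add: power_mono)
  then show ?thesis
    using assms(1,2) by (auto simp: L2_def intro: Bochner_Integration.integrable_bound)
qed

lemma L2_cong_AE:
  assumes "L2 m f" "g \<in> borel_measurable m" "AE z in m. f z = g z"
  shows "L2 m g"
  by (rule L2_bound[OF assms(1,2)]) (use assms(3) in \<open>eventually_elim, simp\<close>)

lemma L2_add:
  assumes "L2 m f" "L2 m g"
  shows "L2 m (\<lambda>z. f z + g z)"
proof -
  have "(norm (f z + g z))\<^sup>2 \<le> 2 * (norm (f z))\<^sup>2 + 2 * (norm (g z))\<^sup>2" for z
  proof -
    have "(norm (f z + g z))\<^sup>2 \<le> (norm (f z) + norm (g z))\<^sup>2"
      by (intro power_mono norm_triangle_ineq) simp
    also have "\<dots> \<le> 2 * (norm (f z))\<^sup>2 + 2 * (norm (g z))\<^sup>2"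
      using sum_squares_bound[of "norm (f z)" "norm (g z)"] by (simp add: power2_sum)
    finally show ?thesis .
  qed
  moreover have "integrable m (\<lambda>z. 2 * (norm (f z))\<^sup>2 + 2 * (norm (g z))\<^sup>2)"
    using assms by (auto simp: L2_def)
  moreover have "(\<lambda>z. f z + g z) \<in> borel_measurable m" using assms by measurable
  ultimately show ?thesis
    unfolding L2_def by (auto intro: Bochner_Integration.integrable_bound)
qed

lemma L2_scaleR: "L2 m f \<Longrightarrow> L2 m (\<lambda>z. (c::real) *\<^sub>R f z)"
  by (auto simp: L2_def power_mult_distrib)

lemma L2_diff:
  assumes "L2 m f" "L2 m g"
  shows "L2 m (\<lambda>z. f z - g z)"
  using L2_add[OF assms(1) L2_scaleR[OF assms(2), of "-1"]] by simp

lemma L2_bounded_indicator: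
  assumes "A \<in> sets m" "emeasure m A < \<infinity>" "f \<in> borel_measurable m"
    and "AE z in m. norm (f z) \<le> c * indicator A z"
  shows "L2 m f"
proof -
  have "L2 m (\<lambda>z. c * indicator A z :: real)"
    unfolding L2_def using assms(1,2)
    by (auto simp: power_mult_distrib power2_eq_square[of "indicator A _"] simp flip: indicator_inter_arith)
  then show ?thesis
    by (rule L2_bound[OF _ assms(3)]) (use assms(4) in \<open>eventually_elim, auto\<close>)
qed

lemma L2_inner_integrable:
  fixes f g :: "'a \<Rightarrow> 'h::{real_inner, second_countable_topology}"
  assumes "L2 m f" "L2 m g"
  shows "integrable m (\<lambda>z. f z \<bullet> g z)"
proof -
  have "\<bar>f z \<bullet> g z\<bar> \<le> (norm (f z))\<^sup>2 + (norm (g z))\<^sup>2" for z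
  proof -
    have "\<bar>f z \<bullet> g z\<bar> \<le> norm (f z) * norm (g z)" by (rule Cauchy_Schwarz_ineq2)
    also have "\<dots> \<le> (norm (f z))\<^sup>2 + (norm (g z))\<^sup>2"
      using sum_squares_bound[of "norm (f z)" "norm (g z)"] mult_nonneg_nonneg[OF norm_ge_zero[of "f z"] norm_ge_zero[of "g z"]]
      by linarith
    finally show ?thesis .
  qed
  moreover have "integrable m (\<lambda>z. (norm (f z))\<^sup>2 + (norm (g z))\<^sup>2)"
    using assms by (auto simp: L2_def)
  moreover have "(\<lambda>z. f z \<bullet> g z) \<in> borel_measurable m" using assms by measurable
  ultimately show ?thesis
    by (auto intro: Bochner_Integration.integrable_bound)
qed

section \<open>Functionals of the process\<close>

text \<open>The factorization lemma of Doob and Dynkin for vector valued functions: simple functions factor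
  level set by level set, and the factors of an approximating sequence converge on the range.\<close>

lemma borel_measurable_vimage_factor:
  fixes g :: "'a \<Rightarrow> 'h::{real_normed_vector, banach, second_countable_topology}"
  assumes T: "T \<in> S \<rightarrow> space K" and g: "g \<in> borel_measurable (vimage_algebra S T K)"
  shows "\<exists>f\<in>borel_measurable K. \<forall>x\<in>S. g x = f (T x)"
proof -
  let ?V = "vimage_algebra S T K"
  obtain s where s: "\<And>i. simple_function ?V (s i)" "\<And>x. x \<in> S \<Longrightarrow> (\<lambda>i. s i x) \<longlonglongrightarrow> g x"
    using borel_measurable_implies_sequence_metric[OF g, of 0] by auto
  have "\<exists>B\<in>sets K. s i -` {y} \<inter> S = T -` B \<inter> S" for i y
    using simple_functionD(2)[OF s(1), of i "{y}"] by (auto simp: sets_vimage_algebra2[OF T])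
  then obtain B where B: "\<And>i y. B i y \<in> sets K" "\<And>i y. s i -` {y} \<inter> S = T -` B i y \<inter> S"
    by metis
  define t where "t i z = (\<Sum>y\<in>s i ` S. indicator (B i y) z *\<^sub>R y)" for i z
  have [measurable]: "t i \<in> borel_measurable K" for i
    unfolding t_def using B by measurable
  have t: "t i (T x) = s i x" if x: "x \<in> S" for i x
  proof -
    have fin: "finite (s i ` S)"
      using simple_functionD(1)[OF s(1), of i] by simp
    have "indicator (B i y) (T x) = (if y = s i x then 1 else 0 :: real)" for y
      using B(2)[of i y] x by (auto simp: indicator_def)
    then show ?thesis
      using x fin by (simp add: t_def if_distrib[of "\<lambda>c. c *\<^sub>R _"] sum.delta' cong: if_cong)
  qed
  show ?thesis
  proof (intro bexI ballI)
    show "(\<lambda>z. lim (\<lambda>i. t i z)) \<in> borel_measurable K" by measurable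
    show "g x = lim (\<lambda>i. t i (T x))" if "x \<in> S" for x
      using s(2)[OF that] by (simp add: t that limI)
  qed
qed

lemma completion_ex_borel_measurable_banach:
  fixes g :: "'a \<Rightarrow> 'h::{real_normed_vector, banach, second_countable_topology}"
  assumes g: "g \<in> borel_measurable (completion m)"
  shows "\<exists>g'\<in>borel_measurable m. AE x in m. g x = g' x"
proof -
  obtain s where s: "\<And>i. simple_function (completion m) (s i)"
    "\<And>x. x \<in> space m \<Longrightarrow> (\<lambda>i. s i x) \<longlonglongrightarrow> g x"
    using borel_measurable_implies_sequence_metric[OF g, of 0] by auto
  obtain s' where s': "\<And>i. simple_function m (s' i)" "\<And>i. AE x in m. s i x = s' i x"
    using completion_ex_simple_function[OF s(1)] by metis
  have [measurable]: "s' i \<in> borel_measurable m" for i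
    by (rule borel_measurable_simple_function[OF s'(1)])
  have "AE x in m. \<forall>i. s i x = s' i x"
    using s'(2) by (simp add: AE_all_countable)
  then have "AE x in m. g x = lim (\<lambda>i. s' i x)"
    using AE_space by eventually_elim (metis (no_types, lifting) ext limI s(2))
  then show ?thesis
    by (intro bexI[of _ "\<lambda>x. lim (\<lambda>i. s' i x)"]) auto
qed

context poisson_process
begin

text \<open>Representatives exist because \<open>P\<close> is the completion of the \<open>\<sigma>\<close>-algebra of \<open>N\<close>: a measurable
  function is almost everywhere equal to one that is measurable without completion, and this one
  factors through \<open>N\<close>.  The parameter space \<open>K\<close> is \<open>M\<close> for random fields and a single point for
  random variables.\<close>

lemma N_representative_param:
  fixes g :: "'w \<times> 'k \<Rightarrow> 'h::{real_normed_vector, banach, second_countable_topology}" and K :: "'k measure"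
  assumes K: "sigma_finite_measure K" and g: "g \<in> borel_measurable (P \<Otimes>\<^sub>M K)"
  shows "\<exists>\<phi>\<in>borel_measurable (\<N> \<Otimes>\<^sub>M K). AE (\<omega>, y) in P \<Otimes>\<^sub>M K. g (\<omega>, y) = \<phi> (N \<omega>, y)"
proof -
  interpret K: sigma_finite_measure K by (rule K)
  interpret PK: pair_sigma_finite P K ..
  let ?V = "vimage_algebra (space P) N \<N>"
  define P0 where "P0 = restr_to_subalg P ?V"
  have N_space: "N \<in> space P \<rightarrow> space \<N>"
    using measurable_space[OF N_measurable] by auto
  have sub: "subalgebra P ?V"
    using measurable_sets[OF N_measurable] by (auto simp: subalgebra_def sets_vimage_algebra2[OF N_space])
  have P: "P = completion P0"
    using P_eq by (simp add: P0_def)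
  have sets_P0: "sets P0 = sets ?V" and space_P0: "space P0 = space P"
    by (simp_all add: P0_def sets_restr_to_subalg[OF sub] space_restr_to_subalg)
  interpret P0: prob_space P0
    using prob_space_restr_to_subalg[OF sub prob_space_P] by (simp add: P0_def)
  interpret P0K: pair_sigma_finite P0 K ..
  have lift: "AE z in P \<Otimes>\<^sub>M K. z \<notin> T" if T: "T \<in> null_sets (P0 \<Otimes>\<^sub>M K)" for T
  proof -
    have T': "T \<in> sets (P0 \<Otimes>\<^sub>M K)" using T by auto
    have "T \<in> sets (P \<Otimes>\<^sub>M K)"
      using T' sets_pair_in_sets[of P0 K "P \<Otimes>\<^sub>M K"] sub
      by (auto simp: sets_P0 subalgebra_def)
    moreover have "AE \<omega> in P0. AE y in K. (\<omega>, y) \<notin> T"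
      using P0K.AE_pair[OF AE_not_in[OF T]] .
    then have "AE \<omega> in P. AE y in K. (\<omega>, y) \<notin> T"
      unfolding P by (rule AE_completion)
    ultimately show ?thesis
      by (intro PK.AE_pair_measure) auto
  qed
  have "sets (P \<Otimes>\<^sub>M K) \<subseteq> sets (completion (P0 \<Otimes>\<^sub>M K))"
  proof (rule sets_pair_in_sets)
    fix a b assume a: "a \<in> sets P" and b: "b \<in> sets K"
    obtain S Z Z' where S: "a = S \<union> Z" "Z \<subseteq> Z'" "Z' \<in> null_sets P0" "S \<in> sets P0"
      using a sets_completionE[of a P0] P by metis
    show "a \<times> b \<in> sets (completion (P0 \<Otimes>\<^sub>M K))"
    proof (rule sets_completionI)
      show "a \<times> b = S \<times> b \<union> Z \<times> b" using S by auto
      show "Z \<times> b \<subseteq> Z' \<times> b" using S by auto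
      show "Z' \<times> b \<in> null_sets (P0 \<Otimes>\<^sub>M K)" using S b by auto
      show "S \<times> b \<in> sets (P0 \<Otimes>\<^sub>M K)" using S b by auto
    qed
  qed
  then have "g \<in> borel_measurable (completion (P0 \<Otimes>\<^sub>M K))"
    using g by (auto simp: measurable_def space_pair_measure space_P0)
  then obtain g' where g': "g' \<in> borel_measurable (P0 \<Otimes>\<^sub>M K)" "AE z in P0 \<Otimes>\<^sub>M K. g z = g' z"
    using completion_ex_borel_measurable_banach by blast
  let ?T = "\<lambda>(\<omega>, y). (N \<omega>, y)"
  have T: "?T \<in> space P \<times> space K \<rightarrow> space (\<N> \<Otimes>\<^sub>M K)"
    using N_space by (auto simp: space_pair_measure)
  have "sets (P0 \<Otimes>\<^sub>M K) \<subseteq> sets (vimage_algebra (space P \<times> space K) ?T (\<N> \<Otimes>\<^sub>M K))"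
  proof (rule sets_pair_in_sets)
    fix a b assume a: "a \<in> sets P0" and b: "b \<in> sets K"
    obtain S where S: "S \<in> sets \<N>" "a = N -` S \<inter> space P"
      using a by (auto simp: sets_P0 sets_vimage_algebra2[OF N_space])
    have "a \<times> b = ?T -` (S \<times> b) \<inter> (space P \<times> space K)"
      using S sets.sets_into_space[OF b] by auto
    then show "a \<times> b \<in> sets (vimage_algebra (space P \<times> space K) ?T (\<N> \<Otimes>\<^sub>M K))"
      using S b by (auto simp: sets_vimage_algebra2[OF T])
  qed
  then have "g' \<in> borel_measurable (vimage_algebra (space P \<times> space K) ?T (\<N> \<Otimes>\<^sub>M K))"
    using g'(1) by (auto simp: measurable_def space_pair_measure space_P0)
  then obtain \<phi> where \<phi>: "\<phi> \<in> borel_measurable (\<N> \<Otimes>\<^sub>M K)"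
    "\<And>z. z \<in> space P \<times> space K \<Longrightarrow> g' z = \<phi> (?T z)"
    using borel_measurable_vimage_factor[OF T] by blast
  obtain Z where Z: "{z \<in> space (P0 \<Otimes>\<^sub>M K). g z \<noteq> g' z} \<subseteq> Z" "Z \<in> null_sets (P0 \<Otimes>\<^sub>M K)"
    using g'(2) by (auto elim!: AE_E simp: null_sets_def)
  have "AE z in P \<Otimes>\<^sub>M K. g z = \<phi> (?T z)"
    using lift[OF Z(2)] AE_space
  proof eventually_elim
    case (elim z)
    then have z: "z \<in> space P \<times> space K" by (simp add: space_pair_measure)
    then have "g z = g' z"
      using Z(1) elim(1) by (auto simp: space_pair_measure space_P0)
    then show ?case using \<phi>(2)[OF z] by simp
  qed
  then show ?thesis
    using \<phi>(1) by (intro bexI[of _ \<phi>]) (simp_all add: case_prod_beta')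
qed

lemma N_representative_field:
  fixes g :: "'w \<times> 'e \<Rightarrow> 'h::{real_normed_vector, banach, second_countable_topology}"
  assumes "g \<in> borel_measurable PE"
  shows "\<exists>\<phi>. \<phi> \<in> borel_measurable NE \<and>
    (AE (\<omega>, y) in PE. g (\<omega>, y) = \<phi> (N \<omega>, y))"
  using N_representative_param[OF sigma_finite_M assms] by blast

lemma N_representative:
  fixes F :: "'w \<Rightarrow> 'h::{real_normed_vector, banach, second_countable_topology}"
  assumes F: "F \<in> borel_measurable P"
  shows "\<exists>f. f \<in> borel_measurable \<N> \<and> (AE \<omega> in P. F \<omega> = f (N \<omega>))"
proof -
  let ?K = "count_space (UNIV :: unit set)"
  have K: "sigma_finite_measure ?K" by (rule sigma_finite_measure_count_space)
  interpret K: sigma_finite_measure ?K by (rule K)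
  interpret PK: pair_sigma_finite P ?K ..
  have "(\<lambda>z. F (fst z)) \<in> borel_measurable (P \<Otimes>\<^sub>M ?K)" using F by measurable
  then obtain \<phi> where \<phi>: "\<phi> \<in> borel_measurable (\<N> \<Otimes>\<^sub>M ?K)"
    "AE (\<omega>, y) in P \<Otimes>\<^sub>M ?K. F (fst (\<omega>, y)) = \<phi> (N \<omega>, y)"
    using N_representative_param[OF K, of "\<lambda>z. F (fst z)"] by blast
  have "(\<lambda>\<eta>. \<phi> (\<eta>, ())) \<in> borel_measurable \<N>"
    by (rule measurable_compose[OF _ \<phi>(1)]) simp
  moreover have "AE \<omega> in P. F \<omega> = \<phi> (N \<omega>, ())"
    using PK.AE_pair[OF \<phi>(2)] by (simp add: AE_count_space)
  ultimately show ?thesis by blast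
qed

section \<open>The difference operator\<close>

text \<open>The difference of a fixed representative, in contrast to \<open>diff_op\<close>, which chooses one.\<close>

definition dif :: "('e measure \<Rightarrow> 'h::real_normed_vector) \<Rightarrow> 'w \<times> 'e \<Rightarrow> 'h" where
  "dif f z = f (add_point (N (fst z)) (snd z)) - f (N (fst z))"

lemma measurable_dif [measurable]:
  fixes f :: "'e measure \<Rightarrow> 'h::{real_normed_vector, second_countable_topology}"
  assumes [measurable]: "f \<in> borel_measurable \<N>"
  shows "dif f \<in> borel_measurable PE"
  unfolding dif_def[abs_def] by measurable

text \<open>A property of \<open>N\<close> that holds almost surely also holds almost everywhere for \<open>N + \<delta>\<^sub>x\<close>: by
  Mecke's formula the law of \<open>N + \<delta>\<^sub>x\<close>, averaged over \<open>x\<close>, is absolutely continuous with respect to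
  the law of \<open>N\<close>.  This is why difference operators do not depend on representatives.\<close>

lemma AE_add_point:
  assumes Q [measurable]: "Measurable.pred \<N> Q" and ae: "AE \<omega> in P. Q (N \<omega>)"
  shows "AE z in PE. Q (add_point (N (fst z)) (snd z))"
proof -
  have m1: "(\<lambda>(\<omega>, x). (N \<omega>, x)) \<in> PE \<rightarrow>\<^sub>M NE" by measurable
  have m2: "(\<lambda>(m, \<omega>). (rest m \<omega>, X m \<omega>)) \<in> marked \<rightarrow>\<^sub>M NE" by measurable
  have R: "{z \<in> space NE. Q (add_point (fst z) (snd z))} \<in> sets NE"
    by measurable
  have "AE z in marked. Q (add_point (rest (fst z) (snd z)) (X (fst z) (snd z)))"
  proof (subst AE_marked_iff)
    have [measurable]: "(\<lambda>z. rest (fst z) (snd z)) \<in> IP \<rightarrow>\<^sub>M \<N>"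
      "(\<lambda>z. X (fst z) (snd z)) \<in> IP \<rightarrow>\<^sub>M M"
      using measurable_rest_pair measurable_X_pair by (simp_all add: case_prod_beta')
    show "Measurable.pred IP (\<lambda>z. Q (add_point (rest (fst z) (snd z)) (X (fst z) (snd z))))"
      by measurable
    show "AE \<omega> in P. \<forall>m\<in>below \<omega>. Q (add_point (rest (fst (m, \<omega>)) (snd (m, \<omega>))) (X (fst (m, \<omega>)) (snd (m, \<omega>))))"
      using ae AE_space by eventually_elim (auto simp: add_point_rest)
  qed
  then have "AE z in distr marked NE (\<lambda>(m, \<omega>). (rest m \<omega>, X m \<omega>)). Q (add_point (fst z) (snd z))"
    by (subst AE_distr_iff[OF m2 R]) (simp add: case_prod_beta')
  then show ?thesis
    unfolding mecke_measure[symmetric] by (subst (asm) AE_distr_iff[OF m1 R]) (simp add: case_prod_beta')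
qed

lemma dif_cong:
  fixes f g :: "'e measure \<Rightarrow> 'h::{real_normed_vector, second_countable_topology}"
  assumes [measurable]: "f \<in> borel_measurable \<N>" "g \<in> borel_measurable \<N>"
    and ae: "AE \<omega> in P. f (N \<omega>) = g (N \<omega>)"
  shows "AE z in PE. dif f z = dif g z"
proof -
  have "AE z in PE. f (add_point (N (fst z)) (snd z)) = g (add_point (N (fst z)) (snd z))"
    using ae by (intro AE_add_point) auto
  moreover have "AE z in PE. f (N (fst z)) = g (N (fst z))"
    using ae by (intro PM.AE_pair_measure) auto
  ultimately show ?thesis
    by eventually_elim (simp add: dif_def)
qed

lemma diff_op_measurable_representative:
  fixes F :: "'w \<Rightarrow> 'h::{real_normed_vector, banach, second_countable_topology}"
  assumes "F \<in> borel_measurable P"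
  obtains f where "f \<in> borel_measurable \<N>" "AE \<omega> in P. F \<omega> = f (N \<omega>)" "diff_op P M N F = dif f"
proof -
  define f where "f = (SOME f. f \<in> borel_measurable \<N> \<and> (AE \<omega> in P. F \<omega> = f (N \<omega>)))"
  have "f \<in> borel_measurable \<N> \<and> (AE \<omega> in P. F \<omega> = f (N \<omega>))"
    unfolding f_def by (rule someI_ex[OF N_representative[OF assms]])
  moreover have "diff_op P M N F = dif f"
    by (simp add: diff_op_def f_def[symmetric] dif_def[abs_def] case_prod_beta')
  ultimately show ?thesis using that by blast
qed

lemma diff_op_measurable:
  fixes F :: "'w \<Rightarrow> 'h::{real_normed_vector, banach, second_countable_topology}"
  assumes "F \<in> borel_measurable P"
  shows "diff_op P M N F \<in> borel_measurable PE"
  by (rule diff_op_measurable_representative[OF assms]) simp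

lemma diff_op_AE:
  fixes F :: "'w \<Rightarrow> 'h::{real_normed_vector, banach, second_countable_topology}"
  assumes "F \<in> borel_measurable P" "f \<in> borel_measurable \<N>" "AE \<omega> in P. F \<omega> = f (N \<omega>)"
  shows "AE z in PE. diff_op P M N F z = dif f z"
proof -
  obtain g where g: "g \<in> borel_measurable \<N>" "AE \<omega> in P. F \<omega> = g (N \<omega>)" "diff_op P M N F = dif g"
    using diff_op_measurable_representative[OF assms(1)] by blast
  have "AE \<omega> in P. g (N \<omega>) = f (N \<omega>)"
    using g(2) assms(3) by eventually_elim simp
  then show ?thesis
    using dif_cong[OF g(1) assms(2)] g(3) by simp
qed

lemma sobolev_iff:
  fixes F :: "'w \<Rightarrow> 'h::{real_normed_vector, banach, second_countable_topology}"
  assumes "F \<in> borel_measurable P" "f \<in> borel_measurable \<N>" "AE \<omega> in P. F \<omega> = f (N \<omega>)"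
  shows "F \<in> sobolev 2 P M N \<longleftrightarrow> L2 P F \<and> L2 PE (dif f)"
proof -
  have ae: "AE z in PE. diff_op P M N F z = dif f z" by (rule diff_op_AE[OF assms])
  have "L2 PE (diff_op P M N F) \<longleftrightarrow> L2 PE (dif f)"
  proof
    assume "L2 PE (diff_op P M N F)"
    then show "L2 PE (dif f)"
      by (rule L2_cong_AE[OF _ measurable_dif[OF assms(2)] ae])
  next
    assume "L2 PE (dif f)"
    then show "L2 PE (diff_op P M N F)"
      by (rule L2_cong_AE[OF _ diff_op_measurable[OF assms(1)]]) (use ae in \<open>auto elim: eventually_mono\<close>)
  qed
  then show ?thesis
    by (simp add: sobolev_def Lp_2_iff)
qed

lemma is_skorohodD:
  fixes \<Phi> :: "'w \<times> 'e \<Rightarrow> 'h::{real_inner, banach, second_countable_topology}"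
  assumes "is_skorohod P M N \<Phi> G" "L2 PE \<Phi>"
    and "f \<in> borel_measurable \<N>" "L2 P (\<lambda>\<omega>. f (N \<omega>))" "L2 PE (dif f)"
  shows "(\<integral>z. dif f z \<bullet> \<Phi> z \<partial>PE) = (\<integral>\<omega>. f (N \<omega>) \<bullet> G \<omega> \<partial>P)"
proof -
  let ?F = "\<lambda>\<omega>. f (N \<omega>)"
  have m [measurable]: "?F \<in> borel_measurable P" using assms(3) by measurable
  have "?F \<in> sobolev 2 P M N"
    using assms sobolev_iff[OF m assms(3)] by simp
  then have "(\<integral>z. diff_op P M N ?F z \<bullet> \<Phi> z \<partial>PE) = (\<integral>\<omega>. f (N \<omega>) \<bullet> G \<omega> \<partial>P)"
    using assms(1) by (simp add: is_skorohod_def)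
  moreover have "(\<integral>z. diff_op P M N ?F z \<bullet> \<Phi> z \<partial>PE) = (\<integral>z. dif f z \<bullet> \<Phi> z \<partial>PE)"
  proof (rule integral_cong_AE)
    show "AE z in PE. diff_op P M N ?F z \<bullet> \<Phi> z = dif f z \<bullet> \<Phi> z"
      using diff_op_AE[OF m assms(3)] by (auto elim: eventually_mono)
  qed (use diff_op_measurable[OF m] assms(2,3) in measurable)
  ultimately show ?thesis by simp
qed

end

section \<open>Integral forms of the Mecke formula\<close>

lemma (in pair_sigma_finite) L2_sections:
  fixes f :: "_ \<Rightarrow> 'h::{real_normed_vector, second_countable_topology}"
  assumes f: "L2 (M1 \<Otimes>\<^sub>M M2) f"
  shows "AE x in M1. L2 M2 (\<lambda>y. f (x, y))" "AE y in M2. L2 M1 (\<lambda>x. f (x, y))"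
proof -
  have [measurable]: "f \<in> borel_measurable (M1 \<Otimes>\<^sub>M M2)"
    and i: "integrable (M1 \<Otimes>\<^sub>M M2) (\<lambda>z. (norm (f z))\<^sup>2)"
    using f by (auto simp: L2_def)
  show "AE x in M1. L2 M2 (\<lambda>y. f (x, y))"
    using AE_integrable_fst'[OF i] AE_space by eventually_elim (simp add: L2_def)
  have "AE y in M2. integrable M1 (\<lambda>x. (norm (f (x, y)))\<^sup>2)"
    using AE_integrable_snd[of "\<lambda>x y. (norm (f (x, y)))\<^sup>2"] i by (simp add: case_prod_beta')
  then show "AE y in M2. L2 M1 (\<lambda>x. f (x, y))"
    using AE_space by eventually_elim (simp add: L2_def)
qed

context poisson_process
begin

sublocale Q: pair_sigma_finite M "PE" ..

text \<open>Exchanging the two marks turns \<open>D\<^sub>x\<Phi>(y)\<close> into \<open>D\<^sub>y\<Phi>(x)\<close>.\<close>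

lemma distr_swap_marks:
  "distr EPE EPE (\<lambda>(x, \<omega>, y). (y, \<omega>, x)) = EPE"
proof (rule measure_eqI)
  interpret MP: pair_sigma_finite M P ..
  interpret MM: pair_sigma_finite M M ..
  fix T assume "T \<in> sets (distr EPE EPE (\<lambda>(x, \<omega>, y). (y, \<omega>, x)))"
  then have T [measurable]: "T \<in> sets EPE" by simp
  have expand: "(\<integral>\<^sup>+z. f z \<partial>EPE) = (\<integral>\<^sup>+x. \<integral>\<^sup>+\<omega>. \<integral>\<^sup>+y. f (x, \<omega>, y) \<partial>M \<partial>P \<partial>M)"
    if [measurable]: "f \<in> borel_measurable EPE" for f
  proof -
    have "(\<integral>\<^sup>+z. f z \<partial>EPE) = (\<integral>\<^sup>+x. \<integral>\<^sup>+z. f (x, z) \<partial>PE \<partial>M)"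
      by (rule PM.P.nn_integral_fst[symmetric]) simp
    also have "\<dots> = (\<integral>\<^sup>+x. \<integral>\<^sup>+\<omega>. \<integral>\<^sup>+y. f (x, \<omega>, y) \<partial>M \<partial>P \<partial>M)"
      by (intro nn_integral_cong M.nn_integral_fst[symmetric]) simp
    finally show ?thesis .
  qed
  have "emeasure (distr EPE EPE (\<lambda>(x, \<omega>, y). (y, \<omega>, x))) T =
      (\<integral>\<^sup>+z. indicator T (case z of (x, \<omega>, y) \<Rightarrow> (y, \<omega>, x)) \<partial>EPE)"
  proof -
    have sw: "(\<lambda>(x, \<omega>, y). (y, \<omega>, x)) \<in> EPE \<rightarrow>\<^sub>M EPE" by measurable
    show ?thesis
      using nn_integral_distr[OF sw, of "indicator T"] T by simp
  qed
  also have "\<dots> = (\<integral>\<^sup>+x. \<integral>\<^sup>+\<omega>. \<integral>\<^sup>+y. indicator T (y, \<omega>, x) \<partial>M \<partial>P \<partial>M)"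
    by (subst expand) auto
  also have "\<dots> = (\<integral>\<^sup>+\<omega>. \<integral>\<^sup>+x. \<integral>\<^sup>+y. indicator T (y, \<omega>, x) \<partial>M \<partial>M \<partial>P)"
    by (rule PM.Fubini') measurable
  also have "\<dots> = (\<integral>\<^sup>+\<omega>. \<integral>\<^sup>+y. \<integral>\<^sup>+x. indicator T (y, \<omega>, x) \<partial>M \<partial>M \<partial>P)"
    by (intro nn_integral_cong MM.Fubini') measurable
  also have "\<dots> = (\<integral>\<^sup>+y. \<integral>\<^sup>+\<omega>. \<integral>\<^sup>+x. indicator T (y, \<omega>, x) \<partial>M \<partial>P \<partial>M)"
    by (rule MP.Fubini') measurable
  also have "\<dots> = emeasure EPE T"
    by (subst expand[symmetric]) auto
  finally show "emeasure (distr EPE EPE (\<lambda>(x, \<omega>, y). (y, \<omega>, x))) T =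
      emeasure EPE T" .
qed simp

lemma integral_swap_marks:
  fixes g :: "'e \<times> 'w \<times> 'e \<Rightarrow> 'b::{banach, second_countable_topology}"
  assumes g: "integrable EPE g"
  shows "integrable EPE (\<lambda>(y, \<omega>, x). g (x, \<omega>, y))"
    and "(\<integral>(y, \<omega>, x). g (x, \<omega>, y) \<partial>EPE) = (\<integral>z. g z \<partial>EPE)"
proof -
  have T: "(\<lambda>(x, \<omega>, y). (y, \<omega>, x)) \<in> EPE \<rightarrow>\<^sub>M EPE" by measurable
  have m: "g \<in> borel_measurable EPE" using g by simp
  have e: "(\<lambda>z. g (case z of (x, \<omega>, y) \<Rightarrow> (y, \<omega>, x))) = (\<lambda>(y, \<omega>, x). g (x, \<omega>, y))"
    by (auto simp: fun_eq_iff)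
  show "integrable EPE (\<lambda>(y, \<omega>, x). g (x, \<omega>, y))"
    using g integrable_distr_eq[OF T m] by (simp add: distr_swap_marks e)
  show "(\<integral>(y, \<omega>, x). g (x, \<omega>, y) \<partial>EPE) = (\<integral>z. g z \<partial>EPE)"
    using integral_distr[OF T m] by (simp add: distr_swap_marks e)
qed

lemma measurable_case_rest [measurable]:
  "(\<lambda>z. rest (fst z) (snd z)) \<in> IP \<rightarrow>\<^sub>M \<N>"
  "(\<lambda>z. X (fst z) (snd z)) \<in> IP \<rightarrow>\<^sub>M M"
  using measurable_rest_pair measurable_X_pair by (simp_all add: case_prod_beta')

lemma mecke_measure':
  "distr PE NE (\<lambda>z. (N (fst z), snd z)) =
    distr marked NE (\<lambda>z. (rest (fst z) (snd z), X (fst z) (snd z)))"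
  using mecke_measure by (simp add: case_prod_beta')

lemma mecke_nn_integral:
  assumes h: "h \<in> borel_measurable NE"
  shows "(\<integral>\<^sup>+z. h (N (fst z), snd z) \<partial>PE) =
    (\<integral>\<^sup>+z. h (rest (fst z) (snd z), X (fst z) (snd z)) \<partial>marked)"
proof -
  have m1: "(\<lambda>z. (N (fst z), snd z)) \<in> PE \<rightarrow>\<^sub>M NE" by measurable
  have m2: "(\<lambda>z. (rest (fst z) (snd z), X (fst z) (snd z))) \<in> marked \<rightarrow>\<^sub>M NE" by measurable
  show ?thesis
    using arg_cong[OF mecke_measure', of "\<lambda>m. nn_integral m h"] h
    by (simp add: nn_integral_distr[OF m1] nn_integral_distr[OF m2] case_prod_beta')
qed

lemma mecke_integral:
  fixes h :: "'e measure \<times> 'e \<Rightarrow> 'b::{banach, second_countable_topology}"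
  assumes h: "h \<in> borel_measurable NE"
  shows "integrable PE (\<lambda>z. h (N (fst z), snd z)) \<longleftrightarrow>
      integrable marked (\<lambda>z. h (rest (fst z) (snd z), X (fst z) (snd z)))"
    and "(\<integral>z. h (N (fst z), snd z) \<partial>PE) = (\<integral>z. h (rest (fst z) (snd z), X (fst z) (snd z)) \<partial>marked)"
proof -
  have m1: "(\<lambda>z. (N (fst z), snd z)) \<in> PE \<rightarrow>\<^sub>M NE" by measurable
  have m2: "(\<lambda>z. (rest (fst z) (snd z), X (fst z) (snd z))) \<in> marked \<rightarrow>\<^sub>M NE" by measurable
  show "integrable PE (\<lambda>z. h (N (fst z), snd z)) \<longleftrightarrow>
      integrable marked (\<lambda>z. h (rest (fst z) (snd z), X (fst z) (snd z)))"
    using arg_cong[OF mecke_measure', of "\<lambda>m. integrable m h"] h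
    by (simp add: integrable_distr_eq[OF m1] integrable_distr_eq[OF m2] case_prod_beta')
  show "(\<integral>z. h (N (fst z), snd z) \<partial>PE) = (\<integral>z. h (rest (fst z) (snd z), X (fst z) (snd z)) \<partial>marked)"
    using arg_cong[OF mecke_measure', of "\<lambda>m. integral\<^sup>L m h"] h
    by (simp add: integral_distr[OF m1] integral_distr[OF m2] case_prod_beta')
qed

lemma AE_marked_add_point: "AE z in marked. snd z \<in> space P \<and> fst z \<in> below (snd z) \<and>
    add_point (rest (fst z) (snd z)) (X (fst z) (snd z)) = N (snd z)"
proof -
  have "Measurable.pred IP (\<lambda>(m, \<omega>). m \<in> below \<omega>)"
    by (rule measurable_pair_measure_countable1) auto
  then have "Measurable.pred IP (\<lambda>z. fst z \<in> below (snd z))"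
    by (simp add: case_prod_beta')
  then have "AE z in marked. fst z \<in> below (snd z)"
    by (subst AE_marked_iff) auto
  then show ?thesis
    using AE_space by eventually_elim (auto simp: space_marked add_point_rest)
qed

lemma integral_marked:
  fixes f :: "nat \<times> 'w \<Rightarrow> 'b::{banach, second_countable_topology}"
  assumes f: "integrable marked f"
  shows "AE \<omega> in P. integrable (count_space UNIV) (\<lambda>m. indicator (below \<omega>) m *\<^sub>R f (m, \<omega>))"
    and "integrable P (\<lambda>\<omega>. \<integral>m. indicator (below \<omega>) m *\<^sub>R f (m, \<omega>) \<partial>count_space UNIV)"
    and "(\<integral>z. f z \<partial>marked) = (\<integral>\<omega>. (\<integral>m. indicator (below \<omega>) m *\<^sub>R f (m, \<omega>) \<partial>count_space UNIV) \<partial>P)"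
proof -
  have fm: "f \<in> borel_measurable IP"
    using borel_measurable_integrable[OF f] by (simp add: marked_def)
  let ?i = "\<lambda>z. indicator (below (snd z)) (fst z) :: real"
  have im: "?i \<in> borel_measurable IP"
  proof -
    have "(\<lambda>(m, \<omega>). indicator (below \<omega>) m :: real) \<in> borel_measurable IP"
      by (rule measurable_pair_measure_countable1) (auto simp: indicator_def)
    then show ?thesis by (simp add: case_prod_beta')
  qed
  have marked: "marked = density IP (\<lambda>z. ennreal (?i z))"
    by (simp add: marked_def case_prod_beta' ennreal_indicator)
  have "integrable IP (\<lambda>z. ?i z *\<^sub>R f z)"
    using f unfolding marked by (subst (asm) integrable_density) (auto simp: fm im)
  then have i: "integrable IP (\<lambda>(m, \<omega>). indicator (below \<omega>) m *\<^sub>R f (m, \<omega>))"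
    by (simp add: case_prod_beta')
  show "AE \<omega> in P. integrable (count_space UNIV) (\<lambda>m. indicator (below \<omega>) m *\<^sub>R f (m, \<omega>))"
    and "integrable P (\<lambda>\<omega>. \<integral>m. indicator (below \<omega>) m *\<^sub>R f (m, \<omega>) \<partial>count_space UNIV)"
    by (rule CP.AE_integrable_snd[OF i] CP.integrable_snd[OF i])+
  have "(\<integral>z. f z \<partial>marked) = (\<integral>z. ?i z *\<^sub>R f z \<partial>IP)"
    unfolding marked by (rule integral_density) (auto simp: fm im)
  also have "\<dots> = (\<integral>\<omega>. (\<integral>m. indicator (below \<omega>) m *\<^sub>R f (m, \<omega>) \<partial>count_space UNIV) \<partial>P)"
    using CP.integral_snd[OF i] by (simp add: case_prod_beta')
  finally show "(\<integral>z. f z \<partial>marked) = (\<integral>\<omega>. (\<integral>m. indicator (below \<omega>) m *\<^sub>R f (m, \<omega>) \<partial>count_space UNIV) \<partial>P)" .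
qed

lemma emeasure_N_count:
  assumes "\<omega> \<in> space P" "B \<in> sets M"
  shows "emeasure (N \<omega>) B = emeasure (count_space UNIV) {m \<in> below \<omega>. X m \<omega> \<in> B}"
proof -
  have "emeasure (count_space UNIV) {m \<in> below \<omega>. X m \<omega> \<in> B} =
      (\<integral>\<^sup>+m. indicator {m \<in> below \<omega>. X m \<omega> \<in> B} m \<partial>count_space UNIV)"
    by simp
  also have "\<dots> = (\<Sum>m. indicator {m \<in> below \<omega>. X m \<omega> \<in> B} m)"
    by (rule nn_integral_count_space_nat)
  also have "\<dots> = emeasure (N \<omega>) B"
    unfolding emeasure_N[OF assms] by (intro arg_cong[where f=suminf] ext) (auto simp: indicator_def)
  finally show ?thesis by simp
qed

lemma nn_integral_marked_points:
  assumes [measurable]: "B \<in> sets M" "v \<in> borel_measurable P"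
  shows "(\<integral>\<^sup>+z. indicator B (X (fst z) (snd z)) * v (snd z) \<partial>marked) = (\<integral>\<^sup>+\<omega>. emeasure (N \<omega>) B * v \<omega> \<partial>P)"
proof (subst nn_integral_marked)
  show "(\<integral>\<^sup>+\<omega>. (\<Sum>m. indicator (below \<omega>) m * (indicator B (X (fst (m, \<omega>)) (snd (m, \<omega>))) * v (snd (m, \<omega>)))) \<partial>P) =
      (\<integral>\<^sup>+\<omega>. emeasure (N \<omega>) B * v \<omega> \<partial>P)"
  proof (rule nn_integral_cong)
    fix \<omega> assume w: "\<omega> \<in> space P"
    have "(\<Sum>m. indicator (below \<omega>) m * (indicator B (X (fst (m, \<omega>)) (snd (m, \<omega>))) * v (snd (m, \<omega>)))) =
        (\<Sum>m. (if m \<in> below \<omega> then indicator B (X m \<omega>) else 0) * v \<omega>)"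
      by (intro arg_cong[where f=suminf] ext) (auto simp: indicator_def)
    then show "(\<Sum>m. indicator (below \<omega>) m * (indicator B (X (fst (m, \<omega>)) (snd (m, \<omega>))) * v (snd (m, \<omega>)))) =
        emeasure (N \<omega>) B * v \<omega>"
      using w by (simp add: emeasure_N)
  qed
qed measurable

section \<open>Duality for local events\<close>

text \<open>The Skorohod integral of the field \<open>1\<^sub>S(N) 1\<^sub>B(x)\<close>, as a function of the configuration.  Here
  \<open>S'\<close> is the event that arises from \<open>S\<close> by adding a point of \<open>B\<close>, so that summing
  \<open>1\<^sub>S(N - \<delta>\<^sub>x)\<close> over the points \<open>x\<close> of \<open>N\<close> in \<open>B\<close> gives \<open>N(B) 1\<close> on \<open>S'\<close> and \<open>0\<close> elsewhere.\<close>

definition weight :: "'e set \<Rightarrow> 'e measure set \<Rightarrow> 'e measure set \<Rightarrow> 'e measure \<Rightarrow> real" where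
  "weight B S S' \<eta> = enn2real (emeasure \<eta> B) * indicator S' \<eta> - measure M B * indicator S \<eta>"

lemma measurable_weight [measurable]:
  "B \<in> sets M \<Longrightarrow> S \<in> sets \<N> \<Longrightarrow> S' \<in> sets \<N> \<Longrightarrow>
    weight B S S' \<in> borel_measurable \<N>"
  unfolding weight_def[abs_def]
  by (intro borel_measurable_diff borel_measurable_times borel_measurable_const borel_measurable_indicator
      measurable_compose[OF measurable_emeasure_point_algebra]) auto

lemma integral_indicator_product:
  fixes v :: "'w \<Rightarrow> real"
  assumes B [measurable]: "B \<in> sets M" "emeasure M B < \<infinity>" and v: "integrable P v"
  shows "integrable PE (\<lambda>z. indicator B (snd z) * v (fst z))"
    and "(\<integral>z. indicator B (snd z) * v (fst z) \<partial>PE) = measure M B * (\<integral>\<omega>. v \<omega> \<partial>P)"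
proof -
  have [measurable]: "v \<in> borel_measurable P" using v by simp
  show i: "integrable PE (\<lambda>z. indicator B (snd z) * v (fst z))"
  proof (rule PM.Fubini_integrable)
    show "integrable P (\<lambda>\<omega>. \<integral>y. norm (indicator B (snd (\<omega>, y)) * v (fst (\<omega>, y))) \<partial>M)"
      using v by (simp add: abs_mult)
    show "AE \<omega> in P. integrable M (\<lambda>y. indicator B (snd (\<omega>, y)) * v (fst (\<omega>, y)))"
      using B by auto
  qed measurable
  show "(\<integral>z. indicator B (snd z) * v (fst z) \<partial>PE) = measure M B * (\<integral>\<omega>. v \<omega> \<partial>P)"
    using PM.integral_fst'[OF i] B by simp
qed

text \<open>By the shift relation the reduced Mecke formula involves no configuration with a removed point
  any more.  The bound on the counts makes the right-hand side integrable for every integrable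
  \<open>u(N)\<close>.\<close>

lemma mecke_event:
  fixes u :: "'e measure \<Rightarrow> real"
  assumes B [measurable]: "B \<in> sets M" and S [measurable]: "S \<in> sets \<N>" "S' \<in> sets \<N>"
    and u [measurable]: "u \<in> borel_measurable \<N>" and int: "integrable P (\<lambda>\<omega>. u (N \<omega>))"
    and shift: "\<And>\<eta> x. \<eta> \<in> point_measures M \<Longrightarrow> x \<in> B \<Longrightarrow> add_point \<eta> x \<in> S' \<longleftrightarrow> \<eta> \<in> S"
    and bound: "\<And>\<eta>. \<eta> \<in> S' \<Longrightarrow> emeasure \<eta> B \<le> ennreal c"
  shows "integrable PE
      (\<lambda>z. indicator B (snd z) * indicator S (N (fst z)) * u (add_point (N (fst z)) (snd z)))" (is "integrable _ ?L")
    and "(\<integral>z. indicator B (snd z) * indicator S (N (fst z)) * u (add_point (N (fst z)) (snd z)) \<partial>PE) =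
      (\<integral>\<omega>. enn2real (emeasure (N \<omega>) B) * indicator S' (N \<omega>) * u (N \<omega>) \<partial>P)"
proof -
  define h where "h z = indicator B (snd z) * indicator S (fst z) * u (add_point (fst z) (snd z))" for z
  have h [measurable]: "h \<in> borel_measurable NE"
    unfolding h_def[abs_def] by measurable
  define v where "v \<omega> = indicator S' (N \<omega>) * u (N \<omega>)" for \<omega>
  have [measurable]: "v \<in> borel_measurable P" unfolding v_def[abs_def] by measurable
  define g where "g z = indicator B (X (fst z) (snd z)) * v (snd z)" for z
  have g [measurable]: "g \<in> borel_measurable IP"
    unfolding g_def[abs_def] by measurable
  have gh: "AE z in marked. h (rest (fst z) (snd z), X (fst z) (snd z)) = g z"
    using AE_marked_add_point
  proof eventually_elim
    case (elim z)
    then show ?case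
      using shift[OF rest_point_measure[of "snd z" "fst z"], of "X (fst z) (snd z)"]
      by (auto simp: h_def g_def v_def indicator_def)
  qed
  have gi: "integrable marked g"
  proof (rule integrableI_bounded)
    have "(\<integral>\<^sup>+z. ennreal (norm (g z)) \<partial>marked) =
        (\<integral>\<^sup>+z. indicator B (X (fst z) (snd z)) * ennreal \<bar>v (snd z)\<bar> \<partial>marked)"
      by (intro nn_integral_cong) (auto simp: g_def indicator_def)
    also have "\<dots> = (\<integral>\<^sup>+\<omega>. emeasure (N \<omega>) B * ennreal \<bar>v \<omega>\<bar> \<partial>P)"
      by (intro nn_integral_marked_points) auto
    also have "\<dots> \<le> (\<integral>\<^sup>+\<omega>. ennreal c * ennreal \<bar>u (N \<omega>)\<bar> \<partial>P)"
      using bound by (intro nn_integral_mono) (auto simp: v_def indicator_def intro: mult_right_mono)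
    also have "\<dots> = ennreal c * (\<integral>\<^sup>+\<omega>. ennreal \<bar>u (N \<omega>)\<bar> \<partial>P)"
      by (intro nn_integral_cmult) auto
    also have "\<dots> < \<infinity>"
      using int by (auto simp: integrable_iff_bounded ennreal_mult_less_top)
    finally show "(\<integral>\<^sup>+z. ennreal (norm (g z)) \<partial>marked) < \<infinity>" .
  qed measurable
  have hm: "(\<lambda>z. h (rest (fst z) (snd z), X (fst z) (snd z))) \<in> borel_measurable marked" by measurable
  have hi: "integrable marked (\<lambda>z. h (rest (fst z) (snd z), X (fst z) (snd z)))"
    using gi by (rule integrable_cong_AE_imp[OF _ hm]) (use gh in \<open>auto elim: eventually_mono\<close>)
  then show "integrable PE ?L"
    using mecke_integral(1)[OF h] by (simp add: h_def)
  have "(\<integral>z. ?L z \<partial>PE) = (\<integral>z. h (rest (fst z) (snd z), X (fst z) (snd z)) \<partial>marked)"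
    using mecke_integral(2)[OF h] by (simp add: h_def)
  also have "\<dots> = (\<integral>z. g z \<partial>marked)"
    using gh by (intro integral_cong_AE hm) auto
  also have "\<dots> = (\<integral>\<omega>. (\<integral>m. indicator (below \<omega>) m *\<^sub>R g (m, \<omega>) \<partial>count_space UNIV) \<partial>P)"
    by (rule integral_marked(3)[OF gi])
  also have "\<dots> = (\<integral>\<omega>. enn2real (emeasure (N \<omega>) B) * indicator S' (N \<omega>) * u (N \<omega>) \<partial>P)"
  proof (rule Bochner_Integration.integral_cong[OF refl])
    fix \<omega> assume w: "\<omega> \<in> space P"
    have "(\<integral>m. indicator (below \<omega>) m *\<^sub>R g (m, \<omega>) \<partial>count_space UNIV) =
        (\<integral>m. indicator {m \<in> below \<omega>. X m \<omega> \<in> B} m * v \<omega> \<partial>count_space UNIV)"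
      by (intro Bochner_Integration.integral_cong) (auto simp: g_def indicator_def)
    also have "\<dots> = enn2real (emeasure (N \<omega>) B) * v \<omega>"
      unfolding emeasure_N_count[OF w B] by (simp add: measure_def)
    finally show "(\<integral>m. indicator (below \<omega>) m *\<^sub>R g (m, \<omega>) \<partial>count_space UNIV) =
        enn2real (emeasure (N \<omega>) B) * indicator S' (N \<omega>) * u (N \<omega>)"
      by (simp add: v_def)
  qed
  finally show "(\<integral>z. ?L z \<partial>PE) =
      (\<integral>\<omega>. enn2real (emeasure (N \<omega>) B) * indicator S' (N \<omega>) * u (N \<omega>) \<partial>P)" .
qed

lemma event_duality:
  fixes u :: "'e measure \<Rightarrow> real"
  assumes B [measurable]: "B \<in> sets M" "emeasure M B < \<infinity>"
    and S [measurable]: "S \<in> sets \<N>" "S' \<in> sets \<N>"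
    and u [measurable]: "u \<in> borel_measurable \<N>" and int: "integrable P (\<lambda>\<omega>. u (N \<omega>))"
    and shift: "\<And>\<eta> x. \<eta> \<in> point_measures M \<Longrightarrow> x \<in> B \<Longrightarrow> add_point \<eta> x \<in> S' \<longleftrightarrow> \<eta> \<in> S"
    and bound: "\<And>\<eta>. \<eta> \<in> S' \<Longrightarrow> emeasure \<eta> B \<le> ennreal c" and c: "0 \<le> c"
  shows "integrable PE (\<lambda>z. indicator B (snd z) * indicator S (N (fst z)) * dif u z)"
    and "integrable P (\<lambda>\<omega>. weight B S S' (N \<omega>) * u (N \<omega>))"
    and "(\<integral>z. indicator B (snd z) * indicator S (N (fst z)) * dif u z \<partial>PE) =
      (\<integral>\<omega>. weight B S S' (N \<omega>) * u (N \<omega>) \<partial>P)"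
proof -
  note m = mecke_event[OF B(1) S u int shift bound]
  have S_int: "integrable P (\<lambda>\<omega>. indicator S (N \<omega>) * u (N \<omega>))"
    by (rule Bochner_Integration.integrable_bound[OF int]) (auto simp: indicator_def)
  have S'_int: "integrable P (\<lambda>\<omega>. enn2real (emeasure (N \<omega>) B) * indicator S' (N \<omega>) * u (N \<omega>))"
  proof (rule Bochner_Integration.integrable_bound)
    show "integrable P (\<lambda>\<omega>. c * u (N \<omega>))" using int by simp
    have "\<bar>enn2real (emeasure \<eta> B) * indicator S' \<eta> * u \<eta>\<bar> \<le> \<bar>c * u \<eta>\<bar>" for \<eta>
    proof (cases "\<eta> \<in> S'")
      case True
      then have "enn2real (emeasure \<eta> B) \<le> c"
        using enn2real_mono[OF bound[OF True]] c by simp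
      then show ?thesis using True c by (simp add: abs_mult mult_right_mono)
    qed simp
    then show "AE \<omega> in P. norm (enn2real (emeasure (N \<omega>) B) * indicator S' (N \<omega>) * u (N \<omega>)) \<le> norm (c * u (N \<omega>))"
      by simp
  qed measurable
  note q = integral_indicator_product[OF B S_int]
  have e: "indicator B (snd z) * indicator S (N (fst z)) * dif u z =
      indicator B (snd z) * indicator S (N (fst z)) * u (add_point (N (fst z)) (snd z)) -
      indicator B (snd z) * (indicator S (N (fst z)) * u (N (fst z)))" for z
    by (simp add: dif_def algebra_simps)
  show "integrable PE (\<lambda>z. indicator B (snd z) * indicator S (N (fst z)) * dif u z)"
    unfolding e using m(1) q(1) by (rule Bochner_Integration.integrable_diff)
  have w: "weight B S S' (N \<omega>) * u (N \<omega>) =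
      enn2real (emeasure (N \<omega>) B) * indicator S' (N \<omega>) * u (N \<omega>) - measure M B * (indicator S (N \<omega>) * u (N \<omega>))" for \<omega>
    by (simp add: weight_def algebra_simps)
  show "integrable P (\<lambda>\<omega>. weight B S S' (N \<omega>) * u (N \<omega>))"
    unfolding w using S_int S'_int by auto
  show "(\<integral>z. indicator B (snd z) * indicator S (N (fst z)) * dif u z \<partial>PE) =
      (\<integral>\<omega>. weight B S S' (N \<omega>) * u (N \<omega>) \<partial>P)"
    unfolding e w using m q S_int S'_int
    by (subst Bochner_Integration.integral_diff; (subst Bochner_Integration.integral_diff)?) auto
qed

lemma local_functional_L2:
  fixes f :: "'e measure \<Rightarrow> real" and h :: "'h::{real_normed_vector, second_countable_topology}"
  assumes [measurable]: "f \<in> borel_measurable \<N>" and K [measurable]: "K \<in> sets M" "emeasure M K < \<infinity>"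
    and bound: "\<And>\<eta>. \<eta> \<in> point_measures M \<Longrightarrow> \<bar>f \<eta>\<bar> \<le> C"
    and local: "\<And>\<eta> y. \<eta> \<in> point_measures M \<Longrightarrow> y \<in> space M - K \<Longrightarrow> f (add_point \<eta> y) = f \<eta>"
  shows "L2 P (\<lambda>\<omega>. f (N \<omega>) *\<^sub>R h)" and "L2 PE (dif (\<lambda>\<eta>. f \<eta> *\<^sub>R h))"
proof -
  show "L2 P (\<lambda>\<omega>. f (N \<omega>) *\<^sub>R h)"
  proof (rule L2_bounded_indicator)
    show "AE \<omega> in P. norm (f (N \<omega>) *\<^sub>R h) \<le> (C * norm h) * indicator (space P) \<omega>"
      using AE_space by eventually_elim (auto intro!: mult_right_mono bound simp: N_point_measure)
  qed (auto simp: P.emeasure_space_1)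
  show "L2 PE (dif (\<lambda>\<eta>. f \<eta> *\<^sub>R h))"
  proof (rule L2_bounded_indicator)
    show "space P \<times> K \<in> sets PE" by auto
    show "emeasure PE (space P \<times> K) < \<infinity>"
      using K by (simp add: M.emeasure_pair_measure_Times P.emeasure_space_1)
    show "AE z in PE. norm (dif (\<lambda>\<eta>. f \<eta> *\<^sub>R h) z) \<le> (2 * C * norm h) * indicator (space P \<times> K) z"
      using AE_space
    proof eventually_elim
      case (elim z)
      then have z: "fst z \<in> space P" "snd z \<in> space M" by (auto simp: space_pair_measure)
      note pm = N_point_measure[OF z(1)]
      have "dif (\<lambda>\<eta>. f \<eta> *\<^sub>R h) z = (f (add_point (N (fst z)) (snd z)) - f (N (fst z))) *\<^sub>R h"
        by (simp add: dif_def algebra_simps)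
      moreover have "\<bar>f (add_point (N (fst z)) (snd z)) - f (N (fst z))\<bar> \<le> 2 * C"
        using bound[OF pm] bound[OF add_point_in_point_measures[OF pm], of "snd z"] by linarith
      ultimately show ?case
        using local[OF pm, of "snd z"] z
        by (cases "snd z \<in> K") (auto simp: mem_Times_iff intro: mult_right_mono)
    qed
  qed measurable
qed

end

section \<open>Commutation of the difference operator with the Skorohod integral\<close>

context poisson_process
begin

lemma is_skorohod_L2: "is_skorohod P M N \<Phi> G \<Longrightarrow> L2 P G"
  by (simp add: is_skorohod_def Lp_2_iff)

text \<open>The positive and the negative part of \<open>w\<close> are densities of two measures on configurations that
  are marked with the fixed point \<open>x\<close>.  By hypothesis they agree on boxes, so they are equal.\<close>

lemma AE_zero_if_boxes_zero:
  fixes w :: "'w \<Rightarrow> real"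
  assumes w: "w \<in> borel_measurable P" and x: "x \<in> space M"
    and int: "\<And>n k I. I \<in> labels n \<Longrightarrow> x \<in> atom n I \<Longrightarrow> integrable P (\<lambda>\<omega>. indicator (cyl n k) (N \<omega>) * w \<omega>)"
    and zero: "\<And>n k I. I \<in> labels n \<Longrightarrow> x \<in> atom n I \<Longrightarrow> (\<integral>\<omega>. indicator (cyl n k) (N \<omega>) * w \<omega> \<partial>P) = 0"
  shows "AE \<omega> in P. w \<omega> = 0"
proof -
  obtain v where v [measurable]: "v \<in> borel_measurable \<N>" and wv: "AE \<omega> in P. w \<omega> = v (N \<omega>)"
    using N_representative[OF w] by blast
  have [measurable]: "w \<in> borel_measurable P" by (rule w)
  define m where "m s = distr (density P (\<lambda>\<omega>. ennreal (s * w \<omega>))) NE (\<lambda>\<omega>. (N \<omega>, x))" for s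
  have T: "(\<lambda>\<omega>. (N \<omega>, x)) \<in> density P (\<lambda>\<omega>. ennreal (s * w \<omega>)) \<rightarrow>\<^sub>M NE" for s
    using x by simp
  have em: "emeasure (m s) (S \<times> B) = (\<integral>\<^sup>+\<omega>. ennreal (s * (indicator S (N \<omega>) * w \<omega>)) * indicator B x \<partial>P)"
    if [measurable]: "S \<in> sets \<N>" "B \<in> sets M" for s S B
  proof -
    have "emeasure (m s) (S \<times> B) = emeasure (density P (\<lambda>\<omega>. ennreal (s * w \<omega>))) ((\<lambda>\<omega>. (N \<omega>, x)) -` (S \<times> B) \<inter> space P)"
      unfolding m_def by (subst emeasure_distr[OF T]) auto
    also have "\<dots> = (\<integral>\<^sup>+\<omega>. ennreal (s * w \<omega>) * indicator ((\<lambda>\<omega>. (N \<omega>, x)) -` (S \<times> B) \<inter> space P) \<omega> \<partial>P)"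
    proof (rule emeasure_density)
      show "(\<lambda>\<omega>. (N \<omega>, x)) -` (S \<times> B) \<inter> space P \<in> sets P"
        using measurable_sets[OF T[of 1], of "S \<times> B"] by auto
    qed measurable
    also have "\<dots> = (\<integral>\<^sup>+\<omega>. ennreal (s * (indicator S (N \<omega>) * w \<omega>)) * indicator B x \<partial>P)"
      by (intro nn_integral_cong) (auto simp: indicator_def)
    finally show ?thesis .
  qed
  have "m 1 = m (- 1)"
  proof (rule measure_eqI_boxes)
    show "sets (m 1) = sets NE" "sets (m (- 1)) = sets NE"
      by (simp_all add: m_def)
    have lf: "{z \<in> space NE. fst z \<in> locally_finite} \<in> sets NE"
      by measurable
    have "AE \<omega> in density P (\<lambda>\<omega>. ennreal (s * w \<omega>)). N \<omega> \<in> locally_finite" for s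
      using AE_locally_finite by (subst AE_density) (auto elim: eventually_mono)
    then have "AE z in m s. fst z \<in> locally_finite" for s
      unfolding m_def by (subst AE_distr_iff[OF T lf]) simp
    then show "AE z in m 1. fst z \<in> locally_finite" "AE z in m (- 1). fst z \<in> locally_finite"
      by auto
    fix n k I assume I: "I \<in> labels n"
    have "emeasure (m 1) (cyl n k \<times> atom n I) = emeasure (m (- 1)) (cyl n k \<times> atom n I) \<and>
        emeasure (m 1) (cyl n k \<times> atom n I) \<noteq> \<infinity>"
    proof (cases "x \<in> atom n I")
      case True
      note i = int[OF I True, of k]
      have fin: "(\<integral>\<^sup>+\<omega>. ennreal (indicator (cyl n k) (N \<omega>) * w \<omega>) \<partial>P) < \<infinity>"
        "(\<integral>\<^sup>+\<omega>. ennreal (- (indicator (cyl n k) (N \<omega>) * w \<omega>)) \<partial>P) < \<infinity>"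
        using i by (auto simp: real_integrable_def less_top[symmetric])
      have "enn2real (\<integral>\<^sup>+\<omega>. ennreal (indicator (cyl n k) (N \<omega>) * w \<omega>) \<partial>P) =
          enn2real (\<integral>\<^sup>+\<omega>. ennreal (- (indicator (cyl n k) (N \<omega>) * w \<omega>)) \<partial>P)"
        using zero[OF I True, of k] real_lebesgue_integral_def[OF i] by simp
      then have "(\<integral>\<^sup>+\<omega>. ennreal (indicator (cyl n k) (N \<omega>) * w \<omega>) \<partial>P) =
          (\<integral>\<^sup>+\<omega>. ennreal (- (indicator (cyl n k) (N \<omega>) * w \<omega>)) \<partial>P)"
        using fin by (metis ennreal_enn2real infinity_ennreal_def)
      then show ?thesis
        using True fin by (simp add: em)
    qed (simp add: em)
    then show "emeasure (m 1) (cyl n k \<times> atom n I) = emeasure (m (- 1)) (cyl n k \<times> atom n I)"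
      and "emeasure (m 1) (cyl n k \<times> atom n I) \<noteq> \<infinity>" by auto
  qed
  then have eq: "(\<integral>\<^sup>+\<omega>. ennreal (indicator S (N \<omega>) * w \<omega>) \<partial>P) = (\<integral>\<^sup>+\<omega>. ennreal (- (indicator S (N \<omega>) * w \<omega>)) \<partial>P)"
    if "S \<in> sets \<N>" for S
    using em[OF that sets.top, of 1] em[OF that sets.top, of "- 1"] x by simp
  have pos: "AE \<omega> in P. s * w \<omega> \<le> 0" if s: "s = 1 \<or> s = - 1" for s :: real
  proof -
    let ?S = "{\<eta> \<in> space \<N>. 0 < s * v \<eta>}"
    have S: "?S \<in> sets \<N>" by measurable
    have ind: "AE \<omega> in P. indicator ?S (N \<omega>) * w \<omega> = s * max 0 (s * w \<omega>)"
      using wv AE_space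
    proof eventually_elim
      case (elim \<omega>)
      then show ?case
        using s N_point_measure[of \<omega>] by (auto simp: indicator_def space_point_algebra)
    qed
    have "(\<integral>\<^sup>+\<omega>. ennreal (max 0 (s * w \<omega>)) \<partial>P) = (\<integral>\<^sup>+\<omega>. ennreal (s * (indicator ?S (N \<omega>) * w \<omega>)) \<partial>P)"
      using ind by (intro nn_integral_cong_AE) (use s in \<open>auto elim!: eventually_mono\<close>)
    also have "\<dots> = (\<integral>\<^sup>+\<omega>. ennreal (- s * (indicator ?S (N \<omega>) * w \<omega>)) \<partial>P)"
      using eq[OF S] s by auto
    also have "\<dots> = (\<integral>\<^sup>+\<omega>. 0 \<partial>P)"
      using ind by (intro nn_integral_cong_AE) (use s in \<open>auto elim!: eventually_mono simp: ennreal_neg\<close>)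
    finally have "(\<integral>\<^sup>+\<omega>. ennreal (max 0 (s * w \<omega>)) \<partial>P) = 0"
      by simp
    then have "AE \<omega> in P. ennreal (max 0 (s * w \<omega>)) = 0"
      by (subst (asm) nn_integral_0_iff_AE) auto
    then show ?thesis by eventually_elim (auto simp: max_def split: if_splits)
  qed
  show ?thesis
    using pos[of 1] pos[of "- 1"] by (auto elim: eventually_elim2)
qed

text \<open>The requirements on the test fields.  Dependence on the configuration in the set \<open>K\<close> of finite
  intensity alone puts \<open>1\<^sub>S(N)\<close> and \<open>weight B S S' (N)\<close> into the Sobolev space, since their
  differences are bounded and vanish off \<open>K\<close>.\<close>

definition local_event :: "'e set \<Rightarrow> 'e set \<Rightarrow> 'e measure set \<Rightarrow> 'e measure set \<Rightarrow> real \<Rightarrow> bool" where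
  "local_event K B S S' c \<longleftrightarrow>
    K \<in> sets M \<and> emeasure M K < \<infinity> \<and> B \<in> sets M \<and> B \<subseteq> K \<and>
    S \<in> sets \<N> \<and> S' \<in> sets \<N> \<and> 0 \<le> c \<and>
    (\<forall>\<eta>\<in>point_measures M. \<forall>x\<in>B. add_point \<eta> x \<in> S' \<longleftrightarrow> \<eta> \<in> S) \<and>
    (\<forall>\<eta>\<in>point_measures M. \<forall>y\<in>space M - K.
      (add_point \<eta> y \<in> S \<longleftrightarrow> \<eta> \<in> S) \<and> (add_point \<eta> y \<in> S' \<longleftrightarrow> \<eta> \<in> S')) \<and>
    (\<forall>\<eta>\<in>S'. emeasure \<eta> B \<le> ennreal c)"

lemma local_eventD:
  assumes "local_event K B S S' c"
  shows "K \<in> sets M" "emeasure M K < \<infinity>" "B \<in> sets M" "B \<subseteq> K" "emeasure M B < \<infinity>"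
    "S \<in> sets \<N>" "S' \<in> sets \<N>" "0 \<le> c"
    "\<And>\<eta> x. \<eta> \<in> point_measures M \<Longrightarrow> x \<in> B \<Longrightarrow> add_point \<eta> x \<in> S' \<longleftrightarrow> \<eta> \<in> S"
    "\<And>\<eta> y. \<eta> \<in> point_measures M \<Longrightarrow> y \<in> space M - K \<Longrightarrow> add_point \<eta> y \<in> S \<longleftrightarrow> \<eta> \<in> S"
    "\<And>\<eta> y. \<eta> \<in> point_measures M \<Longrightarrow> y \<in> space M - K \<Longrightarrow> add_point \<eta> y \<in> S' \<longleftrightarrow> \<eta> \<in> S'"
    "\<And>\<eta>. \<eta> \<in> S' \<Longrightarrow> emeasure \<eta> B \<le> ennreal c"
  using assms emeasure_mono[of B K M] unfolding local_event_def by (auto intro: le_less_trans)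

lemma local_event_subset:
  assumes "local_event K B S S' c" "B' \<in> sets M" "B' \<subseteq> B"
  shows "local_event K B' S S' c"
proof -
  note D = local_eventD[OF assms(1)]
  have "emeasure \<eta> B' \<le> ennreal c" if "\<eta> \<in> S'" for \<eta>
  proof -
    have "sets \<eta> = sets M"
      using sets.sets_into_space[OF D(7)] that by (auto simp: space_point_algebra dest: point_measuresD)
    then show ?thesis
      using D(3) D(12)[OF that] emeasure_mono[of B' B \<eta>] assms by (auto intro: order_trans)
  qed
  then show ?thesis
    using assms D unfolding local_event_def by auto
qed

lemma local_event_cyl:
  assumes I: "I \<in> labels n"
  shows "local_event (\<Union>i<n. A i) (atom n I) (cyl n k) (cyl n (incr k I)) (real (Suc (k I)))"
proof -
  let ?K = "\<Union>i<n. A i"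
  have K: "?K \<in> sets M" using A_sets by auto
  have "emeasure M ?K \<le> (\<Sum>i<n. emeasure M (A i))"
    using A_sets by (intro emeasure_subadditive_finite) auto
  also have "\<dots> < \<infinity>" using A_finite by simp
  finally have "emeasure M ?K < \<infinity>" .
  moreover have sub: "atom n J \<subseteq> ?K" if J: "J \<in> labels n" for J
  proof -
    obtain i where i: "i \<in> J" "i < n" using J by (auto simp: labels_def)
    then show ?thesis using atom_subset_A[OF J i(1)] by auto
  qed
  moreover have "add_point \<eta> y \<in> cyl n l \<longleftrightarrow> \<eta> \<in> cyl n l"
    if \<eta>: "\<eta> \<in> point_measures M" and y: "y \<in> space M - ?K" for \<eta> y l
  proof -
    have "emeasure (add_point \<eta> y) (atom n J) = emeasure \<eta> (atom n J)" if "J \<in> labels n" for J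
    proof -
      have "y \<notin> atom n J" using sub[OF that] y by blast
      then show ?thesis by (simp add: emeasure_add_point point_measuresD(1)[OF \<eta>])
    qed
    then show ?thesis
      using \<eta> add_point_in_point_measures[OF \<eta>] by (auto simp: cyl_def)
  qed
  moreover have "emeasure \<eta> (atom n I) \<le> ennreal (real (Suc (k I)))" if "\<eta> \<in> cyl n (incr k I)" for \<eta>
    using that I by (auto simp: cyl_def ennreal_of_nat_eq_real_of_nat)
  ultimately show ?thesis
    using I K add_point_cyl_iff[OF _ I] unfolding local_event_def by auto
qed

lemma weight_bounded:
  assumes "local_event K B S S' c"
  shows "\<bar>weight B S S' \<eta>\<bar> \<le> c + measure M B"
proof -
  note D = local_eventD[OF assms]
  have "0 \<le> enn2real (emeasure \<eta> B) * indicator S' \<eta>" by simp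
  moreover have "enn2real (emeasure \<eta> B) * indicator S' \<eta> \<le> c"
    using D(8) enn2real_mono[OF D(12)] by (cases "\<eta> \<in> S'") auto
  moreover have "0 \<le> measure M B * indicator S \<eta>" "measure M B * indicator S \<eta> \<le> measure M B"
    by (auto simp: indicator_def)
  ultimately show ?thesis unfolding weight_def by linarith
qed

lemma weight_local:
  assumes "local_event K B S S' c" "\<eta> \<in> point_measures M" "y \<in> space M - K"
  shows "weight B S S' (add_point \<eta> y) = weight B S S' \<eta>"
proof -
  note D = local_eventD[OF assms(1)]
  have "emeasure (add_point \<eta> y) B = emeasure \<eta> B"
  proof -
    have "y \<notin> B" using D(4) assms(3) by blast
    then show ?thesis using D(3) by (simp add: emeasure_add_point point_measuresD(1)[OF assms(2)])
  qed
  then show ?thesis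
    using D(10)[OF assms(2,3)] D(11)[OF assms(2,3)] by (simp add: weight_def indicator_def)
qed

text \<open>The commutation relation for the field \<open>1\<^sub>S(N) 1\<^sub>B(x)\<close>, tested against \<open>u(N)\<close>.  If
  \<open>Y S\<close> is the event that \<open>S\<close> holds after the point \<open>y\<close> has been added, then \<open>Y S'\<close> is the shift of
  \<open>Y S\<close>, because points can be added in any order.  The relation is the difference of the dualities for \<open>Y S\<close> and \<open>S\<close>, where the term
  \<open>1\<^sub>S(N) 1\<^sub>B(y)\<close> appears because the count in \<open>B\<close> grows by one if \<open>y\<close> lies in \<open>B\<close>.\<close>

lemma event_commutation:
  fixes u :: "'e measure \<Rightarrow> real"
  assumes L: "local_event K B S S' c" and u [measurable]: "u \<in> borel_measurable \<N>"
    and int: "integrable P (\<lambda>\<omega>. u (N \<omega>))" and y: "y \<in> space M"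
  shows "integrable P (\<lambda>\<omega>. dif (weight B S S') (\<omega>, y) * u (N \<omega>))"
    and "(\<integral>\<omega>. dif (weight B S S') (\<omega>, y) * u (N \<omega>) \<partial>P) =
      (\<integral>z. indicator B (snd z) * dif (indicator S) (fst z, y) * dif u z \<partial>PE) +
      indicator B y * (\<integral>\<omega>. indicator S (N \<omega>) * u (N \<omega>) \<partial>P)"
proof -
  note D = local_eventD[OF L]
  have [measurable]: "B \<in> sets M" "S \<in> sets \<N>" "S' \<in> sets \<N>"
    using D by auto
  have add_m [measurable]: "(\<lambda>\<eta>. add_point \<eta> y) \<in> \<N> \<rightarrow>\<^sub>M \<N>"
    using y by measurable
  define Y where "Y T = {\<eta> \<in> space \<N>. add_point \<eta> y \<in> T}" for T
  have Y_sets: "Y T \<in> sets \<N>" if [measurable]: "T \<in> sets \<N>" for T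
    unfolding Y_def by measurable
  have Y_iff: "\<eta> \<in> Y T \<longleftrightarrow> add_point \<eta> y \<in> T" if "\<eta> \<in> point_measures M" for \<eta> T
    using that by (simp add: Y_def space_point_algebra)
  have Y_shift: "add_point \<eta> x \<in> Y S' \<longleftrightarrow> \<eta> \<in> Y S" if \<eta>: "\<eta> \<in> point_measures M" and x: "x \<in> B" for \<eta> x
  proof -
    have "add_point \<eta> x \<in> Y S' \<longleftrightarrow> add_point (add_point \<eta> y) x \<in> S'"
      using \<eta> by (simp add: Y_iff add_point_in_point_measures add_point_commute[of \<eta> x y])
    also have "\<dots> \<longleftrightarrow> \<eta> \<in> Y S"
      using \<eta> x by (simp add: D(9) add_point_in_point_measures Y_iff)
    finally show ?thesis .
  qed
  have Y_bound: "emeasure \<eta> B \<le> ennreal c" if "\<eta> \<in> Y S'" for \<eta>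
  proof -
    have \<eta>: "\<eta> \<in> point_measures M" "add_point \<eta> y \<in> S'"
      using that by (auto simp: Y_def space_point_algebra)
    then have "emeasure \<eta> B \<le> emeasure (add_point \<eta> y) B"
      by (simp add: emeasure_add_point point_measuresD(1))
    then show ?thesis using D(12)[OF \<eta>(2)] by (rule order_trans)
  qed
  note e1 = event_duality[OF D(3,5) D(6,7) u int D(9) D(12) D(8)]
  note e2 = event_duality[OF D(3,5) Y_sets[OF D(6)] Y_sets[OF D(7)] u int Y_shift Y_bound D(8)]
  have w: "weight B S S' (add_point \<eta> y) = weight B (Y S) (Y S') \<eta> + indicator B y * indicator S \<eta>"
    if \<eta>: "\<eta> \<in> point_measures M" for \<eta>
  proof -
    have em: "emeasure (add_point \<eta> y) B = emeasure \<eta> B + indicator B y"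
      using \<eta> D(3) by (simp add: emeasure_add_point point_measuresD(1))
    have "enn2real (emeasure (add_point \<eta> y) B) * indicator S' (add_point \<eta> y) =
        enn2real (emeasure \<eta> B) * indicator S' (add_point \<eta> y) + indicator B y * indicator S \<eta>"
    proof (cases "add_point \<eta> y \<in> S'")
      case True
      then have "emeasure \<eta> B < \<infinity>"
        using Y_bound[of \<eta>] \<eta> by (auto simp: Y_iff intro: le_less_trans)
      then show ?thesis
        using True D(9)[OF \<eta>, of y] unfolding em
        by (auto simp: enn2real_plus indicator_def split: if_splits)
    next
      case False
      then show ?thesis using D(9)[OF \<eta>, of y] by (auto simp: indicator_def)
    qed
    then show ?thesis
      using \<eta> by (simp add: weight_def Y_iff indicator_def)
  qed
  have w': "dif (weight B S S') (\<omega>, y) * u (N \<omega>) =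
      (weight B (Y S) (Y S') (N \<omega>) * u (N \<omega>) - weight B S S' (N \<omega>) * u (N \<omega>)) +
      indicator B y * (indicator S (N \<omega>) * u (N \<omega>))" if "\<omega> \<in> space P" for \<omega>
    using w[OF N_point_measure[OF that]] by (simp add: dif_def algebra_simps)
  have S_int: "integrable P (\<lambda>\<omega>. indicator S (N \<omega>) * u (N \<omega>))"
    by (rule Bochner_Integration.integrable_bound[OF int]) (auto simp: indicator_def)
  have i: "integrable P (\<lambda>\<omega>. (weight B (Y S) (Y S') (N \<omega>) * u (N \<omega>) - weight B S S' (N \<omega>) * u (N \<omega>)) +
      indicator B y * (indicator S (N \<omega>) * u (N \<omega>)))"
    using e1(2) e2(2) S_int by auto
  then show "integrable P (\<lambda>\<omega>. dif (weight B S S') (\<omega>, y) * u (N \<omega>))"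
    by (subst Bochner_Integration.integrable_cong[OF refl w'])
  have "(\<integral>\<omega>. dif (weight B S S') (\<omega>, y) * u (N \<omega>) \<partial>P) =
      (\<integral>\<omega>. (weight B (Y S) (Y S') (N \<omega>) * u (N \<omega>) - weight B S S' (N \<omega>) * u (N \<omega>)) +
      indicator B y * (indicator S (N \<omega>) * u (N \<omega>)) \<partial>P)"
    by (rule Bochner_Integration.integral_cong[OF refl w'])
  also have "\<dots> = ((\<integral>\<omega>. weight B (Y S) (Y S') (N \<omega>) * u (N \<omega>) \<partial>P) - (\<integral>\<omega>. weight B S S' (N \<omega>) * u (N \<omega>) \<partial>P)) +
      indicator B y * (\<integral>\<omega>. indicator S (N \<omega>) * u (N \<omega>) \<partial>P)"
    using e1(2) e2(2) S_int by simp
  also have "(\<integral>\<omega>. weight B (Y S) (Y S') (N \<omega>) * u (N \<omega>) \<partial>P) - (\<integral>\<omega>. weight B S S' (N \<omega>) * u (N \<omega>) \<partial>P) =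
      (\<integral>z. indicator B (snd z) * indicator (Y S) (N (fst z)) * dif u z -
        indicator B (snd z) * indicator S (N (fst z)) * dif u z \<partial>PE)"
    using e1 e2 by simp
  also have "\<dots> = (\<integral>z. indicator B (snd z) * dif (indicator S) (fst z, y) * dif u z \<partial>PE)"
  proof (rule Bochner_Integration.integral_cong[OF refl])
    fix z assume "z \<in> space PE"
    then have "N (fst z) \<in> point_measures M" by (auto simp: space_pair_measure N_point_measure)
    then have "indicator (Y S) (N (fst z)) = (indicator S (add_point (N (fst z)) y) :: real)"
      by (simp add: Y_iff indicator_def)
    then show "indicator B (snd z) * indicator (Y S) (N (fst z)) * dif u z -
        indicator B (snd z) * indicator S (N (fst z)) * dif u z =
        indicator B (snd z) * dif (indicator S) (fst z, y) * dif u z"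
      by (simp add: dif_def algebra_simps)
  qed
  finally show "(\<integral>\<omega>. dif (weight B S S') (\<omega>, y) * u (N \<omega>) \<partial>P) =
      (\<integral>z. indicator B (snd z) * dif (indicator S) (fst z, y) * dif u z \<partial>PE) +
      indicator B y * (\<integral>\<omega>. indicator S (N \<omega>) * u (N \<omega>) \<partial>P)" .
qed

end

lemma AE_zero_if_subset_integrals_zero:
  fixes f :: "'a \<Rightarrow> real"
  assumes B: "B \<in> sets M"
    and int: "\<And>B'. B' \<in> sets M \<Longrightarrow> B' \<subseteq> B \<Longrightarrow> integrable M (\<lambda>x. indicator B' x * f x)"
    and zero: "\<And>B'. B' \<in> sets M \<Longrightarrow> B' \<subseteq> B \<Longrightarrow> (\<integral>x. indicator B' x * f x \<partial>M) = 0"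
  shows "AE x in M. x \<in> B \<longrightarrow> f x = 0"
proof -
  have [measurable]: "(\<lambda>x. indicator B x * f x) \<in> borel_measurable M"
    using int[OF B] by simp
  have sgn: "AE x in M. x \<in> B \<longrightarrow> s * f x \<le> 0" if s: "s = 1 \<or> s = - 1" for s :: real
  proof -
    define B' where "B' = {x \<in> space M. 0 < s * (indicator B x * f x)}"
    have B': "B' \<in> sets M" "B' \<subseteq> B"
      unfolding B'_def by measurable (auto simp: indicator_def split: if_splits)
    have "(\<integral>x. s * (indicator B' x * f x) \<partial>M) = 0"
      using zero[OF B'] by simp
    moreover have "AE x in M. 0 \<le> s * (indicator B' x * f x)"
      by (auto simp: B'_def indicator_def)
    ultimately have "AE x in M. s * (indicator B' x * f x) = 0"
      using integral_nonneg_eq_0_iff_AE[of M "\<lambda>x. s * (indicator B' x * f x)"] int[OF B'] by auto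
    then show ?thesis
      using AE_space
    proof eventually_elim
      case (elim x)
      then show ?case
        by (cases "x \<in> B'") (auto simp: B'_def indicator_def not_less split: if_splits)
    qed
  qed
  show ?thesis
    using sgn[of 1] sgn[of "- 1"] by (auto elim: eventually_elim2)
qed

lemma inner_dense_zero:
  fixes w :: "'h::real_inner"
  assumes dense: "\<And>U. open U \<Longrightarrow> U \<noteq> {} \<Longrightarrow> \<exists>d\<in>D. d \<in> U" and zero: "\<And>d. d \<in> D \<Longrightarrow> w \<bullet> d = 0"
  shows "w = 0"
proof (rule ccontr)
  assume "w \<noteq> 0"
  have "open {v. 0 < w \<bullet> v}" by (intro open_Collect_less continuous_intros)
  moreover have "w \<in> {v. 0 < w \<bullet> v}" using \<open>w \<noteq> 0\<close> by simp
  ultimately obtain d where "d \<in> D" "0 < w \<bullet> d" using dense[of "{v. 0 < w \<bullet> v}"] by blast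
  then show False using zero[of d] by simp
qed

context poisson_process
begin

text \<open>The field \<open>D\<^sub>x\<Phi>\<close> of a fixed representative, in contrast to \<open>diff_field\<close>.\<close>

definition dfield :: "('e measure \<times> 'e \<Rightarrow> 'h::real_normed_vector) \<Rightarrow> 'e \<Rightarrow> 'w \<times> 'e \<Rightarrow> 'h" where
  "dfield \<phi> x z = \<phi> (add_point (N (fst z)) x, snd z) - \<phi> (N (fst z), snd z)"

lemma measurable_dfield [measurable]:
  fixes \<phi> :: "'e measure \<times> 'e \<Rightarrow> 'h::{real_normed_vector, second_countable_topology}"
  assumes [measurable]: "\<phi> \<in> borel_measurable NE"
  shows "(\<lambda>(x, z). dfield \<phi> x z) \<in> borel_measurable EPE"
  unfolding dfield_def[abs_def] by measurable

lemma L2_P_const: "L2 P (\<lambda>_. h :: 'h::{real_normed_vector, second_countable_topology})"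
  by (simp add: L2_def)

context
  fixes \<phi> :: "'e measure \<times> 'e \<Rightarrow> 'h::{real_inner, banach, second_countable_topology}"
    and \<gamma> :: "'e measure \<Rightarrow> 'h"
  assumes \<phi> [measurable]: "\<phi> \<in> borel_measurable NE"
    and \<gamma> [measurable]: "\<gamma> \<in> borel_measurable \<N>"
    and \<phi>_L2: "L2 PE (\<lambda>z. \<phi> (N (fst z), snd z))"
    and D\<phi>_L2: "L2 EPE (\<lambda>(x, z). dfield \<phi> x z)"
    and sk: "is_skorohod P M N (\<lambda>z. \<phi> (N (fst z), snd z)) (\<lambda>\<omega>. \<gamma> (N \<omega>))"
begin

text \<open>The chain of dualities of the introduction for the test field \<open>1\<^sub>S(N) 1\<^sub>B(x) h\<close>.  The functions
  \<open>a1\<close>, \<open>a2\<close> and \<open>b\<close> of \<open>x\<close> are the pairings of \<open>1\<^sub>S(N) h\<close> with \<open>D\<^sub>x\<delta>(\<Phi>)\<close>, with \<open>\<Phi>(x)\<close> and, once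
  \<open>D\<^sub>x\<Phi>\<close> is known to be integrable, with \<open>\<delta>(D\<^sub>x\<Phi>)\<close>.\<close>

lemma commutation_event_integral:
  fixes h :: 'h
  assumes L: "local_event K B S S' c"
  defines "a1 \<equiv> \<lambda>x. \<integral>\<omega>. indicator S (N \<omega>) * (dif \<gamma> (\<omega>, x) \<bullet> h) \<partial>P"
    and "a2 \<equiv> \<lambda>x. \<integral>\<omega>. indicator S (N \<omega>) * (\<phi> (N \<omega>, x) \<bullet> h) \<partial>P"
    and "b \<equiv> \<lambda>x. \<integral>z. dif (indicator S) z * (dfield \<phi> x z \<bullet> h) \<partial>PE"
  shows "integrable M (\<lambda>x. indicator B x * (a1 x - a2 x - b x))"
    and "(\<integral>x. indicator B x * (a1 x - a2 x - b x) \<partial>M) = 0"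
    and "AE x in M. x \<in> B \<longrightarrow> integrable P (\<lambda>\<omega>. indicator S (N \<omega>) * (dif \<gamma> (\<omega>, x) \<bullet> h))"
proof -
  note D = local_eventD[OF L]
  have [measurable]: "K \<in> sets M" "B \<in> sets M" "S \<in> sets \<N>" "S' \<in> sets \<N>"
    using D by auto
  define wt where "wt = weight B S S'"
  have wt [measurable]: "wt \<in> borel_measurable \<N>" by (simp add: wt_def)
  define one where "one = (indicator S :: 'e measure \<Rightarrow> real)"
  have one [measurable]: "one \<in> borel_measurable \<N>" by (simp add: one_def)
  define g where "g \<eta> = \<gamma> \<eta> \<bullet> h" for \<eta>
  define u where "u y \<eta> = \<phi> (\<eta>, y) \<bullet> h" for y \<eta>
  have g [measurable]: "g \<in> borel_measurable \<N>" unfolding g_def[abs_def] by measurable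
  have dif_g: "dif g z = dif \<gamma> z \<bullet> h" for z by (simp add: dif_def g_def inner_diff_left)
  have dif_u: "dif (u y) (\<omega>, x) = dfield \<phi> x (\<omega>, y) \<bullet> h" for x y \<omega>
    by (simp add: dif_def u_def dfield_def inner_diff_left)
  have g_int: "integrable P (\<lambda>\<omega>. g (N \<omega>))"
    unfolding g_def by (rule L2_inner_integrable[OF is_skorohod_L2[OF sk] L2_P_const])
  \<comment> \<open>The event duality turns the difference of \<open>\<gamma>\<close> into a pairing with the integral of the test field.\<close>
  note e = event_duality[OF D(3,5,6,7) g g_int D(9) D(12) D(8), folded wt_def]
  have F1: "integrable PE (\<lambda>(\<omega>, x). indicator B x * (indicator S (N \<omega>) * (dif \<gamma> (\<omega>, x) \<bullet> h)))"
    using e(1) by (simp add: dif_g case_prod_beta' mult.assoc)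
  have i1: "integrable M (\<lambda>x. indicator B x * a1 x)"
    using PM.integrable_snd[OF F1] by (simp add: a1_def)
  show "AE x in M. x \<in> B \<longrightarrow> integrable P (\<lambda>\<omega>. indicator S (N \<omega>) * (dif \<gamma> (\<omega>, x) \<bullet> h))"
    using PM.AE_integrable_snd[OF F1] by eventually_elim auto
  have s1: "(\<integral>x. indicator B x * a1 x \<partial>M) = (\<integral>\<omega>. wt (N \<omega>) * g (N \<omega>) \<partial>P)"
    using PM.integral_snd[OF F1] e(3) by (simp add: a1_def dif_g case_prod_beta' mult.assoc)
  \<comment> \<open>The pairing is rewritten by the definition of the Skorohod integral.\<close>
  note lw = local_functional_L2[OF wt D(1,2), of "c + measure M B" h, unfolded wt_def,
      OF weight_bounded[OF L] weight_local[OF L], folded wt_def]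
  have dif_wt: "dif (\<lambda>\<eta>. wt \<eta> *\<^sub>R h) z = dif wt z *\<^sub>R h" for z
    by (simp add: dif_def algebra_simps)
  have "(\<integral>z. dif (\<lambda>\<eta>. wt \<eta> *\<^sub>R h) z \<bullet> \<phi> (N (fst z), snd z) \<partial>PE) =
      (\<integral>\<omega>. (wt (N \<omega>) *\<^sub>R h) \<bullet> \<gamma> (N \<omega>) \<partial>P)"
    by (rule is_skorohodD[OF sk \<phi>_L2 _ lw]) measurable
  then have s2: "(\<integral>z. dif wt z * (\<phi> (N (fst z), snd z) \<bullet> h) \<partial>PE) = (\<integral>\<omega>. wt (N \<omega>) * g (N \<omega>) \<partial>P)"
    by (simp add: dif_wt g_def inner_commute)
  have F2: "integrable PE (\<lambda>(\<omega>, y). dif wt (\<omega>, y) * (\<phi> (N \<omega>, y) \<bullet> h))"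
    using L2_inner_integrable[OF lw(2) \<phi>_L2] by (simp add: dif_wt case_prod_beta' inner_commute)
  have s3: "(\<integral>y. (\<integral>\<omega>. dif wt (\<omega>, y) * u y (N \<omega>) \<partial>P) \<partial>M) = (\<integral>\<omega>. wt (N \<omega>) * g (N \<omega>) \<partial>P)"
    using PM.integral_snd[OF F2] s2 by (simp add: u_def case_prod_beta')
  \<comment> \<open>For fixed \<open>y\<close>, the difference of the weight is commuted with the integral of the test field.\<close>
  define J where "J y = (\<integral>z. indicator B (snd z) * dif one (fst z, y) * dif (u y) z \<partial>PE)" for y
  have "AE y in M. L2 P (\<lambda>\<omega>. \<phi> (N \<omega>, y))"
    using PM.L2_sections(2)[OF \<phi>_L2] by simp
  then have s4: "AE y in M. (\<integral>\<omega>. dif wt (\<omega>, y) * u y (N \<omega>) \<partial>P) = J y + indicator B y * a2 y"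
    using AE_space
  proof eventually_elim
    case (elim y)
    have "integrable P (\<lambda>\<omega>. u y (N \<omega>))"
      unfolding u_def by (rule L2_inner_integrable[OF elim(1) L2_P_const])
    moreover have "u y \<in> borel_measurable \<N>"
      unfolding u_def[abs_def] using elim(2) by measurable
    ultimately show ?case
      using event_commutation(2)[OF L _ _ elim(2), of "u y"]
      by (simp add: wt_def J_def one_def a2_def u_def)
  qed
  define G where "G = (\<lambda>(x, z). indicator B x * dif one z * (dfield \<phi> x z \<bullet> h))"
  have G: "integrable EPE G"
  proof -
    have "L2 EPE (\<lambda>(x, z). (indicator B x * dif one z) *\<^sub>R h)"
    proof (rule L2_bounded_indicator)
      show "B \<times> (space P \<times> K) \<in> sets EPE" by auto
      show "emeasure EPE (B \<times> (space P \<times> K)) < \<infinity>"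
        using D(2,5) by (simp add: PM.P.emeasure_pair_measure_Times M.emeasure_pair_measure_Times
            P.emeasure_space_1 ennreal_mult_less_top)
      show "AE z in EPE. norm (case z of (x, z) \<Rightarrow> (indicator B x * dif one z) *\<^sub>R h) \<le>
          norm h * indicator (B \<times> (space P \<times> K)) z"
        using AE_space
      proof eventually_elim
        case (elim z)
        obtain x \<omega> y where z: "z = (x, \<omega>, y)" by (cases z) auto
        have w: "\<omega> \<in> space P" "y \<in> space M" using elim by (auto simp: z space_pair_measure)
        have "y \<notin> K \<Longrightarrow> dif one (\<omega>, y) = 0"
          using D(10)[OF N_point_measure[OF w(1)], of y] w by (simp add: dif_def one_def indicator_def)
        moreover have "\<bar>dif one (\<omega>, y)\<bar> \<le> 1" by (simp add: dif_def one_def indicator_def)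
        ultimately show ?case
          using w mult_right_mono[of "\<bar>dif one (\<omega>, y)\<bar>" 1 "norm h"]
          by (auto simp: z indicator_def)
      qed
    qed measurable
    from L2_inner_integrable[OF this D\<phi>_L2] show ?thesis
      by (simp add: G_def case_prod_beta' inner_commute mult.assoc)
  qed
  note G' = integral_swap_marks[OF G]
  have J_eq: "J y = (\<integral>z. (case (y, z) of (y, \<omega>, x) \<Rightarrow> G (x, \<omega>, y)) \<partial>PE)" for y
    unfolding J_def by (intro Bochner_Integration.integral_cong) (auto simp: G_def dif_u case_prod_beta')
  have iJ: "integrable M J"
    using Q.integrable_fst'[OF G'(1)] unfolding J_eq .
  have b_eq: "indicator B x * b x = (\<integral>z. G (x, z) \<partial>PE)" for x
    by (simp add: b_def G_def one_def mult.assoc)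
  have ib: "integrable M (\<lambda>x. indicator B x * b x)"
    using Q.integrable_fst'[OF G] unfolding b_eq .
  have s5: "(\<integral>y. J y \<partial>M) = (\<integral>x. indicator B x * b x \<partial>M)"
    unfolding J_eq b_eq using Q.integral_fst'[OF G] Q.integral_fst'[OF G'(1)] G'(2) by simp
  have "L2 PE (\<lambda>z. (indicator B (snd z) * indicator S (N (fst z))) *\<^sub>R h)"
  proof (rule L2_bounded_indicator)
    show "space P \<times> B \<in> sets PE" by auto
    show "emeasure PE (space P \<times> B) < \<infinity>"
      using D(5) by (simp add: M.emeasure_pair_measure_Times P.emeasure_space_1)
    show "AE z in PE. norm ((indicator B (snd z) * indicator S (N (fst z)) :: real) *\<^sub>R h) \<le>
        norm h * indicator (space P \<times> B) z"
      using AE_space by eventually_elim (auto simp: space_pair_measure indicator_def)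
  qed measurable
  from L2_inner_integrable[OF this \<phi>_L2]
  have F3: "integrable PE (\<lambda>(\<omega>, y). indicator B y * (indicator S (N \<omega>) * (\<phi> (N \<omega>, y) \<bullet> h)))"
    by (simp add: case_prod_beta' inner_commute mult.assoc)
  have i2: "integrable M (\<lambda>y. indicator B y * a2 y)"
    using PM.integrable_snd[OF F3] by (simp add: a2_def)
  have "(\<integral>y. (\<integral>\<omega>. dif wt (\<omega>, y) * u y (N \<omega>) \<partial>P) \<partial>M) = (\<integral>y. J y + indicator B y * a2 y \<partial>M)"
  proof (rule integral_cong_AE)
    show "(\<lambda>y. \<integral>\<omega>. dif wt (\<omega>, y) * u y (N \<omega>) \<partial>P) \<in> borel_measurable M"
      using borel_measurable_integrable[OF PM.integrable_snd[OF F2]] by (simp add: u_def)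
    show "(\<lambda>y. J y + indicator B y * a2 y) \<in> borel_measurable M"
      using iJ i2 by auto
  qed (rule s4)
  then have "(\<integral>x. indicator B x * a1 x \<partial>M) = (\<integral>x. indicator B x * b x \<partial>M) + (\<integral>y. indicator B y * a2 y \<partial>M)"
    using s1 s3 s5 iJ i2 by simp
  then show "(\<integral>x. indicator B x * (a1 x - a2 x - b x) \<partial>M) = 0"
    using i1 i2 ib by (simp add: right_diff_distrib)
  show "integrable M (\<lambda>x. indicator B x * (a1 x - a2 x - b x))"
    using i1 i2 ib by (simp add: right_diff_distrib)
qed

text \<open>The integral identity holds for every measurable part of \<open>B\<close>, hence pointwise almost everywhere;
  at such a point \<open>x\<close> the definition of the Skorohod integral identifies \<open>b x\<close>.\<close>

lemma commutation_event:
  fixes h :: 'h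
  assumes L: "local_event K B S S' c"
    and skx: "AE x in M. is_skorohod P M N (dfield \<phi> x) (G x)"
  shows "AE x in M. x \<in> B \<longrightarrow>
    integrable P (\<lambda>\<omega>. indicator S (N \<omega>) * ((dif \<gamma> (\<omega>, x) - \<phi> (N \<omega>, x) - G x \<omega>) \<bullet> h)) \<and>
    (\<integral>\<omega>. indicator S (N \<omega>) * ((dif \<gamma> (\<omega>, x) - \<phi> (N \<omega>, x) - G x \<omega>) \<bullet> h) \<partial>P) = 0"
proof -
  note D = local_eventD[OF L]
  have [measurable]: "S \<in> sets \<N>" by (rule D)
  define a1 where "a1 x = (\<integral>\<omega>. indicator S (N \<omega>) * (dif \<gamma> (\<omega>, x) \<bullet> h) \<partial>P)" for x
  define a2 where "a2 x = (\<integral>\<omega>. indicator S (N \<omega>) * (\<phi> (N \<omega>, x) \<bullet> h) \<partial>P)" for x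
  define b where "b x = (\<integral>z. dif (indicator S) z * (dfield \<phi> x z \<bullet> h) \<partial>PE)" for x
  have "AE x in M. x \<in> B \<longrightarrow> a1 x - a2 x - b x = 0"
  proof (rule AE_zero_if_subset_integrals_zero[OF D(3)])
    fix B' assume B': "B' \<in> sets M" "B' \<subseteq> B"
    note L' = local_event_subset[OF L B']
    show "integrable M (\<lambda>x. indicator B' x * (a1 x - a2 x - b x))"
      and "(\<integral>x. indicator B' x * (a1 x - a2 x - b x) \<partial>M) = 0"
      unfolding a1_def a2_def b_def
      by (rule commutation_event_integral(1)[OF L'] commutation_event_integral(2)[OF L'])+
  qed
  moreover have "AE x in M. L2 P (\<lambda>\<omega>. \<phi> (N \<omega>, x))"
    using PM.L2_sections(2)[OF \<phi>_L2] by simp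
  moreover have "AE x in M. L2 PE (dfield \<phi> x)"
    using Q.L2_sections(1)[OF D\<phi>_L2] by simp
  ultimately show ?thesis
    using commutation_event_integral(3)[OF L, of h] skx
  proof eventually_elim
    case (elim x)
    show ?case
    proof
      assume x: "x \<in> B"
      have one: "indicator S \<in> borel_measurable \<N>" by simp
      note lo = local_functional_L2[OF one D(1,2), of 1 h]
      have lo1: "L2 P (\<lambda>\<omega>. indicator S (N \<omega>) *\<^sub>R h)" and lo2: "L2 PE (dif (\<lambda>\<eta>. indicator S \<eta> *\<^sub>R h))"
        using lo D(10) by (auto simp: indicator_def)
      have "(\<integral>z. dif (\<lambda>\<eta>. indicator S \<eta> *\<^sub>R h) z \<bullet> dfield \<phi> x z \<partial>PE) =
          (\<integral>\<omega>. (indicator S (N \<omega>) *\<^sub>R h) \<bullet> G x \<omega> \<partial>P)"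
        by (rule is_skorohodD[OF elim(5) elim(3) _ lo1 lo2]) measurable
      moreover have "dif (\<lambda>\<eta>. indicator S \<eta> *\<^sub>R h) z = dif (indicator S) z *\<^sub>R h" for z
        by (simp add: dif_def algebra_simps)
      ultimately have b: "b x = (\<integral>\<omega>. indicator S (N \<omega>) * (G x \<omega> \<bullet> h) \<partial>P)"
        by (simp add: b_def inner_commute)
      have i1: "integrable P (\<lambda>\<omega>. indicator S (N \<omega>) * (dif \<gamma> (\<omega>, x) \<bullet> h))"
        using elim(4) x by simp
      have i2: "integrable P (\<lambda>\<omega>. indicator S (N \<omega>) * (\<phi> (N \<omega>, x) \<bullet> h))"
        using L2_inner_integrable[OF lo1 elim(2)] by (simp add: inner_commute)
      have i3: "integrable P (\<lambda>\<omega>. indicator S (N \<omega>) * (G x \<omega> \<bullet> h))"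
        using L2_inner_integrable[OF lo1 is_skorohod_L2[OF elim(5)]] by (simp add: inner_commute)
      have e: "indicator S (N \<omega>) * ((dif \<gamma> (\<omega>, x) - \<phi> (N \<omega>, x) - G x \<omega>) \<bullet> h) =
          indicator S (N \<omega>) * (dif \<gamma> (\<omega>, x) \<bullet> h) - indicator S (N \<omega>) * (\<phi> (N \<omega>, x) \<bullet> h) -
          indicator S (N \<omega>) * (G x \<omega> \<bullet> h)" for \<omega>
        by (simp add: inner_diff_left right_diff_distrib)
      show "integrable P (\<lambda>\<omega>. indicator S (N \<omega>) * ((dif \<gamma> (\<omega>, x) - \<phi> (N \<omega>, x) - G x \<omega>) \<bullet> h)) \<and>
          (\<integral>\<omega>. indicator S (N \<omega>) * ((dif \<gamma> (\<omega>, x) - \<phi> (N \<omega>, x) - G x \<omega>) \<bullet> h) \<partial>P) = 0"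
        unfolding e using i1 i2 i3 elim(1) x b by (simp add: a1_def a2_def)
    qed
  qed
qed

text \<open>Countably many events and directions \<open>h\<close> suffice, so the exceptional sets of points \<open>x\<close> unite to a
  null set.  Outside of it, the cylinder events of all partitions in which \<open>x\<close> has a nonempty label
  determine the difference of both sides, which therefore vanishes almost surely.\<close>

theorem commutation:
  assumes skx: "AE x in M. is_skorohod P M N (dfield \<phi> x) (G x)"
  shows "AE x in M. AE \<omega> in P. dif \<gamma> (\<omega>, x) = \<phi> (N \<omega>, x) + G x \<omega>"
proof -
  obtain D :: "'h set" where D: "countable D" "\<And>U. open U \<Longrightarrow> U \<noteq> {} \<Longrightarrow> \<exists>d\<in>D. d \<in> U"
    by (erule countable_dense_setE)
  define W where "W x \<omega> = dif \<gamma> (\<omega>, x) - \<phi> (N \<omega>, x) - G x \<omega>" for x \<omega>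
  have one: "AE x in M. x \<in> atom n I \<longrightarrow> integrable P (\<lambda>\<omega>. indicator S (N \<omega>) * (W x \<omega> \<bullet> h)) \<and>
      (\<integral>\<omega>. indicator S (N \<omega>) * (W x \<omega> \<bullet> h) \<partial>P) = 0"
    if "I \<in> labels n" "S \<in> range (cyl n)" for n I S h
    using commutation_event[OF local_event_cyl[OF that(1)] skx] that(2) by (auto simp: W_def)
  have "AE x in M. \<forall>n. \<forall>I\<in>labels n. \<forall>S\<in>range (cyl n). \<forall>h\<in>D. x \<in> atom n I \<longrightarrow>
      integrable P (\<lambda>\<omega>. indicator S (N \<omega>) * (W x \<omega> \<bullet> h)) \<and> (\<integral>\<omega>. indicator S (N \<omega>) * (W x \<omega> \<bullet> h) \<partial>P) = 0"
    unfolding AE_all_countable AE_ball_countable[OF countable_finite[OF finite_labels]]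
      AE_ball_countable[OF countable_cyl] AE_ball_countable[OF D(1)]
    using one by blast
  then show ?thesis
    using skx AE_space
  proof eventually_elim
    case (elim x)
    have [measurable]: "G x \<in> borel_measurable P"
      using L2_measurable[OF is_skorohod_L2[OF elim(2)]] .
    have [measurable]: "W x \<in> borel_measurable P"
      unfolding W_def[abs_def] using elim(3) by measurable
    have "AE \<omega> in P. W x \<omega> \<bullet> h = 0" if "h \<in> D" for h
      using elim(1) that by (intro AE_zero_if_boxes_zero[OF _ elim(3)]) auto
    then have "AE \<omega> in P. \<forall>h\<in>D. W x \<omega> \<bullet> h = 0"
      by (simp add: AE_ball_countable D(1))
    then show "AE \<omega> in P. dif \<gamma> (\<omega>, x) = \<phi> (N \<omega>, x) + G x \<omega>"
    proof eventually_elim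
      case (elim \<omega>)
      then have "W x \<omega> = 0" using inner_dense_zero[OF D(2)] by blast
      then show ?case by (simp add: W_def algebra_simps)
    qed
  qed
qed

end

end

section \<open>Bounded fields of finite intensity\<close>

context poisson_process
begin

text \<open>The Mecke formula gives \<open>\<^bold>E N(K) = \<mu>(K)\<close> and then \<open>\<^bold>E N(K)\<^sup>2 = \<mu>(K) \<^bold>E (N(K) + 1)\<close>.\<close>

lemma count_L2:
  assumes K [measurable]: "K \<in> sets M" and fin: "emeasure M K < \<infinity>"
  shows "L2 P (\<lambda>\<omega>. enn2real (emeasure (N \<omega>) K))"
proof -
  have point: "(\<integral>\<^sup>+z. indicator K (snd z) * v (add_point (N (fst z)) (snd z)) \<partial>PE) =
      (\<integral>\<^sup>+\<omega>. emeasure (N \<omega>) K * v (N \<omega>) \<partial>P)"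
    if [measurable]: "v \<in> borel_measurable \<N>" for v :: "'e measure \<Rightarrow> ennreal"
  proof -
    let ?h = "\<lambda>z. indicator K (snd z) * v (add_point (fst z) (snd z))"
    have "?h \<in> borel_measurable NE" by measurable
    from mecke_nn_integral[OF this]
    have "(\<integral>\<^sup>+z. indicator K (snd z) * v (add_point (N (fst z)) (snd z)) \<partial>PE) =
        (\<integral>\<^sup>+z. indicator K (X (fst z) (snd z)) * v (add_point (rest (fst z) (snd z)) (X (fst z) (snd z))) \<partial>marked)"
      by simp
    also have "\<dots> = (\<integral>\<^sup>+z. indicator K (X (fst z) (snd z)) * v (N (snd z)) \<partial>marked)"
    proof (rule nn_integral_cong_AE)
      show "AE z in marked. indicator K (X (fst z) (snd z)) * v (add_point (rest (fst z) (snd z)) (X (fst z) (snd z))) =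
          indicator K (X (fst z) (snd z)) * v (N (snd z))"
        using AE_marked_add_point by eventually_elim simp
    qed
    also have "\<dots> = (\<integral>\<^sup>+\<omega>. emeasure (N \<omega>) K * v (N \<omega>) \<partial>P)"
      by (intro nn_integral_marked_points) auto
    finally show ?thesis .
  qed
  have ind: "(\<integral>\<^sup>+z. indicator K (snd z) * v (fst z) \<partial>PE) = emeasure M K * (\<integral>\<^sup>+\<omega>. v \<omega> \<partial>P)"
    if [measurable]: "v \<in> borel_measurable P" for v :: "'w \<Rightarrow> ennreal"
    by (subst M.nn_integral_fst[symmetric]) (auto simp: nn_integral_multc nn_integral_cmult)
  have "(\<integral>\<^sup>+\<omega>. emeasure (N \<omega>) K \<partial>P) = emeasure M K"
    using point[of "\<lambda>_. 1"] ind[of "\<lambda>_. 1"] by (simp add: P.emeasure_space_1)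
  moreover have "(\<integral>\<^sup>+\<omega>. emeasure (N \<omega>) K * emeasure (N \<omega>) K \<partial>P) =
      emeasure M K * (\<integral>\<^sup>+\<omega>. emeasure (N \<omega>) K + 1 \<partial>P)"
  proof -
    have "(\<integral>\<^sup>+\<omega>. emeasure (N \<omega>) K * emeasure (N \<omega>) K \<partial>P) =
        (\<integral>\<^sup>+z. indicator K (snd z) * emeasure (add_point (N (fst z)) (snd z)) K \<partial>PE)"
      by (rule point[symmetric]) simp
    also have "\<dots> = (\<integral>\<^sup>+z. indicator K (snd z) * (emeasure (N (fst z)) K + 1) \<partial>PE)"
      by (intro nn_integral_cong)
        (auto simp: indicator_def emeasure_add_point sets_N space_pair_measure)
    also have "\<dots> = emeasure M K * (\<integral>\<^sup>+\<omega>. emeasure (N \<omega>) K + 1 \<partial>P)"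
      by (rule ind) measurable
    finally show ?thesis .
  qed
  ultimately have "(\<integral>\<^sup>+\<omega>. emeasure (N \<omega>) K * emeasure (N \<omega>) K \<partial>P) = emeasure M K * (emeasure M K + 1)"
    by (simp add: nn_integral_add P.emeasure_space_1)
  then have "(\<integral>\<^sup>+\<omega>. emeasure (N \<omega>) K * emeasure (N \<omega>) K \<partial>P) < \<infinity>"
    using fin by (simp add: ennreal_mult_less_top)
  moreover have "AE \<omega> in P. ennreal ((norm (enn2real (emeasure (N \<omega>) K)))\<^sup>2) = emeasure (N \<omega>) K * emeasure (N \<omega>) K"
    using AE_count_finite[OF K fin]
    by eventually_elim (simp add: power2_eq_square ennreal_mult ennreal_enn2real)
  ultimately have "(\<integral>\<^sup>+\<omega>. ennreal ((norm (enn2real (emeasure (N \<omega>) K)))\<^sup>2) \<partial>P) < \<infinity>"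
    by (subst nn_integral_cong_AE) auto
  moreover have "(\<lambda>\<omega>. enn2real (emeasure (N \<omega>) K)) \<in> borel_measurable P"
    by (intro measurable_compose[OF measurable_compose[OF N_measurable measurable_emeasure_point_algebra[OF K]]]) simp
  ultimately show ?thesis
    by (simp add: L2_iff_nn_integral)
qed

text \<open>Duality against every square integrable functional, whether or not its difference is square
  integrable.  In this form it can be applied to the integral \<open>G\<close> itself, before \<open>G\<close> is known to
  belong to the Sobolev space.\<close>

definition strong_skorohod ::
    "('e measure \<times> 'e \<Rightarrow> 'h::{real_inner, banach, second_countable_topology}) \<Rightarrow> ('w \<Rightarrow> 'h) \<Rightarrow> bool" where
  "strong_skorohod \<phi> G \<longleftrightarrow> L2 P G \<and>
    (\<forall>u\<in>borel_measurable \<N>. L2 P (\<lambda>\<omega>. u (N \<omega>)) \<longrightarrow>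
      integrable PE (\<lambda>z. dif u z \<bullet> \<phi> (N (fst z), snd z)) \<and>
      (\<integral>z. dif u z \<bullet> \<phi> (N (fst z), snd z) \<partial>PE) = (\<integral>\<omega>. u (N \<omega>) \<bullet> G \<omega> \<partial>P))"

lemma is_skorohodI:
  fixes \<Phi> :: "'w \<times> 'e \<Rightarrow> 'h::{real_inner, banach, second_countable_topology}"
  assumes [measurable]: "\<Phi> \<in> borel_measurable PE" and G: "L2 P G"
    and dual: "\<And>f. f \<in> borel_measurable \<N> \<Longrightarrow> L2 P (\<lambda>\<omega>. f (N \<omega>)) \<Longrightarrow> L2 PE (dif f) \<Longrightarrow>
      (\<integral>z. dif f z \<bullet> \<Phi> z \<partial>PE) = (\<integral>\<omega>. f (N \<omega>) \<bullet> G \<omega> \<partial>P)"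
  shows "is_skorohod P M N \<Phi> G"
  unfolding is_skorohod_def Lp_2_iff
proof (intro conjI ballI G)
  have [measurable]: "G \<in> borel_measurable P" using G by measurable
  fix F :: "'w \<Rightarrow> 'h" assume F: "F \<in> sobolev 2 P M N"
  then have F_L2: "L2 P F" by (simp add: sobolev_def Lp_2_iff)
  then have Fm [measurable]: "F \<in> borel_measurable P" by measurable
  obtain f where f [measurable]: "f \<in> borel_measurable \<N>" and Ff: "AE \<omega> in P. F \<omega> = f (N \<omega>)"
    and d: "diff_op P M N F = dif f"
    using diff_op_measurable_representative[OF Fm] by blast
  have "L2 P (\<lambda>\<omega>. f (N \<omega>))"
    by (rule L2_cong_AE[OF F_L2 _ Ff]) measurable
  moreover have "L2 PE (dif f)"
    using F by (simp add: sobolev_def Lp_2_iff d)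
  ultimately have "(\<integral>z. dif f z \<bullet> \<Phi> z \<partial>PE) = (\<integral>\<omega>. f (N \<omega>) \<bullet> G \<omega> \<partial>P)"
    by (rule dual[OF f])
  also have "\<dots> = (\<integral>\<omega>. F \<omega> \<bullet> G \<omega> \<partial>P)"
    using Ff by (intro integral_cong_AE) (auto elim: eventually_mono)
  finally show "(\<integral>z. diff_op P M N F z \<bullet> \<Phi> z \<partial>PE) = (\<integral>\<omega>. F \<omega> \<bullet> G \<omega> \<partial>P)"
    by (simp add: d)
qed

lemma strong_imp_is_skorohod:
  fixes \<phi> :: "'e measure \<times> 'e \<Rightarrow> 'h::{real_inner, banach, second_countable_topology}"
  assumes [measurable]: "\<phi> \<in> borel_measurable NE" and s: "strong_skorohod \<phi> G"
  shows "is_skorohod P M N (\<lambda>z. \<phi> (N (fst z), snd z)) G"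
  using s by (intro is_skorohodI) (auto simp: strong_skorohod_def)

lemma strong_skorohod_diff:
  fixes \<phi> \<psi> :: "'e measure \<times> 'e \<Rightarrow> 'h::{real_inner, banach, second_countable_topology}"
  assumes 1: "strong_skorohod \<phi> G" and 2: "strong_skorohod \<psi> H"
  shows "strong_skorohod (\<lambda>z. \<phi> z - \<psi> z) (\<lambda>\<omega>. G \<omega> - H \<omega>)"
proof -
  have "L2 P (\<lambda>\<omega>. G \<omega> - H \<omega>)" using assms by (auto simp: strong_skorohod_def intro: L2_diff)
  moreover have "integrable PE (\<lambda>z. dif u z \<bullet> (\<phi> (N (fst z), snd z) - \<psi> (N (fst z), snd z))) \<and>
      (\<integral>z. dif u z \<bullet> (\<phi> (N (fst z), snd z) - \<psi> (N (fst z), snd z)) \<partial>PE) =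
      (\<integral>\<omega>. u (N \<omega>) \<bullet> (G \<omega> - H \<omega>) \<partial>P)"
    if u: "u \<in> borel_measurable \<N>" "L2 P (\<lambda>\<omega>. u (N \<omega>))" for u
  proof -
    have "integrable P (\<lambda>\<omega>. u (N \<omega>) \<bullet> G \<omega>)" "integrable P (\<lambda>\<omega>. u (N \<omega>) \<bullet> H \<omega>)"
      using assms u by (auto simp: strong_skorohod_def intro: L2_inner_integrable)
    then show ?thesis
      using 1 2 u unfolding strong_skorohod_def inner_diff_right by auto
  qed
  ultimately show ?thesis by (auto simp: strong_skorohod_def)
qed

definition finite_field :: "'e set \<Rightarrow> real \<Rightarrow> ('e measure \<times> 'e \<Rightarrow> 'h::real_normed_vector) \<Rightarrow> bool" where
  "finite_field K C \<phi> \<longleftrightarrow> K \<in> sets M \<and> emeasure M K < \<infinity> \<and> 0 \<le> C \<and>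
    \<phi> \<in> borel_measurable NE \<and>
    (\<forall>\<eta>\<in>point_measures M. \<forall>y\<in>space M. norm (\<phi> (\<eta>, y)) \<le> C * indicator K y)"

lemma finite_field_L2:
  fixes \<phi> :: "'e measure \<times> 'e \<Rightarrow> 'h::{real_normed_vector, second_countable_topology}"
  assumes "finite_field K C \<phi>"
  shows "L2 PE (\<lambda>z. \<phi> (N (fst z), snd z))"
proof (rule L2_bounded_indicator)
  have [measurable]: "\<phi> \<in> borel_measurable NE" "K \<in> sets M"
    using assms by (auto simp: finite_field_def)
  show "space P \<times> K \<in> sets PE" by measurable
  show "emeasure PE (space P \<times> K) < \<infinity>"
    using assms by (simp add: finite_field_def M.emeasure_pair_measure_Times P.emeasure_space_1)
  show "(\<lambda>z. \<phi> (N (fst z), snd z)) \<in> borel_measurable PE" by measurable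
  show "AE z in PE. norm (\<phi> (N (fst z), snd z)) \<le> C * indicator (space P \<times> K) z"
    using AE_space
  proof eventually_elim
    case (elim z)
    then have "fst z \<in> space P" "snd z \<in> space M" by (auto simp: space_pair_measure)
    moreover from this have "norm (\<phi> (N (fst z), snd z)) \<le> C * indicator K (snd z)"
      using assms N_point_measure by (auto simp: finite_field_def)
    ultimately show ?case by (simp add: indicator_def mem_Times_iff)
  qed
qed

text \<open>For a bounded field of finite intensity the Skorohod integral is the pathwise integral against
  the compensated process, where each point is removed from the configuration before the field is
  evaluated at it.\<close>

definition pathwise :: "('e measure \<times> 'e \<Rightarrow> 'h::{banach, second_countable_topology}) \<Rightarrow> 'w \<Rightarrow> 'h" where
  "pathwise \<phi> \<omega> = (\<integral>m. indicator (below \<omega>) m *\<^sub>R \<phi> (rest m \<omega>, X m \<omega>) \<partial>count_space UNIV) - (\<integral>x. \<phi> (N \<omega>, x) \<partial>M)"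

lemma strong_skorohod_pathwise:
  fixes \<phi> :: "'e measure \<times> 'e \<Rightarrow> 'h::{real_inner, banach, second_countable_topology}"
  assumes ff: "finite_field K C \<phi>"
  shows "strong_skorohod \<phi> (pathwise \<phi>)"
proof -
  have K [measurable]: "K \<in> sets M" and fin: "emeasure M K < \<infinity>" and C: "0 \<le> C"
    and \<phi> [measurable]: "\<phi> \<in> borel_measurable NE"
    and bound: "\<And>\<eta> y. \<eta> \<in> point_measures M \<Longrightarrow> y \<in> space M \<Longrightarrow> norm (\<phi> (\<eta>, y)) \<le> C * indicator K y"
    using ff by (auto simp: finite_field_def)
  note \<phi>_L2 = finite_field_L2[OF ff]
  define nK where "nK \<omega> = enn2real (emeasure (N \<omega>) K)" for \<omega>
  have nK: "L2 P nK" unfolding nK_def by (rule count_L2[OF K fin])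
  then have [measurable]: "nK \<in> borel_measurable P" by measurable
  have \<phi>_int: "integrable PE (\<lambda>z. \<phi> (N (fst z), snd z))"
  proof (rule Bochner_Integration.integrable_bound)
    show "integrable PE (\<lambda>z. indicator K (snd z) * (\<lambda>_. C) (fst z))"
      by (rule integral_indicator_product[OF K fin]) simp
    show "AE z in PE. norm (\<phi> (N (fst z), snd z)) \<le> norm (indicator K (snd z) * (\<lambda>_. C) (fst z))"
      using AE_space
    proof eventually_elim
      case (elim z)
      then show ?case
        using bound[OF N_point_measure, of "fst z" "snd z"] C by (auto simp: space_pair_measure mult.commute abs_mult)
    qed
  qed measurable
  define f where "f z = \<phi> (rest (fst z) (snd z), X (fst z) (snd z))" for z
  have f_int: "integrable marked f"
    using mecke_integral(1)[OF \<phi>] \<phi>_int by (simp add: f_def[abs_def])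
  have f_bound: "norm (f (m, \<omega>)) \<le> C * indicator K (X m \<omega>)" if "\<omega> \<in> space P" for m \<omega>
    using bound[OF rest_point_measure[OF that, of m] measurable_space[OF X_measurable that, of m]] by (simp add: f_def)
  define G1 where "G1 \<omega> = (\<integral>m. indicator (below \<omega>) m *\<^sub>R f (m, \<omega>) \<partial>count_space UNIV)" for \<omega>
  define G2 where "G2 \<omega> = (\<integral>x. \<phi> (N \<omega>, x) \<partial>M)" for \<omega>
  have pw: "pathwise \<phi> = (\<lambda>\<omega>. G1 \<omega> - G2 \<omega>)"
    by (simp add: fun_eq_iff pathwise_def G1_def G2_def f_def)
  have G1m [measurable]: "G1 \<in> borel_measurable P"
    using integral_marked(2)[OF f_int] by (simp add: G1_def[abs_def])
  have G2m [measurable]: "G2 \<in> borel_measurable P"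
    unfolding G2_def[abs_def] by measurable
  have G1_L2: "L2 P G1"
  proof (rule L2_bound[OF L2_scaleR[OF nK, of C] G1m])
    show "AE \<omega> in P. norm (G1 \<omega>) \<le> norm (C *\<^sub>R nK \<omega>)"
      using integral_marked(1)[OF f_int] AE_count_finite[OF K fin] AE_space
    proof eventually_elim
      case (elim \<omega>)
      have "ennreal (norm (G1 \<omega>)) \<le> (\<integral>\<^sup>+m. ennreal (norm (indicator (below \<omega>) m *\<^sub>R f (m, \<omega>))) \<partial>count_space UNIV)"
        unfolding G1_def by (rule integral_norm_bound_ennreal[OF elim(1)])
      also have "\<dots> \<le> (\<integral>\<^sup>+m. ennreal C * indicator {m \<in> below \<omega>. X m \<omega> \<in> K} m \<partial>count_space UNIV)"
      proof (rule nn_integral_mono)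
        fix m :: nat
        have "norm (indicator (below \<omega>) m *\<^sub>R f (m, \<omega>)) \<le> C * indicator {m \<in> below \<omega>. X m \<omega> \<in> K} m"
          using f_bound[OF elim(3), of m] C by (auto simp: indicator_def split: if_splits)
        then have "ennreal (norm (indicator (below \<omega>) m *\<^sub>R f (m, \<omega>))) \<le>
            ennreal (C * indicator {m \<in> below \<omega>. X m \<omega> \<in> K} m)"
          by (rule ennreal_leI)
        then show "ennreal (norm (indicator (below \<omega>) m *\<^sub>R f (m, \<omega>))) \<le>
            ennreal C * indicator {m \<in> below \<omega>. X m \<omega> \<in> K} m"
          using C by (simp add: ennreal_mult ennreal_indicator)
      qed
      also have "\<dots> = ennreal C * emeasure (N \<omega>) K"
        by (subst nn_integral_cmult_indicator) (auto simp: emeasure_N_count[OF elim(3) K])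
      also have "\<dots> = ennreal (C * nK \<omega>)"
        using elim(2) C by (simp add: nK_def ennreal_mult ennreal_enn2real)
      finally show ?case
        using C by (simp add: nK_def)
    qed
  qed
  have G2_L2: "L2 P G2"
  proof (rule L2_bounded_indicator)
    show "AE \<omega> in P. norm (G2 \<omega>) \<le> (C * measure M K) * indicator (space P) \<omega>"
      using AE_space
    proof eventually_elim
      case (elim \<omega>)
      have "norm (G2 \<omega>) \<le> (\<integral>x. norm (\<phi> (N \<omega>, x)) \<partial>M)"
        unfolding G2_def by (rule integral_norm_bound)
      also have "\<dots> \<le> (\<integral>x. C * indicator K x \<partial>M)"
      proof (rule integral_mono_AE')
        show "integrable M (\<lambda>x. C * indicator K x)" using fin by simp
        show "AE x in M. norm (\<phi> (N \<omega>, x)) \<le> C * indicator K x"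
          using AE_space by eventually_elim (rule bound[OF N_point_measure[OF elim]])
      qed (simp add: C)
      also have "\<dots> = C * measure M K" by simp
      finally show ?case using elim by simp
    qed
  qed (auto simp: P.emeasure_space_1)
  have "integrable PE (\<lambda>z. dif u z \<bullet> \<phi> (N (fst z), snd z)) \<and>
      (\<integral>z. dif u z \<bullet> \<phi> (N (fst z), snd z) \<partial>PE) = (\<integral>\<omega>. u (N \<omega>) \<bullet> (G1 \<omega> - G2 \<omega>) \<partial>P)"
    if u [measurable]: "u \<in> borel_measurable \<N>" and uL: "L2 P (\<lambda>\<omega>. u (N \<omega>))" for u
  proof -
    define h where "h z = u (add_point (fst z) (snd z)) \<bullet> \<phi> z" for z
    have h [measurable]: "h \<in> borel_measurable NE"
      unfolding h_def[abs_def] by measurable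
    let ?g = "\<lambda>z. u (N (snd z)) \<bullet> f z"
    have fm [measurable]: "f \<in> borel_measurable IP"
      unfolding f_def[abs_def] by measurable
    have gi: "integrable marked ?g"
    proof (rule integrableI_bounded)
      have "(\<integral>\<^sup>+z. ennreal (norm (?g z)) \<partial>marked) \<le>
          (\<integral>\<^sup>+z. indicator K (X (fst z) (snd z)) * ennreal (C * norm (u (N (snd z)))) \<partial>marked)"
      proof (rule nn_integral_mono)
        fix z assume "z \<in> space marked"
        then have z: "snd z \<in> space P" by (auto simp: space_marked)
        have "norm (?g z) \<le> norm (u (N (snd z))) * norm (f z)" by (simp add: Cauchy_Schwarz_ineq2)
        also have "\<dots> \<le> norm (u (N (snd z))) * (C * indicator K (X (fst z) (snd z)))"
          using f_bound[OF z, of "fst z"] by (intro mult_left_mono) auto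
        finally show "ennreal (norm (?g z)) \<le> indicator K (X (fst z) (snd z)) * ennreal (C * norm (u (N (snd z))))"
          by (auto simp: indicator_def ennreal_leI mult.commute split: if_splits)
      qed
      also have "\<dots> = (\<integral>\<^sup>+\<omega>. emeasure (N \<omega>) K * ennreal (C * norm (u (N \<omega>))) \<partial>P)"
        by (intro nn_integral_marked_points) auto
      also have "\<dots> = (\<integral>\<^sup>+\<omega>. ennreal (C * (nK \<omega> * norm (u (N \<omega>)))) \<partial>P)"
        using AE_count_finite[OF K fin] C
        by (intro nn_integral_cong_AE)
          (auto elim!: eventually_mono simp: nK_def ennreal_mult ennreal_enn2real mult_ac)
      also have "\<dots> < \<infinity>"
      proof -
        have "L2 P (\<lambda>\<omega>. norm (u (N \<omega>)))" using uL by (auto simp: L2_def)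
        from L2_inner_integrable[OF nK this] have "integrable P (\<lambda>\<omega>. C * (nK \<omega> * norm (u (N \<omega>))))" by simp
        then have "(\<integral>\<^sup>+\<omega>. ennreal (norm (C * (nK \<omega> * norm (u (N \<omega>))))) \<partial>P) < \<infinity>"
          unfolding integrable_iff_bounded by blast
        moreover have "norm (C * (nK \<omega> * norm (u (N \<omega>)))) = C * (nK \<omega> * norm (u (N \<omega>)))" for \<omega>
          using C by (simp add: nK_def abs_mult)
        ultimately show ?thesis by (simp only:)
      qed
      finally show "(\<integral>\<^sup>+z. ennreal (norm (?g z)) \<partial>marked) < \<infinity>" .
    qed measurable
    have gh: "AE z in marked. h (rest (fst z) (snd z), X (fst z) (snd z)) = ?g z"
      using AE_marked_add_point by eventually_elim (simp add: h_def f_def)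
    have hm: "(\<lambda>z. h (rest (fst z) (snd z), X (fst z) (snd z))) \<in> borel_measurable marked" by measurable
    have "integrable marked (\<lambda>z. h (rest (fst z) (snd z), X (fst z) (snd z)))"
      using gi by (rule integrable_cong_AE_imp[OF _ hm]) (use gh in \<open>auto elim: eventually_mono\<close>)
    then have hi: "integrable PE (\<lambda>z. h (N (fst z), snd z))"
      using mecke_integral(1)[OF h] by simp
    have "(\<integral>z. h (N (fst z), snd z) \<partial>PE) = (\<integral>z. ?g z \<partial>marked)"
      unfolding mecke_integral(2)[OF h] using gh by (intro integral_cong_AE hm) auto
    also have "\<dots> = (\<integral>\<omega>. (\<integral>m. indicator (below \<omega>) m *\<^sub>R ?g (m, \<omega>) \<partial>count_space UNIV) \<partial>P)"
      by (rule integral_marked(3)[OF gi])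
    also have "\<dots> = (\<integral>\<omega>. u (N \<omega>) \<bullet> G1 \<omega> \<partial>P)"
    proof (rule integral_cong_AE)
      show "(\<lambda>\<omega>. \<integral>m. indicator (below \<omega>) m *\<^sub>R ?g (m, \<omega>) \<partial>count_space UNIV) \<in> borel_measurable P"
        using integral_marked(2)[OF gi] by simp
      show "AE \<omega> in P. (\<integral>m. indicator (below \<omega>) m *\<^sub>R ?g (m, \<omega>) \<partial>count_space UNIV) = u (N \<omega>) \<bullet> G1 \<omega>"
        using integral_marked(1)[OF f_int]
      proof eventually_elim
        case (elim \<omega>)
        have "(\<integral>m. indicator (below \<omega>) m *\<^sub>R ?g (m, \<omega>) \<partial>count_space UNIV) =
            (\<integral>m. u (N \<omega>) \<bullet> (indicator (below \<omega>) m *\<^sub>R f (m, \<omega>)) \<partial>count_space UNIV)"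
          by simp
        also have "\<dots> = u (N \<omega>) \<bullet> G1 \<omega>"
          unfolding G1_def by (rule integral_inner_right) (rule elim)
        finally show ?case .
      qed
    qed measurable
    finally have I1: "(\<integral>z. h (N (fst z), snd z) \<partial>PE) = (\<integral>\<omega>. u (N \<omega>) \<bullet> G1 \<omega> \<partial>P)" .
    have uz: "L2 PE (\<lambda>z. indicator K (snd z) *\<^sub>R u (N (fst z)))"
    proof -
      have "integrable P (\<lambda>\<omega>. (norm (u (N \<omega>)))\<^sup>2)" using uL by (simp add: L2_def)
      from integral_indicator_product(1)[OF K fin this]
      have "integrable PE (\<lambda>z. indicator K (snd z) * (norm (u (N (fst z))))\<^sup>2)" .
      moreover have "(norm (indicator K (snd z) *\<^sub>R u (N (fst z))))\<^sup>2 = indicator K (snd z) * (norm (u (N (fst z))))\<^sup>2"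
        for z :: "'w \<times> 'e" by (simp add: indicator_def)
      moreover have "(\<lambda>z. indicator K (snd z) *\<^sub>R u (N (fst z))) \<in> borel_measurable PE"
        by measurable
      ultimately show ?thesis unfolding L2_def by (simp only:)
    qed
    have ki: "integrable PE (\<lambda>z. u (N (fst z)) \<bullet> \<phi> (N (fst z), snd z))"
    proof (rule integrable_cong_AE_imp[OF L2_inner_integrable[OF uz \<phi>_L2]])
      show "AE z in PE. (indicator K (snd z) *\<^sub>R u (N (fst z))) \<bullet> \<phi> (N (fst z), snd z) =
          u (N (fst z)) \<bullet> \<phi> (N (fst z), snd z)"
        using AE_space
      proof eventually_elim
        case (elim z)
        then show ?case
          using bound[OF N_point_measure, of "fst z" "snd z"] by (cases "snd z \<in> K") (auto simp: space_pair_measure)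
      qed
    qed measurable
    have "(\<integral>z. u (N (fst z)) \<bullet> \<phi> (N (fst z), snd z) \<partial>PE) = (\<integral>\<omega>. (\<integral>x. u (N \<omega>) \<bullet> \<phi> (N \<omega>, x) \<partial>M) \<partial>P)"
      using PM.integral_fst'[OF ki] by simp
    also have "\<dots> = (\<integral>\<omega>. u (N \<omega>) \<bullet> G2 \<omega> \<partial>P)"
    proof (rule integral_cong_AE)
      show "AE \<omega> in P. (\<integral>x. u (N \<omega>) \<bullet> \<phi> (N \<omega>, x) \<partial>M) = u (N \<omega>) \<bullet> G2 \<omega>"
        using PM.AE_integrable_fst'[OF \<phi>_int] by eventually_elim (simp add: G2_def)
    qed measurable
    finally have I2: "(\<integral>z. u (N (fst z)) \<bullet> \<phi> (N (fst z), snd z) \<partial>PE) = (\<integral>\<omega>. u (N \<omega>) \<bullet> G2 \<omega> \<partial>P)" .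
    have e: "dif u z \<bullet> \<phi> (N (fst z), snd z) = h (N (fst z), snd z) - u (N (fst z)) \<bullet> \<phi> (N (fst z), snd z)" for z
      by (simp add: dif_def h_def inner_diff_left)
    show ?thesis
      unfolding e inner_diff_right
      using hi ki I1 I2 L2_inner_integrable[OF uL G1_L2] L2_inner_integrable[OF uL G2_L2] by simp
  qed
  then show ?thesis
    using L2_diff[OF G1_L2 G2_L2] by (simp add: strong_skorohod_def pw)
qed

text \<open>The energy estimate.  Duality applied to \<open>G\<close> itself gives \<open>\<^bold>E \<parallel>G\<parallel>\<^sup>2 = \<^bold>E \<integral> \<langle>D\<^sub>xG, \<phi>(x)\<rangle> \<mu>(dx)\<close>; the
  commutation relation and a second duality turn this into
  \<open>\<^bold>E \<integral> \<parallel>\<phi>(x)\<parallel>\<^sup>2 \<mu>(dx) + \<^bold>E \<integral>\<integral> \<langle>D\<^sub>y\<phi>(x), D\<^sub>x\<phi>(y)\<rangle> \<mu>(dy) \<mu>(dx)\<close>.\<close>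

lemma energy_estimate:
  fixes \<phi> :: "'e measure \<times> 'e \<Rightarrow> 'h::{real_inner, banach, second_countable_topology}"
  assumes ff: "finite_field K C \<phi>" and G: "strong_skorohod \<phi> G"
    and D\<phi>: "L2 EPE (\<lambda>(x, z). dfield \<phi> x z)"
  shows "(\<integral>\<omega>. (norm (G \<omega>))\<^sup>2 \<partial>P) \<le> (\<integral>z. (norm (\<phi> (N (fst z), snd z)))\<^sup>2 \<partial>PE) +
    (\<integral>(x, z). (norm (dfield \<phi> x z))\<^sup>2 \<partial>EPE)"
proof -
  have C: "0 \<le> C" and \<phi> [measurable]: "\<phi> \<in> borel_measurable NE"
    and bound: "\<And>\<eta> y. \<eta> \<in> point_measures M \<Longrightarrow> y \<in> space M \<Longrightarrow> norm (\<phi> (\<eta>, y)) \<le> C * indicator K y"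
    using ff by (auto simp: finite_field_def)
  note \<phi>_L2 = finite_field_L2[OF ff]
  have GL: "L2 P G" using G by (simp add: strong_skorohod_def)
  then have Gm [measurable]: "G \<in> borel_measurable P" by measurable
  obtain \<gamma> where \<gamma> [measurable]: "\<gamma> \<in> borel_measurable \<N>" and G\<gamma>: "AE \<omega> in P. G \<omega> = \<gamma> (N \<omega>)"
    using N_representative[OF Gm] by blast
  have \<gamma>L: "L2 P (\<lambda>\<omega>. \<gamma> (N \<omega>))" by (rule L2_cong_AE[OF GL _ G\<gamma>]) measurable
  have "strong_skorohod \<phi> (\<lambda>\<omega>. \<gamma> (N \<omega>))"
  proof -
    have "(\<integral>\<omega>. u (N \<omega>) \<bullet> G \<omega> \<partial>P) = (\<integral>\<omega>. u (N \<omega>) \<bullet> \<gamma> (N \<omega>) \<partial>P)"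
      if [measurable]: "u \<in> borel_measurable \<N>" for u
      using G\<gamma> by (intro integral_cong_AE) (auto elim: eventually_mono)
    then show ?thesis using G \<gamma>L by (simp add: strong_skorohod_def)
  qed
  note sk = strong_imp_is_skorohod[OF \<phi> this]
  define \<psi> where "\<psi> x z = \<phi> (add_point (fst z) x, snd z) - \<phi> z" for x z
  have \<psi>_field: "finite_field K (2 * C) (\<psi> x)" if x: "x \<in> space M" for x
  proof -
    have "\<psi> x \<in> borel_measurable NE"
      unfolding \<psi>_def[abs_def] using x by measurable
    moreover have "norm (\<psi> x (\<eta>, y)) \<le> 2 * C * indicator K y" if "\<eta> \<in> point_measures M" "y \<in> space M" for \<eta> y
      unfolding \<psi>_def using bound[OF that] bound[OF add_point_in_point_measures[OF that(1)] that(2), of x]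
      by (simp add: norm_triangle_le_diff)
    ultimately show ?thesis using ff by (simp add: finite_field_def)
  qed
  have d\<psi>: "dfield \<phi> x = (\<lambda>z. \<psi> x (N (fst z), snd z))" for x
    by (simp add: fun_eq_iff dfield_def \<psi>_def)
  define G' where "G' x = pathwise (\<psi> x)" for x
  have strong': "strong_skorohod (\<psi> x) (G' x)" if "x \<in> space M" for x
    unfolding G'_def by (rule strong_skorohod_pathwise[OF \<psi>_field[OF that]])
  have skx: "AE x in M. is_skorohod P M N (dfield \<phi> x) (G' x)"
    using AE_space
  proof eventually_elim
    case (elim x)
    then show ?case
      unfolding d\<psi> using strong'[OF elim] \<psi>_field[OF elim]
      by (intro strong_imp_is_skorohod) (auto simp: finite_field_def)
  qed
  have comm: "AE x in M. AE \<omega> in P. dif \<gamma> (\<omega>, x) = \<phi> (N \<omega>, x) + G' x \<omega>"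
    by (rule commutation[OF \<phi> \<gamma> \<phi>_L2 D\<phi> sk skx])
  have dual: "integrable PE (\<lambda>(\<omega>, x). dif \<gamma> (\<omega>, x) \<bullet> \<phi> (N \<omega>, x))"
    "(\<integral>(\<omega>, x). dif \<gamma> (\<omega>, x) \<bullet> \<phi> (N \<omega>, x) \<partial>PE) = (\<integral>\<omega>. \<gamma> (N \<omega>) \<bullet> G \<omega> \<partial>P)"
    using G \<gamma> \<gamma>L by (auto simp: strong_skorohod_def case_prod_beta')
  have D2: "integrable EPE (\<lambda>z. (norm (case z of (x, z) \<Rightarrow> dfield \<phi> x z))\<^sup>2)"
    using D\<phi> by (simp add: L2_def)
  note D2' = integral_swap_marks[OF D2]
  define R where "R x = (\<integral>z. (norm (dfield \<phi> x z))\<^sup>2 \<partial>PE)" for x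
  define R' where "R' x = (\<integral>z. (norm (dfield \<phi> (snd z) (fst z, x)))\<^sup>2 \<partial>PE)" for x
  have R: "integrable M R" "(\<integral>x. R x \<partial>M) = (\<integral>(x, z). (norm (dfield \<phi> x z))\<^sup>2 \<partial>EPE)"
    using Q.integrable_fst'[OF D2] Q.integral_fst'[OF D2] by (simp_all add: R_def[abs_def] case_prod_beta')
  have R': "integrable M R'" "(\<integral>x. R' x \<partial>M) = (\<integral>(x, z). (norm (dfield \<phi> x z))\<^sup>2 \<partial>EPE)"
    using Q.integrable_fst'[OF D2'(1)] Q.integral_fst'[OF D2'(1)] D2'(2)
    by (simp_all add: R'_def[abs_def] case_prod_beta')
  define V where "V x = (\<integral>\<omega>. (norm (\<phi> (N \<omega>, x)))\<^sup>2 \<partial>P)" for x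
  have v_int: "integrable PE (\<lambda>(\<omega>, x). (norm (\<phi> (N \<omega>, x)))\<^sup>2)"
    using \<phi>_L2 by (simp add: L2_def case_prod_beta')
  have V: "integrable M V" "(\<integral>x. V x \<partial>M) = (\<integral>z. (norm (\<phi> (N (fst z), snd z)))\<^sup>2 \<partial>PE)"
    using PM.integrable_snd[OF v_int] PM.integral_snd[OF v_int] by (simp_all add: V_def[abs_def] case_prod_beta')
  have le: "AE x in M. (\<integral>\<omega>. dif \<gamma> (\<omega>, x) \<bullet> \<phi> (N \<omega>, x) \<partial>P) \<le> V x + (R x + R' x) / 2"
    using comm Q.AE_integrable_fst'[OF D2] Q.AE_integrable_fst'[OF D2'(1)] AE_space
  proof eventually_elim
    case (elim x)
    have \<phi>x [measurable]: "(\<lambda>\<eta>. \<phi> (\<eta>, x)) \<in> borel_measurable \<N>" using elim(4) by measurable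
    have \<phi>xL: "L2 P (\<lambda>\<omega>. \<phi> (N \<omega>, x))"
    proof (rule L2_bounded_indicator)
      show "AE \<omega> in P. norm (\<phi> (N \<omega>, x)) \<le> C * indicator (space P) \<omega>"
        using AE_space
      proof eventually_elim
        case (elim \<omega>)
        have "norm (\<phi> (N \<omega>, x)) \<le> C * indicator K x"
          by (rule bound[OF N_point_measure[OF elim] \<open>x \<in> space M\<close>])
        also have "\<dots> \<le> C" using C by (simp add: indicator_def)
        finally show ?case using elim by simp
      qed
    qed (auto simp: P.emeasure_space_1)
    have G'L: "L2 P (G' x)" using strong'[OF elim(4)] by (simp add: strong_skorohod_def)
    have [measurable]: "G' x \<in> borel_measurable P" using G'L by measurable
    have "(\<integral>\<omega>. dif \<gamma> (\<omega>, x) \<bullet> \<phi> (N \<omega>, x) \<partial>P) = (\<integral>\<omega>. (norm (\<phi> (N \<omega>, x)))\<^sup>2 + \<phi> (N \<omega>, x) \<bullet> G' x \<omega> \<partial>P)"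
    proof (rule integral_cong_AE)
      show "(\<lambda>\<omega>. dif \<gamma> (\<omega>, x) \<bullet> \<phi> (N \<omega>, x)) \<in> borel_measurable P" using elim(4) by measurable
      show "AE \<omega> in P. dif \<gamma> (\<omega>, x) \<bullet> \<phi> (N \<omega>, x) = (norm (\<phi> (N \<omega>, x)))\<^sup>2 + \<phi> (N \<omega>, x) \<bullet> G' x \<omega>"
        using elim(1)
      proof eventually_elim
        case (elim \<omega>)
        then show ?case
          by (simp add: inner_add_left power2_norm_eq_inner inner_commute[of "G' x \<omega>"])
      qed
    qed measurable
    also have "\<dots> = V x + (\<integral>\<omega>. \<phi> (N \<omega>, x) \<bullet> G' x \<omega> \<partial>P)"
      using \<phi>xL L2_inner_integrable[OF \<phi>xL G'L] by (simp add: V_def L2_def)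
    also have "(\<integral>\<omega>. \<phi> (N \<omega>, x) \<bullet> G' x \<omega> \<partial>P) = (\<integral>z. dif (\<lambda>\<eta>. \<phi> (\<eta>, x)) z \<bullet> \<psi> x (N (fst z), snd z) \<partial>PE)"
      using strong'[OF elim(4)] \<phi>x \<phi>xL by (simp add: strong_skorohod_def)
    also have "\<dots> \<le> (\<integral>z. ((norm (dfield \<phi> x z))\<^sup>2 + (norm (dfield \<phi> (snd z) (fst z, x)))\<^sup>2) / 2 \<partial>PE)"
    proof (rule integral_mono)
      show "integrable PE (\<lambda>z. dif (\<lambda>\<eta>. \<phi> (\<eta>, x)) z \<bullet> \<psi> x (N (fst z), snd z))"
        using strong'[OF elim(4)] \<phi>x \<phi>xL by (simp add: strong_skorohod_def)
      show "integrable PE (\<lambda>z. ((norm (dfield \<phi> x z))\<^sup>2 + (norm (dfield \<phi> (snd z) (fst z, x)))\<^sup>2) / 2)"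
        using elim(2,3) by (simp add: case_prod_beta')
      fix z :: "'w \<times> 'e"
      have "dif (\<lambda>\<eta>. \<phi> (\<eta>, x)) z = dfield \<phi> (snd z) (fst z, x)" by (simp add: dif_def dfield_def)
      moreover have "\<psi> x (N (fst z), snd z) = dfield \<phi> x z" by (simp add: d\<psi>)
      moreover have "a \<bullet> b \<le> ((norm b)\<^sup>2 + (norm a)\<^sup>2) / 2" for a b :: 'h
      proof -
        have "2 * (norm a * norm b) \<le> (norm a)\<^sup>2 + (norm b)\<^sup>2"
          using sum_squares_bound[of "norm a" "norm b"] by (simp only: mult.assoc)
        then show ?thesis using norm_cauchy_schwarz[of a b] by argo
      qed
      ultimately show "dif (\<lambda>\<eta>. \<phi> (\<eta>, x)) z \<bullet> \<psi> x (N (fst z), snd z) \<le>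
          ((norm (dfield \<phi> x z))\<^sup>2 + (norm (dfield \<phi> (snd z) (fst z, x)))\<^sup>2) / 2" by simp
    qed
    also have "\<dots> = (R x + R' x) / 2"
      using elim(2,3) by (simp add: R_def R'_def case_prod_beta')
    finally show ?case by simp
  qed
  have "(\<integral>\<omega>. (norm (G \<omega>))\<^sup>2 \<partial>P) = (\<integral>\<omega>. \<gamma> (N \<omega>) \<bullet> G \<omega> \<partial>P)"
    using G\<gamma> by (intro integral_cong_AE) (auto elim!: eventually_mono simp: power2_norm_eq_inner)
  also have "\<dots> = (\<integral>x. (\<integral>\<omega>. dif \<gamma> (\<omega>, x) \<bullet> \<phi> (N \<omega>, x) \<partial>P) \<partial>M)"
    unfolding dual(2)[symmetric] by (rule PM.integral_snd[OF dual(1), symmetric])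
  also have "\<dots> \<le> (\<integral>x. V x + (R x + R' x) / 2 \<partial>M)"
    using PM.integrable_snd[OF dual(1)] V R R' le by (intro integral_mono_AE) auto
  also have "\<dots> = (\<integral>z. (norm (\<phi> (N (fst z), snd z)))\<^sup>2 \<partial>PE) +
      (\<integral>(x, z). (norm (dfield \<phi> x z))\<^sup>2 \<partial>EPE)"
    using V R R' by simp
  finally show ?thesis .
qed

end

section \<open>Limits in the space of square integrable functions\<close>

lemma L2_inner_tendsto:
  fixes f H :: "'a \<Rightarrow> 'h::{real_inner, second_countable_topology}"
  assumes f: "L2 m f" and G: "\<And>n. L2 m (G n)" and H: "L2 m H"
    and lim: "(\<lambda>n. \<integral>z. (norm (G n z - H z))\<^sup>2 \<partial>m) \<longlonglongrightarrow> 0"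
  shows "(\<lambda>n. \<integral>z. f z \<bullet> G n z \<partial>m) \<longlonglongrightarrow> (\<integral>z. f z \<bullet> H z \<partial>m)"
proof -
  define a where "a = (\<integral>z. (norm (f z))\<^sup>2 \<partial>m)"
  define d where "d n = (\<integral>z. (norm (G n z - H z))\<^sup>2 \<partial>m)" for n
  have a: "0 \<le> a" by (simp add: a_def)
  have bound: "\<bar>(\<integral>z. f z \<bullet> G n z \<partial>m) - (\<integral>z. f z \<bullet> H z \<partial>m)\<bar> \<le> t * a + d n / t" if t: "0 < t" for n t
  proof -
    note D = L2_diff[OF G[of n] H]
    have "(\<integral>z. f z \<bullet> G n z \<partial>m) - (\<integral>z. f z \<bullet> H z \<partial>m) = (\<integral>z. f z \<bullet> (G n z - H z) \<partial>m)"
      using L2_inner_integrable[OF f G[of n]] L2_inner_integrable[OF f H] by (simp add: inner_diff_right)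
    also have "\<bar>\<dots>\<bar> \<le> (\<integral>z. \<bar>f z \<bullet> (G n z - H z)\<bar> \<partial>m)"
      by (rule integral_abs_bound)
    also have "\<dots> \<le> (\<integral>z. t * (norm (f z))\<^sup>2 + (norm (G n z - H z))\<^sup>2 / t \<partial>m)"
    proof (rule integral_mono)
      show "integrable m (\<lambda>z. \<bar>f z \<bullet> (G n z - H z)\<bar>)"
        using L2_inner_integrable[OF f D] by simp
      show "integrable m (\<lambda>z. t * (norm (f z))\<^sup>2 + (norm (G n z - H z))\<^sup>2 / t)"
        using f D by (auto simp: L2_def)
      fix z
      define p where "p = norm (f z)"
      define q where "q = norm (G n z - H z)"
      have pq: "0 \<le> p" "0 \<le> q" by (simp_all add: p_def q_def)
      have "0 \<le> (t * p - q)\<^sup>2" by simp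
      then have "2 * (t * p * q) \<le> t * p * (t * p) + q * q"
        by (simp add: power2_eq_square algebra_simps)
      moreover have "0 \<le> t * p * q" using t pq by simp
      ultimately have "t * p * q \<le> t * p * (t * p) + q * q" by linarith
      then have "p * q \<le> t * p\<^sup>2 + q\<^sup>2 / t"
        using t by (simp add: field_simps power2_eq_square)
      then show "\<bar>f z \<bullet> (G n z - H z)\<bar> \<le> t * (norm (f z))\<^sup>2 + (norm (G n z - H z))\<^sup>2 / t"
        using Cauchy_Schwarz_ineq2[of "f z" "G n z - H z"] by (simp add: p_def q_def)
    qed
    also have "\<dots> = t * a + d n / t"
      using f D by (simp add: L2_def a_def d_def)
    finally show ?thesis .
  qed
  show ?thesis
  proof (rule LIMSEQ_I)
    fix e :: real assume e: "0 < e"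
    define t where "t = e / (2 * (a + 1))"
    have t: "0 < t" using a e by (simp add: t_def)
    have ta: "t * a < e / 2"
    proof -
      have "t * a < t * (a + 1)" using t by simp
      also have "\<dots> = e / 2" using a by (simp add: t_def field_simps)
      finally show ?thesis .
    qed
    have "0 < t * e / 2" using t e by simp
    then obtain n0 where n0: "\<And>n. n \<ge> n0 \<Longrightarrow> \<bar>d n\<bar> < t * e / 2"
      using LIMSEQ_D[OF lim, of "t * e / 2"] unfolding d_def by auto
    have "norm ((\<integral>z. f z \<bullet> G n z \<partial>m) - (\<integral>z. f z \<bullet> H z \<partial>m)) < e" if "n \<ge> n0" for n
    proof -
      have "d n / t < e / 2"
        using n0[OF that] t by (simp add: field_simps)
      then show ?thesis unfolding real_norm_def using bound[OF t, of n] ta by linarith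
    qed
    then show "\<exists>no. \<forall>n\<ge>no. norm ((\<integral>z. f z \<bullet> G n z \<partial>m) - (\<integral>z. f z \<bullet> H z \<partial>m)) < e"
      by blast
  qed
qed

text \<open>Completeness of \<open>L\<^sup>2\<close>, in the form in which the energy estimate supplies it.  Along indices
  with \<open>e (r k) \<le> (1/8)\<^sup>k\<close> the \<open>L\<^sup>1\<close>-norms of the increments are summable, so \<open>G (r k)\<close> converges
  almost surely, and Fatou's lemma estimates the distance to the limit.\<close>

lemma (in prob_space) L2_cauchy_limit:
  fixes G :: "nat \<Rightarrow> 'a \<Rightarrow> 'h::{banach, second_countable_topology}"
  assumes G: "\<And>n. L2 M (G n)" and e: "e \<longlonglongrightarrow> 0"
    and cauchy: "\<And>m n. (\<integral>z. (norm (G m z - G n z))\<^sup>2 \<partial>M) \<le> e m + e n"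
  shows "\<exists>H. L2 M H \<and> (\<lambda>n. \<integral>z. (norm (G n z - H z))\<^sup>2 \<partial>M) \<longlonglongrightarrow> 0"
proof -
  have e_nonneg: "0 \<le> e n" for n using cauchy[of n n] by simp
  have [measurable]: "G n \<in> borel_measurable M" for n using G[of n] by measurable
  have "\<exists>n. e n \<le> (1/8) ^ k" for k :: nat
  proof -
    obtain n where "\<bar>e n\<bar> < (1/8) ^ k"
      using LIMSEQ_D[OF e, of "(1/8) ^ k"] by auto
    then show ?thesis by (intro exI[of _ n]) linarith
  qed
  then obtain r where r: "\<And>k. e (r k) \<le> (1/8) ^ k" by metis
  define \<Delta> where "\<Delta> k z = G (r (Suc k)) z - G (r k) z" for k z
  have \<Delta>_L2: "L2 M (\<Delta> k)" for k unfolding \<Delta>_def[abs_def] by (rule L2_diff[OF G G])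
  have [measurable]: "\<Delta> k \<in> borel_measurable M" for k using \<Delta>_L2[of k] by measurable
  \<comment> \<open>The choice \<open>a = (1/2)\<^sup>k\<close> in \<open>t \<le> a + t\<^sup>2 / a\<close> makes both terms summable.\<close>
  have \<Delta>_bound: "(\<integral>\<^sup>+z. ennreal (norm (\<Delta> k z)) \<partial>M) \<le> ennreal (3 * (1/2) ^ k)" for k
  proof -
    define a :: real where "a = (1/2) ^ k"
    have a: "0 < a" by (simp add: a_def)
    have i: "integrable M (\<lambda>z. a + (norm (\<Delta> k z))\<^sup>2 / a)" using \<Delta>_L2[of k] by (simp add: L2_def)
    have "(\<integral>\<^sup>+z. ennreal (norm (\<Delta> k z)) \<partial>M) \<le> (\<integral>\<^sup>+z. ennreal (a + (norm (\<Delta> k z))\<^sup>2 / a) \<partial>M)"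
    proof (intro nn_integral_mono ennreal_leI)
      fix z
      have "0 \<le> (norm (\<Delta> k z) - a)\<^sup>2" by simp
      then have "2 * (a * norm (\<Delta> k z)) \<le> a * a + (norm (\<Delta> k z))\<^sup>2"
        by (simp add: power2_eq_square algebra_simps)
      moreover have "0 \<le> a * norm (\<Delta> k z)" using a by simp
      ultimately have "a * norm (\<Delta> k z) \<le> a * a + (norm (\<Delta> k z))\<^sup>2" by linarith
      then show "norm (\<Delta> k z) \<le> a + (norm (\<Delta> k z))\<^sup>2 / a"
        using a by (simp add: field_simps power2_eq_square)
    qed
    also have "\<dots> = ennreal (\<integral>z. a + (norm (\<Delta> k z))\<^sup>2 / a \<partial>M)"
      using a by (intro nn_integral_eq_integral[OF i]) auto
    also have "(\<integral>z. a + (norm (\<Delta> k z))\<^sup>2 / a \<partial>M) = a + (\<integral>z. (norm (\<Delta> k z))\<^sup>2 \<partial>M) / a"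
      using \<Delta>_L2[of k] by (simp add: L2_def prob_space)
    also have "\<dots> \<le> a + (2 * (1/8) ^ k) / a"
    proof -
      have "(\<integral>z. (norm (\<Delta> k z))\<^sup>2 \<partial>M) \<le> e (r (Suc k)) + e (r k)"
        unfolding \<Delta>_def by (rule cauchy)
      also have "\<dots> \<le> (1/8) ^ Suc k + (1/8) ^ k" using r by (intro add_mono)
      also have "\<dots> \<le> 2 * (1/8) ^ k" by simp
      finally show ?thesis using a by (simp add: divide_right_mono)
    qed
    also have "(2 * (1/8) ^ k) / a = 2 * (1/4) ^ k"
    proof -
      have "(1/8::real) ^ k = (1/4) ^ k * a"
        by (simp add: a_def flip: power_mult_distrib)
      then show ?thesis using a by simp
    qed
    also have "a + 2 * (1/4) ^ k \<le> 3 * (1/2) ^ k"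
      using power_mono[of "1/4::real" "1/2" k] by (simp add: a_def)
    finally show ?thesis by (simp add: ennreal_leI)
  qed
  have "(\<integral>\<^sup>+z. (\<Sum>k. ennreal (norm (\<Delta> k z))) \<partial>M) = (\<Sum>k. \<integral>\<^sup>+z. ennreal (norm (\<Delta> k z)) \<partial>M)"
    by (rule nn_integral_suminf) measurable
  also have "\<dots> \<le> (\<Sum>k. ennreal (3 * (1/2) ^ k))"
    by (intro suminf_le \<Delta>_bound summableI)
  also have "\<dots> < \<infinity>"
    by (subst suminf_ennreal2) (auto intro: summable_mult summable_geometric)
  finally have "AE z in M. (\<Sum>k. ennreal (norm (\<Delta> k z))) \<noteq> \<infinity>"
    by (intro nn_integral_noteq_infinite) auto
  then have conv: "AE z in M. convergent (\<lambda>k. G (r k) z)"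
  proof eventually_elim
    case (elim z)
    then have "summable (\<lambda>k. norm (\<Delta> k z))"
      by (intro summable_suminf_not_top) auto
    then have "summable (\<lambda>k. \<Delta> k z)" by (rule summable_norm_cancel)
    then have "convergent (\<lambda>k. \<Sum>j<k. \<Delta> j z)" by (simp add: summable_iff_convergent)
    moreover have "(\<Sum>j<k. \<Delta> j z) = G (r k) z - G (r 0) z" for k
      by (induction k) (auto simp: \<Delta>_def)
    ultimately have "convergent (\<lambda>k. (G (r k) z - G (r 0) z) + G (r 0) z)"
      by (intro convergent_add convergent_const) simp
    then show ?case by simp
  qed
  define H where "H z = lim (\<lambda>k. G (r k) z)" for z
  have H [measurable]: "H \<in> borel_measurable M" unfolding H_def[abs_def] by measurable
  have G_H: "AE z in M. (\<lambda>k. G (r k) z) \<longlonglongrightarrow> H z"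
    using conv by eventually_elim (simp add: H_def convergent_LIMSEQ_iff)
  have dist: "(\<integral>\<^sup>+z. ennreal ((norm (G n z - H z))\<^sup>2) \<partial>M) \<le> ennreal (e n)" for n
  proof -
    have "(\<integral>\<^sup>+z. ennreal ((norm (G n z - H z))\<^sup>2) \<partial>M) =
        (\<integral>\<^sup>+z. liminf (\<lambda>k. ennreal ((norm (G n z - G (r k) z))\<^sup>2)) \<partial>M)"
    proof (rule nn_integral_cong_AE)
      show "AE z in M. ennreal ((norm (G n z - H z))\<^sup>2) = liminf (\<lambda>k. ennreal ((norm (G n z - G (r k) z))\<^sup>2))"
        using G_H
      proof eventually_elim
        case (elim z)
        have "(\<lambda>k. ennreal ((norm (G n z - G (r k) z))\<^sup>2)) \<longlonglongrightarrow> ennreal ((norm (G n z - H z))\<^sup>2)"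
          by (intro tendsto_intros elim)
        from lim_imp_Liminf[OF trivial_limit_sequentially this] show ?case by (rule sym)
      qed
    qed
    also have "\<dots> \<le> liminf (\<lambda>k. \<integral>\<^sup>+z. ennreal ((norm (G n z - G (r k) z))\<^sup>2) \<partial>M)"
      by (rule nn_integral_liminf) measurable
    also have "\<dots> \<le> liminf (\<lambda>k. ennreal (e n + (1/8) ^ k))"
    proof (intro Liminf_mono always_eventually allI)
      fix k
      have "(\<integral>\<^sup>+z. ennreal ((norm (G n z - G (r k) z))\<^sup>2) \<partial>M) = ennreal (\<integral>z. (norm (G n z - G (r k) z))\<^sup>2 \<partial>M)"
        using L2_diff[OF G[of n] G[of "r k"]] by (intro nn_integral_eq_integral) (auto simp: L2_def)
      also have "\<dots> \<le> ennreal (e n + (1/8) ^ k)"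
        using cauchy[of n "r k"] r[of k] by (intro ennreal_leI) linarith
      finally show "(\<integral>\<^sup>+z. ennreal ((norm (G n z - G (r k) z))\<^sup>2) \<partial>M) \<le> ennreal (e n + (1/8) ^ k)" .
    qed
    also have "liminf (\<lambda>k. ennreal (e n + (1/8) ^ k)) = ennreal (e n + 0)"
      by (intro lim_imp_Liminf tendsto_ennrealI tendsto_add tendsto_const LIMSEQ_power_zero) auto
    finally show ?thesis by simp
  qed
  have D_L2: "L2 M (\<lambda>z. G n z - H z)" for n
    using dist[of n] by (subst L2_iff_nn_integral) (auto intro: le_less_trans)
  have "L2 M (\<lambda>z. G 0 z - (G 0 z - H z))" by (rule L2_diff[OF G D_L2])
  then have "L2 M H" by simp
  moreover have "(\<integral>z. (norm (G n z - H z))\<^sup>2 \<partial>M) \<le> e n" for n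
  proof -
    have "(\<integral>\<^sup>+z. ennreal ((norm (G n z - H z))\<^sup>2) \<partial>M) = ennreal (\<integral>z. (norm (G n z - H z))\<^sup>2 \<partial>M)"
      using D_L2[of n] by (intro nn_integral_eq_integral) (auto simp: L2_def)
    then show ?thesis using dist[of n] e_nonneg[of n] by simp
  qed
  then have "(\<lambda>n. \<integral>z. (norm (G n z - H z))\<^sup>2 \<partial>M) \<longlonglongrightarrow> 0"
    by (intro tendsto_sandwich[OF _ _ tendsto_const e]) (auto intro!: always_eventually)
  ultimately show ?thesis by blast
qed

section \<open>Existence of the Skorohod integral\<close>

text \<open>A bounded map that approximates the identity and is Lipschitz with a constant that does not
  depend on \<open>n\<close>, so that \<open>\<parallel>D\<^sub>x(trunc n \<circ> \<Phi>)\<parallel> \<le> 2 \<parallel>D\<^sub>x\<Phi>\<parallel>\<close>.\<close>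

definition trunc :: "nat \<Rightarrow> 'h::real_normed_vector \<Rightarrow> 'h" where
  "trunc n v = (1 / (1 + norm v / (real n + 1))) *\<^sub>R v"

lemma norm_trunc: "norm (trunc n v) = norm v / (1 + norm v / (real n + 1))"
proof -
  have "0 \<le> 1 + norm v / (real n + 1)" by (intro add_nonneg_nonneg divide_nonneg_nonneg) auto
  then show ?thesis by (simp add: trunc_def)
qed

lemma norm_trunc_le: "norm (trunc n v) \<le> real n + 1" "norm (trunc n v) \<le> norm v"
proof -
  define c where "c = real n + 1"
  have c: "0 < c" by (simp add: c_def)
  have p: "0 < 1 + norm v / c" using c by (simp add: add_pos_nonneg)
  have "norm v \<le> norm v * (1 + norm v / c)" using c by (simp add: distrib_left)
  then show "norm (trunc n v) \<le> norm v"
    unfolding norm_trunc c_def[symmetric] using p by (simp add: pos_divide_le_eq)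
  have "norm v \<le> c * (1 + norm v / c)" using c by (simp add: distrib_left)
  then show "norm (trunc n v) \<le> real n + 1"
    unfolding norm_trunc c_def[symmetric] using p by (simp add: pos_divide_le_eq)
qed

lemma trunc_lipschitz: "norm (trunc n a - trunc n b) \<le> 2 * norm (a - b)"
proof -
  define c where "c = real n + 1"
  have c: "0 < c" by (simp add: c_def)
  define s where "s v = 1 / (1 + norm v / c)" for v :: 'a
  have pos: "0 < 1 + norm v / c" for v :: 'a using c by (simp add: add_pos_nonneg)
  have s: "0 < s v" "s v \<le> 1" "s v * (norm v / c) \<le> 1" for v :: 'a
  proof -
    show "0 < s v" "s v \<le> 1" using pos[of v] c by (simp_all add: s_def pos_divide_le_eq)
    have "s v * (norm v / c) = (norm v / c) / (1 + norm v / c)" by (simp add: s_def)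
    also have "\<dots> \<le> 1" unfolding pos_divide_le_eq[OF pos] by simp
    finally show "s v * (norm v / c) \<le> 1" .
  qed
  have diff: "s a - s b = (norm b - norm a) / c * (s a * s b)"
  proof -
    have "1 / p - 1 / q = (q - p) * (1 / p * (1 / q))" if "0 < p" "0 < q" for p q :: real
      using that by (simp add: field_simps)
    from this[OF pos[of a] pos[of b]] show ?thesis
      by (simp only: s_def) (simp add: diff_divide_distrib)
  qed
  have "trunc n a - trunc n b = s a *\<^sub>R (a - b) + (s a - s b) *\<^sub>R b"
    by (simp add: trunc_def s_def c_def algebra_simps)
  then have "norm (trunc n a - trunc n b) \<le> s a * norm (a - b) + \<bar>s a - s b\<bar> * norm b"
    using s(1)[of a] by (metis abs_of_pos norm_scaleR norm_triangle_ineq)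
  also have "\<bar>s a - s b\<bar> * norm b = \<bar>norm b - norm a\<bar> * (s a * (s b * (norm b / c)))"
    unfolding diff using c s(1)[of a] s(1)[of b] by (simp add: abs_mult)
  also have "\<dots> \<le> norm (a - b) * 1"
  proof (rule mult_mono)
    show "\<bar>norm b - norm a\<bar> \<le> norm (a - b)" by (metis norm_triangle_ineq3 norm_minus_commute)
    show "s a * (s b * (norm b / c)) \<le> 1"
      using mult_mono[OF s(2)[of a] s(3)[of b]] s(1)[of a] s(1)[of b] c by simp
    show "0 \<le> s a * (s b * (norm b / c))" using s(1)[of a] s(1)[of b] c by simp
  qed simp
  also have "s a * norm (a - b) \<le> norm (a - b)" using s(1,2)[of a] by (simp add: mult_left_le_one_le)
  finally show ?thesis by simp
qed

lemma trunc_tendsto: "(\<lambda>n. trunc n v) \<longlonglongrightarrow> v"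
proof -
  have "(\<lambda>n. 1 / (1 + norm v / (real n + 1))) \<longlonglongrightarrow> 1 / (1 + 0)"
  proof (intro tendsto_divide tendsto_add tendsto_const)
    show "(\<lambda>n. norm v / (real n + 1)) \<longlonglongrightarrow> 0"
      using tendsto_mult[OF tendsto_const[of "norm v"] LIMSEQ_inverse_real_of_nat]
      by (simp add: divide_inverse add.commute)
  qed auto
  then have "(\<lambda>n. (1 / (1 + norm v / (real n + 1))) *\<^sub>R v) \<longlonglongrightarrow> (1 / (1 + 0)) *\<^sub>R v"
    by (intro tendsto_scaleR tendsto_const)
  then show ?thesis by (simp add: trunc_def)
qed

lemma measurable_trunc [measurable]:
  "trunc n \<in> borel_measurable (borel :: 'h::{real_normed_vector, second_countable_topology} measure)"
  unfolding trunc_def[abs_def] by measurable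

context poisson_process
begin

text \<open>Every field with \<open>\<phi>(N)\<close> and \<open>D\<phi>(N)\<close> square integrable is approximated by bounded fields of
  finite intensity.  Truncation by a Lipschitz map keeps the differences under control, so that
  the energy estimate makes the integrals of the approximations a Cauchy sequence.\<close>

theorem skorohod_exists:
  fixes \<phi> :: "'e measure \<times> 'e \<Rightarrow> 'h::{real_inner, banach, second_countable_topology}"
  assumes \<phi> [measurable]: "\<phi> \<in> borel_measurable NE"
    and \<phi>L: "L2 PE (\<lambda>z. \<phi> (N (fst z), snd z))"
    and D\<phi>: "L2 EPE (\<lambda>(x, z). dfield \<phi> x z)"
  shows "\<exists>H. is_skorohod P M N (\<lambda>z. \<phi> (N (fst z), snd z)) H"
proof -
  define E where "E n = (\<Union>i<n. A i)" for n
  have E [measurable]: "E n \<in> sets M" for n using A_sets by (auto simp: E_def)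
  have E_fin: "emeasure M (E n) < \<infinity>" for n
  proof -
    have "emeasure M (E n) \<le> (\<Sum>i<n. emeasure M (A i))"
      unfolding E_def using A_sets by (intro emeasure_subadditive_finite) auto
    also have "\<dots> < \<infinity>" using A_finite by simp
    finally show ?thesis .
  qed
  have E_ev: "eventually (\<lambda>n. y \<in> E n) sequentially" if y: "y \<in> space M" for y
  proof -
    obtain i where "y \<in> A i" using y A_cover by auto
    then have "y \<in> E n" if "Suc i \<le> n" for n using that by (auto simp: E_def)
    then show ?thesis unfolding eventually_sequentially by blast
  qed
  define \<psi> where "\<psi> n z = (indicator (E n) (snd z) :: real) *\<^sub>R trunc n (\<phi> z)" for n z
  have \<psi>m [measurable]: "\<psi> n \<in> borel_measurable NE" for n
    unfolding \<psi>_def[abs_def] by measurable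
  have ff: "finite_field (E n) (real n + 1) (\<psi> n)" for n
    using norm_trunc_le(1) E_fin by (auto simp: finite_field_def \<psi>_def indicator_def)
  have ff2: "finite_field (E m \<union> E n) ((real m + 1) + (real n + 1)) (\<lambda>z. \<psi> m z - \<psi> n z)" for m n
  proof -
    have "emeasure M (E m \<union> E n) \<le> emeasure M (E m) + emeasure M (E n)"
      by (rule emeasure_subadditive) auto
    also have "\<dots> < \<infinity>" using E_fin by simp
    finally have "emeasure M (E m \<union> E n) < \<infinity>" .
    moreover have "norm (\<psi> m (\<eta>, y) - \<psi> n (\<eta>, y)) \<le> ((real m + 1) + (real n + 1)) * indicator (E m \<union> E n) y"
      for \<eta> y
    proof -
      have "norm (\<psi> k (\<eta>, y)) \<le> (real k + 1) * indicator (E k) y" for k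
        using norm_trunc_le(1)[of k "\<phi> (\<eta>, y)"] by (auto simp: \<psi>_def indicator_def)
      from norm_triangle_le_diff[OF add_mono[OF this[of m] this[of n]]]
      show ?thesis
        by (rule order_trans) (auto simp: indicator_def)
    qed
    ultimately show ?thesis by (auto simp: finite_field_def)
  qed
  \<comment> \<open>Truncation and restriction to \<open>E n\<close> stay below multiples of the field and of its differences, as
    dominated convergence requires.\<close>
  have \<psi>_le: "norm (\<psi> n z) \<le> norm (\<phi> z)" for n z
    using norm_trunc_le(2)[of n "\<phi> z"] by (simp add: \<psi>_def indicator_def)
  have d\<psi>: "dfield (\<psi> n) x z = (indicator (E n) (snd z) :: real) *\<^sub>R
      (trunc n (\<phi> (add_point (N (fst z)) x, snd z)) - trunc n (\<phi> (N (fst z), snd z)))" for n x z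
    by (simp add: dfield_def \<psi>_def scaleR_diff_right)
  have d\<psi>_le: "norm (dfield (\<psi> n) x z) \<le> 2 * norm (dfield \<phi> x z)" for n x z
    using trunc_lipschitz[of n "\<phi> (add_point (N (fst z)) x, snd z)" "\<phi> (N (fst z), snd z)"]
    unfolding d\<psi> by (simp add: dfield_def indicator_def)
  have \<psi>_lim: "(\<lambda>n. \<psi> n (\<eta>, y)) \<longlonglongrightarrow> \<phi> (\<eta>, y)" if y: "y \<in> space M" for \<eta> y
  proof (rule Lim_transform_eventually[OF trunc_tendsto])
    show "\<forall>\<^sub>F n in sequentially. trunc n (\<phi> (\<eta>, y)) = \<psi> n (\<eta>, y)"
      using E_ev[OF y] by eventually_elim (simp add: \<psi>_def)
  qed
  have d\<psi>_lim: "(\<lambda>n. dfield (\<psi> n) x z) \<longlonglongrightarrow> dfield \<phi> x z" if "snd z \<in> space M" for x z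
    unfolding dfield_def by (intro tendsto_diff \<psi>_lim that)
  define a where "a n = (\<integral>z. (norm (\<psi> n (N (fst z), snd z) - \<phi> (N (fst z), snd z)))\<^sup>2 \<partial>PE)" for n
  define b where "b n = (\<integral>(x, z). (norm (dfield (\<psi> n) x z - dfield \<phi> x z))\<^sup>2 \<partial>EPE)" for n
  have sq: "(norm (p - q))\<^sup>2 \<le> 9 * (norm q)\<^sup>2" if "norm p \<le> 2 * norm q" for p q :: 'h
  proof -
    have "norm (p - q) \<le> 3 * norm q" using norm_triangle_ineq4[of p q] that by linarith
    then have "(norm (p - q))\<^sup>2 \<le> (3 * norm q)\<^sup>2" by (intro power_mono) auto
    then show ?thesis by (simp add: power_mult_distrib)
  qed
  have a_lim: "a \<longlonglongrightarrow> 0"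
  proof -
    have "a \<longlonglongrightarrow> (\<integral>z. (0::real) \<partial>PE)"
      unfolding a_def[abs_def]
    proof (rule integral_dominated_convergence)
      show "integrable PE (\<lambda>z. 9 * (norm (\<phi> (N (fst z), snd z)))\<^sup>2)"
        using \<phi>L by (simp add: L2_def)
      show "AE z in PE. (\<lambda>n. (norm (\<psi> n (N (fst z), snd z) - \<phi> (N (fst z), snd z)))\<^sup>2) \<longlonglongrightarrow> 0"
        using AE_space
      proof eventually_elim
        case (elim z)
        then have "(\<lambda>n. \<psi> n (N (fst z), snd z) - \<phi> (N (fst z), snd z)) \<longlonglongrightarrow> 0"
          using \<psi>_lim by (intro LIM_zero) (auto simp: space_pair_measure)
        then show ?case using tendsto_power[OF tendsto_norm, of _ 0 _ 2] by fastforce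
      qed
      show "AE z in PE. norm ((norm (\<psi> n (N (fst z), snd z) - \<phi> (N (fst z), snd z)))\<^sup>2) \<le>
          9 * (norm (\<phi> (N (fst z), snd z)))\<^sup>2" for n
      proof (rule AE_I2)
        fix z
        have "norm (\<psi> n (N (fst z), snd z)) \<le> 2 * norm (\<phi> (N (fst z), snd z))"
          using \<psi>_le[of n "(N (fst z), snd z)"] norm_ge_zero[of "\<phi> (N (fst z), snd z)"] by linarith
        from sq[OF this] show "norm ((norm (\<psi> n (N (fst z), snd z) - \<phi> (N (fst z), snd z)))\<^sup>2) \<le>
          9 * (norm (\<phi> (N (fst z), snd z)))\<^sup>2" by simp
      qed
    qed measurable
    then show ?thesis by simp
  qed
  have b_lim: "b \<longlonglongrightarrow> 0"
  proof -
    have "b \<longlonglongrightarrow> (\<integral>z. (0::real) \<partial>EPE)"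
      unfolding b_def[abs_def] case_prod_beta'
    proof (rule integral_dominated_convergence)
      show "integrable EPE (\<lambda>w. 9 * (norm (dfield \<phi> (fst w) (snd w)))\<^sup>2)"
        using D\<phi> by (simp add: L2_def case_prod_beta')
      have [measurable]: "(\<lambda>w. dfield \<phi> (fst w) (snd w)) \<in> borel_measurable EPE"
        "(\<lambda>w. dfield (\<psi> n) (fst w) (snd w)) \<in> borel_measurable EPE" for n
        using measurable_dfield[OF \<phi>] measurable_dfield[OF \<psi>m] by (simp_all add: case_prod_beta')
      show "(\<lambda>w. (norm (dfield (\<psi> n) (fst w) (snd w) - dfield \<phi> (fst w) (snd w)))\<^sup>2)
          \<in> borel_measurable EPE" for n
        by measurable
      show "AE w in EPE.
          (\<lambda>n. (norm (dfield (\<psi> n) (fst w) (snd w) - dfield \<phi> (fst w) (snd w)))\<^sup>2) \<longlonglongrightarrow> 0"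
        using AE_space
      proof eventually_elim
        case (elim w)
        then have "(\<lambda>n. dfield (\<psi> n) (fst w) (snd w) - dfield \<phi> (fst w) (snd w)) \<longlonglongrightarrow> 0"
          using d\<psi>_lim by (intro LIM_zero) (auto simp: space_pair_measure)
        then show ?case using tendsto_power[OF tendsto_norm, of _ 0 _ 2] by fastforce
      qed
      show "AE w in EPE. norm ((norm (dfield (\<psi> n) (fst w) (snd w) - dfield \<phi> (fst w) (snd w)))\<^sup>2) \<le>
          9 * (norm (dfield \<phi> (fst w) (snd w)))\<^sup>2" for n
        using sq[OF d\<psi>_le] by simp
    qed auto
    then show ?thesis by simp
  qed
  \<comment> \<open>Differences of approximations are again bounded and of finite intensity, so the energy
    estimate applies to them.\<close>
  have \<psi>L: "L2 PE (\<lambda>z. \<psi> n (N (fst z), snd z))" for n by (rule finite_field_L2[OF ff])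
  have dm: "(\<lambda>(x, z). dfield (\<psi> n) x z) \<in> borel_measurable EPE" for n
    by (rule measurable_dfield[OF \<psi>m])
  have D\<psi>: "L2 EPE (\<lambda>(x, z). dfield (\<psi> n) x z)" for n
    by (rule L2_bound[OF L2_scaleR[OF D\<phi>, of 2] dm]) (use d\<psi>_le in auto)
  define G where "G n = pathwise (\<psi> n)" for n
  have G: "strong_skorohod (\<psi> n) (G n)" for n
    unfolding G_def by (rule strong_skorohod_pathwise[OF ff])
  have GL: "L2 P (G n)" for n using G by (simp add: strong_skorohod_def)
  define e where "e n = 2 * (a n + b n)" for n
  have e_lim: "e \<longlonglongrightarrow> 0"
    using tendsto_mult[OF tendsto_const[of 2] tendsto_add[OF a_lim b_lim]] by (simp add: e_def[abs_def])
  have tri: "(norm (p - q))\<^sup>2 \<le> 2 * (norm (p - s))\<^sup>2 + 2 * (norm (q - s))\<^sup>2" for p q s :: 'h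
  proof -
    have "norm (p - q) \<le> norm (p - s) + norm (q - s)"
      using norm_triangle_ineq4[of "p - s" "q - s"] by simp
    then have "(norm (p - q))\<^sup>2 \<le> (norm (p - s) + norm (q - s))\<^sup>2" by (intro power_mono) auto
    also have "\<dots> \<le> 2 * (norm (p - s))\<^sup>2 + 2 * (norm (q - s))\<^sup>2"
      using sum_squares_bound[of "norm (p - s)" "norm (q - s)"] by (simp add: power2_sum)
    finally show ?thesis .
  qed
  have sum_bound: "(\<integral>w. (norm (f m w - f n w))\<^sup>2 \<partial>\<mu>) \<le>
      2 * (\<integral>w. (norm (f m w - g w))\<^sup>2 \<partial>\<mu>) + 2 * (\<integral>w. (norm (f n w - g w))\<^sup>2 \<partial>\<mu>)"
    if f: "\<And>n. L2 \<mu> (f n)" and g: "L2 \<mu> g" for \<mu> :: "'c measure" and f :: "nat \<Rightarrow> 'c \<Rightarrow> 'h" and g m n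
  proof -
    have "(\<integral>w. (norm (f m w - f n w))\<^sup>2 \<partial>\<mu>) \<le> (\<integral>w. 2 * (norm (f m w - g w))\<^sup>2 + 2 * (norm (f n w - g w))\<^sup>2 \<partial>\<mu>)"
      using L2_diff[OF f[of m] f[of n]] L2_diff[OF f[of m] g] L2_diff[OF f[of n] g] tri
      by (intro integral_mono) (auto simp: L2_def)
    also have "\<dots> = 2 * (\<integral>w. (norm (f m w - g w))\<^sup>2 \<partial>\<mu>) + 2 * (\<integral>w. (norm (f n w - g w))\<^sup>2 \<partial>\<mu>)"
      using L2_diff[OF f[of m] g] L2_diff[OF f[of n] g] by (simp add: L2_def)
    finally show ?thesis .
  qed
  have cauchy: "(\<integral>\<omega>. (norm (G m \<omega> - G n \<omega>))\<^sup>2 \<partial>P) \<le> e m + e n" for m n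
  proof -
    have dd: "dfield (\<lambda>z. \<psi> m z - \<psi> n z) x z = dfield (\<psi> m) x z - dfield (\<psi> n) x z" for x z
      by (simp add: dfield_def)
    have L: "L2 EPE (\<lambda>(x, z). dfield (\<lambda>z. \<psi> m z - \<psi> n z) x z)"
      using L2_diff[OF D\<psi>[of m] D\<psi>[of n]] by (simp add: dd case_prod_beta')
    have "(\<integral>\<omega>. (norm (G m \<omega> - G n \<omega>))\<^sup>2 \<partial>P) \<le>
        (\<integral>z. (norm (\<psi> m (N (fst z), snd z) - \<psi> n (N (fst z), snd z)))\<^sup>2 \<partial>PE) +
        (\<integral>(x, z). (norm (dfield (\<lambda>z. \<psi> m z - \<psi> n z) x z))\<^sup>2 \<partial>EPE)"
      by (rule energy_estimate[OF ff2 strong_skorohod_diff[OF G G] L])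
    moreover have "(\<integral>z. (norm (\<psi> m (N (fst z), snd z) - \<psi> n (N (fst z), snd z)))\<^sup>2 \<partial>PE) \<le> 2 * a m + 2 * a n"
      unfolding a_def by (rule sum_bound[OF \<psi>L \<phi>L])
    moreover have "(\<integral>(x, z). (norm (dfield (\<lambda>z. \<psi> m z - \<psi> n z) x z))\<^sup>2 \<partial>EPE) \<le> 2 * b m + 2 * b n"
    proof -
      have "(\<integral>w. (norm ((case w of (x, z) \<Rightarrow> dfield (\<psi> m) x z) - (case w of (x, z) \<Rightarrow> dfield (\<psi> n) x z)))\<^sup>2
          \<partial>EPE) \<le>
        2 * (\<integral>w. (norm ((case w of (x, z) \<Rightarrow> dfield (\<psi> m) x z) - (case w of (x, z) \<Rightarrow> dfield \<phi> x z)))\<^sup>2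
          \<partial>EPE) +
        2 * (\<integral>w. (norm ((case w of (x, z) \<Rightarrow> dfield (\<psi> n) x z) - (case w of (x, z) \<Rightarrow> dfield \<phi> x z)))\<^sup>2
          \<partial>EPE)"
        by (rule sum_bound[OF D\<psi> D\<phi>])
      then show ?thesis by (simp add: b_def dd case_prod_beta')
    qed
    ultimately show ?thesis by (simp add: e_def)
  qed
  obtain H where H: "L2 P H" "(\<lambda>n. \<integral>\<omega>. (norm (G n \<omega> - H \<omega>))\<^sup>2 \<partial>P) \<longlonglongrightarrow> 0"
    using P.L2_cauchy_limit[OF GL e_lim cauchy] by blast
  have "is_skorohod P M N (\<lambda>z. \<phi> (N (fst z), snd z)) H"
  proof (rule is_skorohodI[OF _ H(1)])
    fix f :: "'e measure \<Rightarrow> 'h"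
    assume f [measurable]: "f \<in> borel_measurable \<N>" and fL: "L2 P (\<lambda>\<omega>. f (N \<omega>))"
      and dfL: "L2 PE (dif f)"
    have "(\<lambda>n. \<integral>z. dif f z \<bullet> \<psi> n (N (fst z), snd z) \<partial>PE) \<longlonglongrightarrow>
        (\<integral>z. dif f z \<bullet> \<phi> (N (fst z), snd z) \<partial>PE)"
      by (rule L2_inner_tendsto[OF dfL \<psi>L \<phi>L a_lim[unfolded a_def[abs_def]]])
    moreover have "(\<integral>z. dif f z \<bullet> \<psi> n (N (fst z), snd z) \<partial>PE) = (\<integral>\<omega>. f (N \<omega>) \<bullet> G n \<omega> \<partial>P)" for n
      using G f fL by (simp add: strong_skorohod_def)
    ultimately have "(\<lambda>n. \<integral>\<omega>. f (N \<omega>) \<bullet> G n \<omega> \<partial>P) \<longlonglongrightarrow> (\<integral>z. dif f z \<bullet> \<phi> (N (fst z), snd z) \<partial>PE)"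
      by simp
    then show "(\<integral>z. dif f z \<bullet> \<phi> (N (fst z), snd z) \<partial>PE) = (\<integral>\<omega>. f (N \<omega>) \<bullet> H \<omega> \<partial>P)"
      using L2_inner_tendsto[OF fL GL H] by (rule LIMSEQ_unique)
  qed measurable
  then show ?thesis by blast
qed

end

section \<open>The commutation theorem\<close>

context poisson_process
begin

lemma is_skorohod_cong:
  fixes \<Phi> \<Psi> :: "'w \<times> 'e \<Rightarrow> 'h::{real_inner, banach, second_countable_topology}"
  assumes s: "is_skorohod P M N \<Phi> G"
    and [measurable]: "\<Phi> \<in> borel_measurable PE" "\<Psi> \<in> borel_measurable PE" "H \<in> borel_measurable P"
    and \<Phi>\<Psi>: "AE z in PE. \<Phi> z = \<Psi> z" and GH: "AE \<omega> in P. G \<omega> = H \<omega>"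
  shows "is_skorohod P M N \<Psi> H"
proof -
  have GL: "L2 P G" by (rule is_skorohod_L2[OF s])
  then have [measurable]: "G \<in> borel_measurable P" by measurable
  have "L2 P H" by (rule L2_cong_AE[OF GL _ GH]) measurable
  moreover have "(\<integral>z. diff_op P M N F z \<bullet> \<Psi> z \<partial>PE) = (\<integral>\<omega>. F \<omega> \<bullet> H \<omega> \<partial>P)"
    if F: "F \<in> sobolev 2 P M N" for F
  proof -
    have Fm [measurable]: "F \<in> borel_measurable P" using F by (simp add: sobolev_def Lp_def)
    have [measurable]: "diff_op P M N F \<in> borel_measurable PE" by (rule diff_op_measurable[OF Fm])
    have "(\<integral>z. diff_op P M N F z \<bullet> \<Psi> z \<partial>PE) = (\<integral>z. diff_op P M N F z \<bullet> \<Phi> z \<partial>PE)"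
      using \<Phi>\<Psi> by (intro integral_cong_AE) (auto elim: eventually_mono)
    also have "\<dots> = (\<integral>\<omega>. F \<omega> \<bullet> G \<omega> \<partial>P)" using s F by (simp add: is_skorohod_def)
    also have "\<dots> = (\<integral>\<omega>. F \<omega> \<bullet> H \<omega> \<partial>P)"
      using GH by (intro integral_cong_AE) (auto elim: eventually_mono)
    finally show ?thesis .
  qed
  ultimately show ?thesis by (simp add: is_skorohod_def Lp_2_iff)
qed

lemma Lp_norm_power: "Lp_norm 2 m f powr 2 = (\<integral>z. (norm (f z))\<^sup>2 \<partial>m)"
  by (simp add: Lp_norm_def powr_powr)

lemma sobolev_norm_power:
  "(sobolev_norm 2 P M N F)\<^sup>2 = (\<integral>\<omega>. (norm (F \<omega>))\<^sup>2 \<partial>P) + (\<integral>z. (norm (diff_op P M N F z))\<^sup>2 \<partial>PE)"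
  by (simp add: sobolev_norm_def Lp_norm_power powr_half_sqrt)

text \<open>For almost every \<open>y\<close> the difference of \<open>\<Phi>(y)\<close>, taken with a representative of its own, agrees with
  the difference of the joint representative.  Hence the Bochner norm of the Sobolev valued function
  controls \<open>D\<Phi>\<close> jointly in all variables.\<close>

lemma L2_sobolev_dfield:
  fixes \<phi> :: "'e measure \<times> 'e \<Rightarrow> 'h::{real_inner, banach, second_countable_topology}"
  assumes \<Phi>: "\<Phi> \<in> L2_sobolev P M N"
    and \<phi> [measurable]: "\<phi> \<in> borel_measurable NE"
    and ae: "AE z in PE. \<Phi> z = \<phi> (N (fst z), snd z)"
  shows "L2 PE (\<lambda>z. \<phi> (N (fst z), snd z))"
    and "L2 EPE (\<lambda>(x, z). dfield \<phi> x z)"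
proof -
  have \<Phi>L: "L2 PE \<Phi>" using \<Phi> by (simp add: L2_sobolev_def Lp_2_iff)
  then have [measurable]: "\<Phi> \<in> borel_measurable PE" by measurable
  show "L2 PE (\<lambda>z. \<phi> (N (fst z), snd z))"
    by (rule L2_cong_AE[OF \<Phi>L _ ae]) measurable
  have sob: "AE y in M. (\<lambda>\<omega>. \<Phi> (\<omega>, y)) \<in> sobolev 2 P M N"
    and fin: "(\<integral>\<^sup>+y. ennreal ((sobolev_norm 2 P M N (\<lambda>\<omega>. \<Phi> (\<omega>, y)))\<^sup>2) \<partial>M) < \<infinity>"
    using \<Phi> by (simp_all add: L2_sobolev_def)
  have "AE \<omega> in P. AE y in M. \<Phi> (\<omega>, y) = \<phi> (N \<omega>, y)"
    using PM.AE_pair[OF ae] by simp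
  then have "AE y in M. AE \<omega> in P. \<Phi> (\<omega>, y) = \<phi> (N \<omega>, y)"
    by (subst (asm) PM.AE_commute) (auto simp: measurable_sets)
  then have le: "AE y in M. (\<integral>\<^sup>+z. ennreal ((norm (dfield \<phi> (snd z) (fst z, y)))\<^sup>2) \<partial>PE) \<le>
      ennreal ((sobolev_norm 2 P M N (\<lambda>\<omega>. \<Phi> (\<omega>, y)))\<^sup>2)"
    using sob AE_space
  proof eventually_elim
    case (elim y)
    have Fm: "(\<lambda>\<omega>. \<Phi> (\<omega>, y)) \<in> borel_measurable P" using elim(3) by measurable
    have fm: "(\<lambda>\<eta>. \<phi> (\<eta>, y)) \<in> borel_measurable \<N>" using elim(3) by measurable
    have d: "AE z in PE. diff_op P M N (\<lambda>\<omega>. \<Phi> (\<omega>, y)) z = dif (\<lambda>\<eta>. \<phi> (\<eta>, y)) z"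
      by (rule diff_op_AE[OF Fm fm elim(1)])
    have "(\<integral>\<^sup>+z. ennreal ((norm (dfield \<phi> (snd z) (fst z, y)))\<^sup>2) \<partial>PE) =
        (\<integral>\<^sup>+z. ennreal ((norm (diff_op P M N (\<lambda>\<omega>. \<Phi> (\<omega>, y)) z))\<^sup>2) \<partial>PE)"
    proof (rule nn_integral_cong_AE)
      show "AE z in PE. ennreal ((norm (dfield \<phi> (snd z) (fst z, y)))\<^sup>2) =
          ennreal ((norm (diff_op P M N (\<lambda>\<omega>. \<Phi> (\<omega>, y)) z))\<^sup>2)"
        using d by eventually_elim (simp add: dif_def dfield_def)
    qed
    also have "\<dots> = ennreal (\<integral>z. (norm (diff_op P M N (\<lambda>\<omega>. \<Phi> (\<omega>, y)) z))\<^sup>2 \<partial>PE)"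
      using elim(2) by (intro nn_integral_eq_integral) (auto simp: sobolev_def Lp_2_iff L2_def)
    also have "\<dots> \<le> ennreal ((sobolev_norm 2 P M N (\<lambda>\<omega>. \<Phi> (\<omega>, y)))\<^sup>2)"
      unfolding sobolev_norm_power by (intro ennreal_leI) simp
    finally show ?case .
  qed
  have dm [measurable]: "(\<lambda>(x, z). dfield \<phi> x z) \<in> borel_measurable EPE"
    by (rule measurable_dfield[OF \<phi>])
  have sw: "(\<lambda>(x, \<omega>, y). (y, \<omega>, x)) \<in> EPE \<rightarrow>\<^sub>M EPE" by measurable
  define g where "g w = ennreal ((norm (case w of (x, z) \<Rightarrow> dfield \<phi> x z))\<^sup>2)" for w
  have gm [measurable]: "g \<in> borel_measurable EPE" unfolding g_def[abs_def] by measurable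
  have "(\<integral>\<^sup>+w. g w \<partial>EPE) =
      (\<integral>\<^sup>+w. g (case w of (x, \<omega>, y) \<Rightarrow> (y, \<omega>, x)) \<partial>EPE)"
    using nn_integral_distr[OF sw, of g] by (simp add: distr_swap_marks)
  also have "\<dots> = (\<integral>\<^sup>+y. \<integral>\<^sup>+z. g (case (y, z) of (x, \<omega>, y) \<Rightarrow> (y, \<omega>, x)) \<partial>PE \<partial>M)"
    by (rule PM.P.nn_integral_fst[symmetric]) (rule measurable_compose[OF sw gm])
  also have "\<dots> = (\<integral>\<^sup>+y. \<integral>\<^sup>+z. ennreal ((norm (dfield \<phi> (snd z) (fst z, y)))\<^sup>2) \<partial>PE \<partial>M)"
    by (simp add: g_def case_prod_beta')
  also have "\<dots> \<le> (\<integral>\<^sup>+y. ennreal ((sobolev_norm 2 P M N (\<lambda>\<omega>. \<Phi> (\<omega>, y)))\<^sup>2) \<partial>M)"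
    by (rule nn_integral_mono_AE[OF le])
  also note fin
  finally show "L2 EPE (\<lambda>(x, z). dfield \<phi> x z)"
    by (simp add: L2_iff_nn_integral[OF dm] g_def)
qed

theorem skorohod_commutation:
  fixes \<Phi> :: "'w \<times> 'e \<Rightarrow> 'h::{real_inner, banach, second_countable_topology}"
  assumes \<Phi>: "\<Phi> \<in> L2_sobolev P M N"
    and dom: "AE x in M. diff_field P M N \<Phi> x \<in> skorohod_dom P M N"
    and fin: "(\<integral>\<^sup>+ \<omega>. (\<integral>\<^sup>+ x. ennreal ((norm (skorohod_diff P M N \<Phi> (\<omega>, x)))\<^sup>2) \<partial>M) \<partial>P) < \<infinity>"
  shows "skorohod P M N \<Phi> \<in> sobolev 2 P M N"
    and "skorohod_diff P M N \<Phi> \<in> Lp 2 PE"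
    and "AE (\<omega>, x) in PE.
       diff_op P M N (skorohod P M N \<Phi>) (\<omega>, x) = skorohod_diff P M N \<Phi> (\<omega>, x) + \<Phi> (\<omega>, x)"
proof -
  have \<Phi>L: "L2 PE \<Phi>" using \<Phi> by (simp add: L2_sobolev_def Lp_2_iff)
  then have \<Phi>m [measurable]: "\<Phi> \<in> borel_measurable PE" by measurable
  define \<phi> where "\<phi> = (SOME \<phi>. \<phi> \<in> borel_measurable NE \<and>
      (AE (\<omega>, y) in PE. \<Phi> (\<omega>, y) = \<phi> (N \<omega>, y)))"
  have "\<phi> \<in> borel_measurable NE \<and> (AE (\<omega>, y) in PE. \<Phi> (\<omega>, y) = \<phi> (N \<omega>, y))"
    unfolding \<phi>_def by (rule someI_ex[OF N_representative_field[OF \<Phi>m]])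
  then have \<phi> [measurable]: "\<phi> \<in> borel_measurable NE"
    and \<Phi>\<phi>: "AE z in PE. \<Phi> z = \<phi> (N (fst z), snd z)"
    by (simp_all add: case_prod_beta')
  have field: "diff_field P M N \<Phi> x = dfield \<phi> x" for x
    unfolding diff_field_def \<phi>_def[symmetric] Let_def dfield_def[abs_def]
    by (simp add: fun_eq_iff)
  note L = L2_sobolev_dfield[OF \<Phi> \<phi> \<Phi>\<phi>]
  have \<phi>Nm: "(\<lambda>z. \<phi> (N (fst z), snd z)) \<in> borel_measurable PE" by measurable
  define G where "G = skorohod P M N \<Phi>"
  obtain H where H: "is_skorohod P M N (\<lambda>z. \<phi> (N (fst z), snd z)) H"
    using skorohod_exists[OF \<phi> L] by blast
  have "is_skorohod P M N \<Phi> H"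
    using \<Phi>\<phi> L2_measurable[OF is_skorohod_L2[OF H]]
    by (intro is_skorohod_cong[OF H \<phi>Nm \<Phi>m]) (auto elim: eventually_mono)
  then have G: "is_skorohod P M N \<Phi> G"
    unfolding G_def skorohod_def by (rule someI[where P="is_skorohod P M N \<Phi>"])
  have GL: "L2 P G" by (rule is_skorohod_L2[OF G])
  then have Gm: "G \<in> borel_measurable P" by measurable
  obtain \<gamma> where \<gamma> [measurable]: "\<gamma> \<in> borel_measurable \<N>" and G\<gamma>: "AE \<omega> in P. G \<omega> = \<gamma> (N \<omega>)"
    and DG: "diff_op P M N G = dif \<gamma>"
    using diff_op_measurable_representative[OF Gm] by blast
  have sk: "is_skorohod P M N (\<lambda>z. \<phi> (N (fst z), snd z)) (\<lambda>\<omega>. \<gamma> (N \<omega>))"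
    by (rule is_skorohod_cong[OF G \<Phi>m \<phi>Nm _ \<Phi>\<phi> G\<gamma>]) measurable
  define G' where "G' x = skorohod P M N (dfield \<phi> x)" for x
  have skx: "AE x in M. is_skorohod P M N (dfield \<phi> x) (G' x)"
    using dom
  proof eventually_elim
    case (elim x)
    then obtain H' where "is_skorohod P M N (dfield \<phi> x) H'"
      by (auto simp: field skorohod_dom_def)
    then show ?case unfolding G'_def skorohod_def by (rule someI[where P="is_skorohod P M N (dfield \<phi> x)"])
  qed
  have comm: "AE x in M. AE \<omega> in P. dif \<gamma> (\<omega>, x) = \<phi> (N \<omega>, x) + G' x \<omega>"
    by (rule commutation[OF \<phi> \<gamma> L sk skx])
  \<comment> \<open>The commutation relation itself provides the jointly measurable version of the integrals.\<close>
  define \<Psi> where "\<Psi> = skorohod_diff P M N \<Phi>"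
  have "\<Psi> \<in> borel_measurable PE \<and> (AE x in M. AE \<omega> in P. \<Psi> (\<omega>, x) = G' x \<omega>)"
    unfolding \<Psi>_def skorohod_diff_def joint_version_def field G'_def[symmetric]
  proof (rule someI[where P="\<lambda>\<Psi>. \<Psi> \<in> borel_measurable PE \<and> (AE x in M. AE \<omega> in P. \<Psi> (\<omega>, x) = G' x \<omega>)"])
    have "AE x in M. AE \<omega> in P. dif \<gamma> (\<omega>, x) - \<phi> (N \<omega>, x) = G' x \<omega>"
      using comm
    proof eventually_elim
      case (elim x)
      then show ?case by eventually_elim simp
    qed
    moreover have "(\<lambda>z. dif \<gamma> z - \<phi> (N (fst z), snd z)) \<in> borel_measurable PE" by measurable
    ultimately show "(\<lambda>z. dif \<gamma> z - \<phi> (N (fst z), snd z)) \<in> borel_measurable PE \<and>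
        (AE x in M. AE \<omega> in P. dif \<gamma> (\<omega>, x) - \<phi> (N (fst (\<omega>, x)), snd (\<omega>, x)) = G' x \<omega>)"
      by simp
  qed
  then have \<Psi>m [measurable]: "\<Psi> \<in> borel_measurable PE" and \<Psi>: "AE x in M. AE \<omega> in P. \<Psi> (\<omega>, x) = G' x \<omega>"
    by auto
  have "AE x in M. AE \<omega> in P. dif \<gamma> (\<omega>, x) = \<Psi> (\<omega>, x) + \<phi> (N \<omega>, x)"
    using comm \<Psi>
  proof eventually_elim
    case (elim x)
    then show ?case by eventually_elim simp
  qed
  then have "AE \<omega> in P. AE x in M. dif \<gamma> (\<omega>, x) = \<Psi> (\<omega>, x) + \<phi> (N \<omega>, x)"
    by (subst PM.AE_commute) auto
  then have "AE z in PE. dif \<gamma> z = \<Psi> z + \<phi> (N (fst z), snd z)"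
    by (intro PM.AE_pair_measure) auto
  then have eq: "AE z in PE. dif \<gamma> z = \<Psi> z + \<Phi> z"
    using \<Phi>\<phi> by eventually_elim simp
  have \<Psi>L: "L2 PE \<Psi>"
    unfolding L2_iff_nn_integral[OF \<Psi>m]
    using fin by (subst M.nn_integral_fst[symmetric]) (auto simp: \<Psi>_def[symmetric])
  have "L2 PE (dif \<gamma>)"
    by (rule L2_cong_AE[OF L2_add[OF \<Psi>L \<Phi>L]]) (use eq in \<open>auto elim: eventually_mono\<close>)
  then show "skorohod P M N \<Phi> \<in> sobolev 2 P M N"
    using GL by (simp add: sobolev_def Lp_2_iff G_def[symmetric] DG)
  show "skorohod_diff P M N \<Phi> \<in> Lp 2 PE"
    using \<Psi>L by (simp add: Lp_2_iff \<Psi>_def)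
  show "AE (\<omega>, x) in PE.
      diff_op P M N (skorohod P M N \<Phi>) (\<omega>, x) = skorohod_diff P M N \<Phi> (\<omega>, x) + \<Phi> (\<omega>, x)"
    using eq by (simp add: G_def[symmetric] DG \<Psi>_def[symmetric] case_prod_beta')
qed

end

text \<open>An injection into the reals with measurable inverse pulls a countable base of the topology back
  to a generator.\<close>

lemma borel_space_countably_generated:
  fixes M :: "'e measure"
  assumes "borel_space M"
  shows "\<exists>\<G>. countable \<G> \<and> sets M = sigma_sets (space M) \<G>"
proof -
  obtain g :: "'e \<Rightarrow> real" and B where B: "B \<in> sets borel" and bij: "bij_betw g (space M) B"
    and g: "g \<in> M \<rightarrow>\<^sub>M restrict_space borel B"
    and inv: "the_inv_into (space M) g \<in> restrict_space borel B \<rightarrow>\<^sub>M M"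
    using assms unfolding borel_space_def by blast
  obtain \<B> :: "real set set" where \<B>: "countable \<B>" "topological_basis \<B>"
    using ex_countable_basis by auto
  define \<G> where "\<G> = {g -` b \<inter> space M |b. b \<in> \<B>}"
  have g_borel: "g \<in> M \<rightarrow>\<^sub>M borel"
    using g by (simp add: measurable_restrict_space2_iff)
  have "sets M = {g -` C \<inter> space M |C. C \<in> sets borel}"
  proof (intro set_eqI iffI)
    fix T assume T: "T \<in> sets M"
    have "the_inv_into (space M) g -` T \<inter> space (restrict_space borel B) \<in> sets (restrict_space borel B)"
      by (rule measurable_sets[OF inv T])
    then obtain C where C: "C \<in> sets borel" "the_inv_into (space M) g -` T \<inter> B = B \<inter> C"
      using B by (auto simp: sets_restrict_space space_restrict_space)
    have "x \<in> T \<longleftrightarrow> g x \<in> C" if "x \<in> space M" for x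
    proof -
      have "g x \<in> B" "the_inv_into (space M) g (g x) = x"
        using bij that by (auto simp: bij_betw_def the_inv_into_f_f)
      moreover have "g x \<in> the_inv_into (space M) g -` T \<inter> B \<longleftrightarrow> g x \<in> B \<inter> C"
        using C(2) by simp
      ultimately show ?thesis by simp
    qed
    then have "T = g -` C \<inter> space M" using sets.sets_into_space[OF T] by auto
    then show "T \<in> {g -` C \<inter> space M |C. C \<in> sets borel}" using C(1) by auto
  qed (use measurable_sets[OF g_borel] in auto)
  also have "\<dots> = {g -` C \<inter> space M |C. C \<in> sigma_sets UNIV \<B>}"
    using borel_eq_countable_basis[OF \<B>] by (metis UNIV_I sets_measure_of subsetI top_greatest Pow_UNIV)
  also have "\<dots> = sigma_sets (space M) \<G>"
    unfolding \<G>_def by (rule sigma_sets_vimage_commute) auto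
  finally have "sets M = sigma_sets (space M) \<G>" .
  moreover have "countable \<G>"
    unfolding \<G>_def using \<B>(1) by (simp add: Setcompr_eq_image)
  ultimately show ?thesis by blast
qed

text \<open>The sets of a \<open>\<sigma>\<close>-finite cover cut the generators down to finite measure; they are members of the
  family themselves, so that the family exhausts the space.\<close>

lemma borel_space_atom_partitions:
  fixes M :: "'e measure"
  assumes "borel_space M" "sigma_finite_measure M"
  shows "\<exists>A. atom_partitions M A"
proof -
  obtain \<G> where \<G>: "countable \<G>" "sets M = sigma_sets (space M) \<G>"
    using borel_space_countably_generated[OF assms(1)] by blast
  obtain F :: "nat \<Rightarrow> 'e set" where F: "range F \<subseteq> sets M" "(\<Union>i. F i) = space M" "\<And>i. emeasure M (F i) \<noteq> \<infinity>"
    using sigma_finite_measure.sigma_finite[OF assms(2)] by metis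
  have \<G>_sets: "C \<in> sets M" if "C \<in> \<G>" for C using that \<G>(2) by auto
  define \<A> where "\<A> = range F \<union> (\<lambda>(i, C). F i \<inter> C) ` (UNIV \<times> \<G>)"
  have \<A>: "countable \<A>" "\<A> \<noteq> {}" unfolding \<A>_def using \<G>(1) by auto
  define A where "A = from_nat_into \<A>"
  have A: "range A = \<A>" unfolding A_def by (rule range_from_nat_into[OF \<A>(2,1)])
  have sets: "T \<in> sets M" if "T \<in> \<A>" for T using that F(1) \<G>_sets by (auto simp: \<A>_def)
  have "atom_partitions M A"
  proof
    show "A i \<in> sets M" for i using sets A by auto
    show "emeasure M (A i) < \<infinity>" for i
    proof -
      have "A i \<in> \<A>" using A by auto
      then obtain j where "A i \<subseteq> F j" by (auto simp: \<A>_def)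
      then have "emeasure M (A i) \<le> emeasure M (F j)" using F(1) by (intro emeasure_mono) auto
      then show ?thesis using F(3)[of j] by (auto simp: less_top[symmetric] top_unique)
    qed
    have "\<Union>\<A> = space M"
      using F(2) sets sets.sets_into_space by (auto simp: \<A>_def)
    then show "(\<Union>i. A i) = space M" using A by simp
    show "sets M = sigma_sets (space M) (range A)"
    proof
      have "C \<in> sigma_sets (space M) \<A>" if C: "C \<in> \<G>" for C
      proof -
        have "C = (\<Union>i. F i \<inter> C)" using F(2) sets.sets_into_space[OF \<G>_sets[OF C]] by auto
        moreover have "(\<Union>i. F i \<inter> C) \<in> sigma_sets (space M) \<A>"
          using C by (intro sigma_sets.Union sigma_sets.Basic) (auto simp: \<A>_def)
        ultimately show ?thesis by simp
      qed
      then show "sets M \<subseteq> sigma_sets (space M) (range A)"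
        unfolding \<G>(2) A by (intro sigma_sets_mono) auto
      show "sigma_sets (space M) (range A) \<subseteq> sets M"
        using sets unfolding A by (intro sets.sigma_sets_subset) auto
    qed
  qed
  then show ?thesis by blast
qed

theorem proposition3p23:
  fixes P :: "'w measure" and M :: "'e measure"
    and N :: "'w \<Rightarrow> 'e measure" and X :: "nat \<Rightarrow> 'w \<Rightarrow> 'e"
    and \<Phi> :: "'w \<times> 'e \<Rightarrow> 'h::{real_inner, banach, second_countable_topology}"
  assumes "sigma_finite_measure M"
    and "{(x, y) \<in> space M \<times> space M. x = y} \<in> sets (M \<Otimes>\<^sub>M M)"
    and "borel_space M"
    and "prob_space P" and "complete_measure P"
    and "poisson_random_measure P M N"
    and "point_representation P M N X"
    and "P = completion (restr_to_subalg P (vimage_algebra (space P) N (point_algebra M)))"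
    and "\<Phi> \<in> L2_sobolev P M N"
    and "AE x in M. diff_field P M N \<Phi> x \<in> skorohod_dom P M N"
    and "(\<integral>\<^sup>+ \<omega>. (\<integral>\<^sup>+ x. ennreal ((norm (skorohod_diff P M N \<Phi> (\<omega>, x)))\<^sup>2) \<partial>M) \<partial>P) < \<infinity>"
  shows "skorohod P M N \<Phi> \<in> sobolev 2 P M N \<and>
    skorohod_diff P M N \<Phi> \<in> Lp 2 (P \<Otimes>\<^sub>M M) \<and>
    (AE (\<omega>, x) in P \<Otimes>\<^sub>M M.
       diff_op P M N (skorohod P M N \<Phi>) (\<omega>, x) = skorohod_diff P M N \<Phi> (\<omega>, x) + \<Phi> (\<omega>, x))"
proof -
  obtain A where A: "atom_partitions M A"
    using borel_space_atom_partitions[OF assms(3,1)] by blast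
  interpret poisson_process M A P N X
    using A assms(1,4,6,7,8) by (intro poisson_process.intro poisson_process_axioms.intro)
  show ?thesis
    using skorohod_commutation[OF assms(9-11)] by blast
qed

end
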